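(* The category $\mathbf{fpRep}$ of representable cartesian multicategories is equivalent to the category $\mathbf{fpCat}$ of finite product categories and finite product preserving functors.
   Context: A cartesian structure on a multicategory $\mathcal M$ assigns, to every mapping $\sigma:\{1,\dots,n\}\to\{1,\dots,m\}$ and sequences of objects $A_1,\dots,A_n$ and $B_1,\dots,B_m$ with $B_{\sigma i}=A_i$, and every object $C$, a mapping $f\mapsto\sigma f$, $\mathcal M(A_1,\dots,A_n;C)\to\mathcal M(B_1,\dots,B_m;C)$, functorially ($\mathrm{id}f=f$, $\rho(\sigma f)=(\rho\sigma)f$) and compatibly with composition: (i) $f(\sigma_1f_1,\dots,\sigma_nf_n)=(\sigma_1+\cdots+\sigma_n)f(f_1,\dots,f_n)$, where $+$ is juxtaposition of mappings; (ii) $(\sigma f)(f_1,\dots,f_m)=\sigma'\big(f(f_{\sigma1},\dots,f_{\sigma n})\big)$, where $\sigma'$ maps the $k$-th place of the $i$-th block (the domain of $f_{\sigma i}$) to the $k$-th place of the $(\sigma i)$-th block of the concatenated domains of $f_1,\dots,f_m$. A cartesian multicategory is a multicategory with a cartesian structure; $\mathbf{fpMlt}$ is the category of cartesian multicategories and functors preserving the actions, $F(\sigma f)=\sigma(Ff)$. An arrow $u:A_1,\dots,A_n\to C$ is preuniversal if composition with $u$ gives a bijection $\mathcal M(C;B)\to\mathcal M(A_1,\dots,A_n;B)$ for every object $B$. $\mathcal M$ is representable if every finite sequence of objects is the domain of a preuniversal arrow and preuniversal arrows are closed under composition. $\mathbf{fpRep}$ is the full subcategory of $\mathbf{fpMlt}$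 on the cartesian multicategories that are representable. *)

theory Defs
  imports Main "HOL-Library.FuncSet"
begin

section \<open>Categories\<close>

record ('o, 'a) category =
  Ob :: "'o set"
  Ar :: "'a set"
  Dom :: "'a \<Rightarrow> 'o"
  Cod :: "'a \<Rightarrow> 'o"
  Ident :: "'o \<Rightarrow> 'a"
  Comp :: "'a \<Rightarrow> 'a \<Rightarrow> 'a"  \<comment> \<open>\<open>Comp C g f\<close> is \<open>g\<close> after \<open>f\<close>\<close>

definition hom :: "('o, 'a) category \<Rightarrow> 'o \<Rightarrow> 'o \<Rightarrow> 'a set" where
  "hom C A B = {f \<in> Ar C. Dom C f = A \<and> Cod C f = B}"

locale category =
  fixes C :: "('o, 'a) category"
  assumes dom_in_Ob: "f \<in> Ar C \<Longrightarrow> Dom C f \<in> Ob C"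
    and cod_in_Ob: "f \<in> Ar C \<Longrightarrow> Cod C f \<in> Ob C"
    and ident_in_hom: "A \<in> Ob C \<Longrightarrow> Ident C A \<in> hom C A A"
    and comp_in_hom: "\<lbrakk>f \<in> hom C A B; g \<in> hom C B D\<rbrakk> \<Longrightarrow> Comp C g f \<in> hom C A D"
    and ident_left: "f \<in> hom C A B \<Longrightarrow> Comp C (Ident C B) f = f"
    and ident_right: "f \<in> hom C A B \<Longrightarrow> Comp C f (Ident C A) = f"
    and comp_assoc: "\<lbrakk>f \<in> hom C A B; g \<in> hom C B D; h \<in> hom C D E\<rbrakk>
      \<Longrightarrow> Comp C h (Comp C g f) = Comp C (Comp C h g) f"

definition is_iso :: "('o, 'a) category \<Rightarrow> 'a \<Rightarrow> bool" where
  "is_iso C f \<longleftrightarrow> f \<in> Ar C \<and>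
    (\<exists>g \<in> hom C (Cod C f) (Dom C f).
      Comp C g f = Ident C (Dom C f) \<and> Comp C f g = Ident C (Cod C f))"

locale cat_functor = source: category C + target: category D
  for C :: "('o, 'a) category" and D :: "('p, 'b) category" +
  fixes Fo :: "'o \<Rightarrow> 'p" and Fa :: "'a \<Rightarrow> 'b"
  assumes map_Ob: "A \<in> Ob C \<Longrightarrow> Fo A \<in> Ob D"
    and map_hom: "f \<in> hom C A B \<Longrightarrow> Fa f \<in> hom D (Fo A) (Fo B)"
    and map_ident: "A \<in> Ob C \<Longrightarrow> Fa (Ident C A) = Ident D (Fo A)"
    and map_comp: "\<lbrakk>f \<in> hom C A B; g \<in> hom C B E\<rbrakk>
      \<Longrightarrow> Fa (Comp C g f) = Comp D (Fa g) (Fa f)"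

locale natural_iso =
    F: cat_functor C D Fo Fa + G: cat_functor C D Go Ga
  for C :: "('o, 'a) category" and D :: "('p, 'b) category"
    and Fo Fa Go Ga +
  fixes \<eta> :: "'o \<Rightarrow> 'b"
  assumes component: "A \<in> Ob C \<Longrightarrow> \<eta> A \<in> hom D (Fo A) (Go A)"
    and naturality: "f \<in> hom C A B \<Longrightarrow> Comp D (\<eta> B) (Fa f) = Comp D (Ga f) (\<eta> A)"
    and component_iso: "A \<in> Ob C \<Longrightarrow> is_iso D (\<eta> A)"

definition equivalent_categories ::
    "('o, 'a) category \<Rightarrow> ('p, 'b) category \<Rightarrow> bool" where
  "equivalent_categories C D \<longleftrightarrow>
    (\<exists>Fo Fa Go Ga \<eta> \<epsilon>.
      cat_functor C D Fo Fa \<and> cat_functor D C Go Ga \<and>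
      natural_iso C C id id (Go \<circ> Fo) (Ga \<circ> Fa) \<eta> \<and>
      natural_iso D D (Fo \<circ> Go) (Fa \<circ> Ga) id id \<epsilon>)"

definition full_subcategory :: "('o, 'a) category \<Rightarrow> 'o set \<Rightarrow> ('o, 'a) category" where
  "full_subcategory C S =
    C\<lparr>Ob := Ob C \<inter> S, Ar := {f \<in> Ar C. Dom C f \<in> S \<and> Cod C f \<in> S}\<rparr>"


section \<open>Categories of structures\<close>

text \<open>
  A morphism of structures records its source and target together with its action on
  objects and arrows. The two maps are required to be extensional, that is, \<open>undefined\<close>
  outside the objects and arrows of the source, so that equality of morphisms is
  equality of functors.
\<close>

record ('s, 'o, 'a) structure_map =
  Src :: 's
  Trg :: 's
  OMap :: "'o \<Rightarrow> 'o"
  AMap :: "'a \<Rightarrow> 'a"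

text \<open>
  The category with objects \<open>S\<close>, where \<open>obs X\<close> and \<open>ars X\<close> are the objects and arrows of
  the structure \<open>X\<close>, and \<open>P X Y Fo Fa\<close> says that \<open>(Fo, Fa)\<close> is a functor from \<open>X\<close> to \<open>Y\<close>
  of the required kind.
\<close>

definition structure_category ::
    "'s set \<Rightarrow> ('s \<Rightarrow> 'o set) \<Rightarrow> ('s \<Rightarrow> 'a set) \<Rightarrow>
     ('s \<Rightarrow> 's \<Rightarrow> ('o \<Rightarrow> 'o) \<Rightarrow> ('a \<Rightarrow> 'a) \<Rightarrow> bool) \<Rightarrow>
     ('s, ('s, 'o, 'a) structure_map) category" where
  "structure_category S obs ars P =
    \<lparr>Ob = S,
     Ar = {F. Src F \<in> S \<and> Trg F \<in> S \<and> P (Src F) (Trg F) (OMap F) (AMap F) \<and>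
       OMap F \<in> extensional (obs (Src F)) \<and> AMap F \<in> extensional (ars (Src F))},
     Dom = Src,
     Cod = Trg,
     Ident = (\<lambda>X. \<lparr>Src = X, Trg = X,
       OMap = (\<lambda>A \<in> obs X. A), AMap = (\<lambda>f \<in> ars X. f)\<rparr>),
     Comp = (\<lambda>G F. \<lparr>Src = Src F, Trg = Trg G,
       OMap = compose (obs (Src F)) (OMap G) (OMap F),
       AMap = compose (ars (Src F)) (AMap G) (AMap F)\<rparr>)\<rparr>"


section \<open>Finite product categories\<close>

definition is_product ::
    "('o, 'a) category \<Rightarrow> 'o list \<Rightarrow> 'o \<Rightarrow> 'a list \<Rightarrow> bool" where
  "is_product C As P ps \<longleftrightarrow>
    P \<in> Ob C \<and> list_all2 (\<lambda>p A. p \<in> hom C P A) ps As \<and>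
    (\<forall>X \<in> Ob C. \<forall>fs. list_all2 (\<lambda>f A. f \<in> hom C X A) fs As \<longrightarrow>
      (\<exists>!h. h \<in> hom C X P \<and> map (\<lambda>p. Comp C p h) ps = fs))"

locale finite_product_category = category C for C :: "('o, 'a) category" +
  assumes has_products: "set As \<subseteq> Ob C \<Longrightarrow> \<exists>P ps. is_product C As P ps"

locale finite_product_functor = cat_functor C D Fo Fa
  for C :: "('o, 'a) category" and D :: "('p, 'b) category" and Fo Fa +
  assumes preserves_products: "\<lbrakk>set As \<subseteq> Ob C; is_product C As P ps\<rbrakk>
    \<Longrightarrow> is_product D (map Fo As) (Fo P) (map Fa ps)"

definition fpCat ::
    "(('o, 'a) category, (('o, 'a) category, 'o, 'a) structure_map) category" where
  "fpCat = structure_category {C. finite_product_category C} Ob Ar finite_product_functor"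


section \<open>Multicategories\<close>

record ('o, 'a) multicategory =
  mOb :: "'o set"
  mAr :: "'a set"
  mDom :: "'a \<Rightarrow> 'o list"
  mCod :: "'a \<Rightarrow> 'o"
  mIdent :: "'o \<Rightarrow> 'a"
  mComp :: "'a \<Rightarrow> 'a list \<Rightarrow> 'a"  \<comment> \<open>\<open>mComp M f [f\<^sub>1, \<dots>, f\<^sub>n]\<close> is \<open>f(f\<^sub>1, \<dots>, f\<^sub>n)\<close>\<close>

definition mhom :: "('o, 'a, 'm) multicategory_scheme \<Rightarrow> 'o list \<Rightarrow> 'o \<Rightarrow> 'a set" where
  "mhom M As B = {f \<in> mAr M. mDom M f = As \<and> mCod M f = B}"

definition composable :: "('o, 'a, 'm) multicategory_scheme \<Rightarrow> 'a \<Rightarrow> 'a list \<Rightarrow> bool" where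
  "composable M f gs \<longleftrightarrow> f \<in> mAr M \<and> set gs \<subseteq> mAr M \<and> map (mCod M) gs = mDom M f"

locale multicategory =
  fixes M :: "('o, 'a, 'm) multicategory_scheme"
  assumes mdom_in_Ob: "f \<in> mAr M \<Longrightarrow> set (mDom M f) \<subseteq> mOb M"
    and mcod_in_Ob: "f \<in> mAr M \<Longrightarrow> mCod M f \<in> mOb M"
    and mident_in_hom: "A \<in> mOb M \<Longrightarrow> mIdent M A \<in> mhom M [A] A"
    and mcomp_in_hom: "composable M f gs
      \<Longrightarrow> mComp M f gs \<in> mhom M (concat (map (mDom M) gs)) (mCod M f)"
    and mident_left: "f \<in> mAr M \<Longrightarrow> mComp M (mIdent M (mCod M f)) [f] = f"
    and mident_right: "f \<in> mAr M \<Longrightarrow> mComp M f (map (mIdent M) (mDom M f)) = f"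
    and mcomp_assoc: "\<lbrakk>composable M f gs; list_all2 (composable M) gs hss\<rbrakk>
      \<Longrightarrow> mComp M (mComp M f gs) (concat hss) = mComp M f (map2 (mComp M) gs hss)"

definition preuniversal :: "('o, 'a, 'm) multicategory_scheme \<Rightarrow> 'a \<Rightarrow> bool" where
  "preuniversal M u \<longleftrightarrow> u \<in> mAr M \<and>
    (\<forall>B \<in> mOb M. bij_betw (\<lambda>g. mComp M g [u]) (mhom M [mCod M u] B) (mhom M (mDom M u) B))"

definition representable :: "('o, 'a, 'm) multicategory_scheme \<Rightarrow> bool" where
  "representable M \<longleftrightarrow>
    (\<forall>As. set As \<subseteq> mOb M \<longrightarrow> (\<exists>u. preuniversal M u \<and> mDom M u = As)) \<and>
    (\<forall>u us. composable M u us \<and> preuniversal M u \<and> (\<forall>v \<in> set us. preuniversal M v)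
      \<longrightarrow> preuniversal M (mComp M u us))"

locale multicategory_functor = source: multicategory M + target: multicategory N
  for M :: "('o, 'a, 'm) multicategory_scheme"
    and N :: "('p, 'b, 'n) multicategory_scheme" +
  fixes Fo :: "'o \<Rightarrow> 'p" and Fa :: "'a \<Rightarrow> 'b"
  assumes map_mOb: "A \<in> mOb M \<Longrightarrow> Fo A \<in> mOb N"
    and map_mhom: "f \<in> mhom M As B \<Longrightarrow> Fa f \<in> mhom N (map Fo As) (Fo B)"
    and map_mident: "A \<in> mOb M \<Longrightarrow> Fa (mIdent M A) = mIdent N (Fo A)"
    and map_mcomp: "composable M f gs \<Longrightarrow> Fa (mComp M f gs) = mComp N (Fa f) (map Fa gs)"


section \<open>Cartesian multicategories\<close>

text \<open>
  A mapping \<open>\<sigma> : {0..<n} \<rightarrow> {0..<m}\<close> is encoded as the list of its values, so that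
  \<open>length \<sigma> = n\<close>, \<open>\<sigma> ! i\<close> is the value at \<open>i\<close>, the identity is \<open>[0..<n]\<close> and the
  composite of \<open>\<rho>\<close> after \<open>\<sigma>\<close> is \<open>map ((!) \<rho>) \<sigma>\<close>. Positions are counted from \<open>0\<close>.
\<close>

text \<open>\<open>reindexing \<sigma> As Bs\<close> says that \<open>\<sigma>\<close> maps the positions of \<open>As\<close> to those of \<open>Bs\<close> and
  that \<open>Bs ! (\<sigma> ! i) = As ! i\<close> for each \<open>i\<close>.\<close>

definition reindexing :: "nat list \<Rightarrow> 'o list \<Rightarrow> 'o list \<Rightarrow> bool" where
  "reindexing \<sigma> As Bs \<longleftrightarrow> set \<sigma> \<subseteq> {..<length Bs} \<and> map ((!) Bs) \<sigma> = As"

text \<open>The first position of block \<open>i\<close> in a concatenation of blocks of lengths \<open>ms\<close>.\<close>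

definition block_start :: "nat list \<Rightarrow> nat \<Rightarrow> nat" where
  "block_start ms i = sum_list (take i ms)"

text \<open>The juxtaposition \<open>\<sigma>\<^sub>1 + \<dots> + \<sigma>\<^sub>n\<close>, where \<open>ms\<close> lists the sizes of the codomains.\<close>

definition juxtaposition :: "nat list \<Rightarrow> nat list list \<Rightarrow> nat list" where
  "juxtaposition ms \<sigma>s =
    concat (map (\<lambda>i. map (\<lambda>k. block_start ms i + k) (\<sigma>s ! i)) [0..<length \<sigma>s])"

text \<open>
  The mapping \<open>\<sigma>'\<close> that sends the \<open>k\<close>-th place of the \<open>i\<close>-th block, which has length
  \<open>ms ! (\<sigma> ! i)\<close>, to the \<open>k\<close>-th place of the \<open>(\<sigma> ! i)\<close>-th block of a concatenation of
  blocks of lengths \<open>ms\<close>.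
\<close>

definition block_mapping :: "nat list \<Rightarrow> nat list \<Rightarrow> nat list" where
  "block_mapping ms \<sigma> =
    concat (map (\<lambda>j. map (\<lambda>k. block_start ms j + k) [0..<ms ! j]) \<sigma>)"

record ('o, 'a) cartesian_multicategory = "('o, 'a) multicategory" +
  mAct :: "'o list \<Rightarrow> nat list \<Rightarrow> 'a \<Rightarrow> 'a"
    \<comment> \<open>\<open>mAct M Bs \<sigma> f\<close> is \<open>\<sigma>f\<close> with domain \<open>Bs\<close>\<close>

locale cartesian_multicategory = multicategory M
  for M :: "('o, 'a) cartesian_multicategory" +
  assumes act_in_hom: "\<lbrakk>f \<in> mAr M; set Bs \<subseteq> mOb M; reindexing \<sigma> (mDom M f) Bs\<rbrakk>
      \<Longrightarrow> mAct M Bs \<sigma> f \<in> mhom M Bs (mCod M f)"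
    and act_id: "f \<in> mAr M \<Longrightarrow> mAct M (mDom M f) [0..<length (mDom M f)] f = f"
    and act_act: "\<lbrakk>f \<in> mAr M; set Bs \<subseteq> mOb M; reindexing \<sigma> (mDom M f) Bs;
        set Cs \<subseteq> mOb M; reindexing \<rho> Bs Cs\<rbrakk>
      \<Longrightarrow> mAct M Cs \<rho> (mAct M Bs \<sigma> f) = mAct M Cs (map ((!) \<rho>) \<sigma>) f"
    and comp_act: "\<lbrakk>composable M f gs; length Bss = length gs; length \<sigma>s = length gs;
        \<forall>i < length gs. set (Bss ! i) \<subseteq> mOb M \<and>
          reindexing (\<sigma>s ! i) (mDom M (gs ! i)) (Bss ! i)\<rbrakk>
      \<Longrightarrow> mComp M f (map (\<lambda>i. mAct M (Bss ! i) (\<sigma>s ! i) (gs ! i)) [0..<length gs]) =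
          mAct M (concat Bss) (juxtaposition (map length Bss) \<sigma>s) (mComp M f gs)"
    and act_comp: "\<lbrakk>f \<in> mAr M; set gs \<subseteq> mAr M; reindexing \<sigma> (mDom M f) (map (mCod M) gs)\<rbrakk>
      \<Longrightarrow> mComp M (mAct M (map (mCod M) gs) \<sigma> f) gs =
          mAct M (concat (map (mDom M) gs))
            (block_mapping (map (\<lambda>g. length (mDom M g)) gs) \<sigma>)
            (mComp M f (map ((!) gs) \<sigma>))"

locale cartesian_functor = multicategory_functor M N Fo Fa +
    source: cartesian_multicategory M + target: cartesian_multicategory N
  for M :: "('o, 'a) cartesian_multicategory"
    and N :: "('p, 'b) cartesian_multicategory" and Fo Fa +
  assumes map_act: "\<lbrakk>f \<in> mAr M; set Bs \<subseteq> mOb M; reindexing \<sigma> (mDom M f) Bs\<rbrakk>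
    \<Longrightarrow> Fa (mAct M Bs \<sigma> f) = mAct N (map Fo Bs) \<sigma> (Fa f)"

text \<open>
  The types \<open>'o\<close> and \<open>'a\<close> play the role of the universe: the objects of \<open>fpCat\<close>, \<open>fpMlt\<close> and
  \<open>fpRep\<close> are the structures whose objects and arrows form subsets of these types. A
  representable multicategory has infinitely many arrows, as its arrows with distinct
  domains are distinct, so \<open>fpRep\<close> is empty when \<open>'a\<close> is finite.
\<close>

definition fpMlt ::
    "(('o, 'a) cartesian_multicategory,
      (('o, 'a) cartesian_multicategory, 'o, 'a) structure_map) category" where
  "fpMlt = structure_category {M. cartesian_multicategory M} mOb mAr cartesian_functor"

definition fpRep ::
    "(('o, 'a) cartesian_multicategory,
      (('o, 'a) cartesian_multicategory, 'o, 'a) structure_map) category" where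
  "fpRep = full_subcategory fpMlt {M. representable M}"

end

theory Submission
  imports Defs
begin

text \<open>
  In a cartesian multicategory, composing \<open>f\<close> with arrows \<open>g\<^sub>1, \<dots>, g\<^sub>n\<close> of common domain
  \<open>\<Gamma>\<close> and then contracting the copies of \<open>\<Gamma>\<close> gives a substitution \<open>f[g\<^sub>1, \<dots>, g\<^sub>n]\<close>, and
  acting on identities gives projections \<open>\<pi>\<^sub>i : \<Gamma> \<rightarrow> \<Gamma>\<^sub>i\<close>. These satisfy the laws of an abstract
  clone and in turn determine composition and action. An arrow \<open>u : A\<^sub>1, \<dots>, A\<^sub>n \<rightarrow> P\<close> is preuniversal
  iff there are \<open>p\<^sub>i : P \<rightarrow> A\<^sub>i\<close> with \<open>p\<^sub>i u = \<pi>\<^sub>i\<close> and \<open>u[p\<^sub>1, \<dots>, p\<^sub>n] = id\<close>; these equations are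
  preserved by cartesian functors, and they make \<open>P\<close> a product of the \<open>A\<^sub>i\<close> in the category of unary
  arrows. Hence taking unary arrows is a functor from \<open>fpRep\<close> to \<open>fpCat\<close>. It is faithful because
  \<open>f = f[p\<^sub>1, \<dots>, p\<^sub>n] u\<close>, and full because a finite product preserving functor \<open>H\<close> extends to the
  unique \<open>F\<close> with \<open>(F f)[H x\<^sub>1, \<dots>, H x\<^sub>n] = H (f[x\<^sub>1, \<dots>, x\<^sub>n])\<close> for all \<open>x\<^sub>i : X \<rightarrow> A\<^sub>i\<close>. It is
  essentially surjective because natural transformations from \<open>C(-, A\<^sub>1) \<times> \<dots> \<times> C(-, A\<^sub>n)\<close> to
  \<open>C(-, B)\<close> form a cartesian multicategory whose unary part is \<open>C\<close>, by the Yoneda lemma.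
\<close>


section \<open>Categories\<close>

text \<open>Composition in a multicategory concatenates domains, so the laws of a cartesian
  structure speak of blocks inside concatenated lists. Substitution keeps one fixed context, and
  most calculations with it are equations without block arithmetic. Preuniversality quantifies over
  all arrows and in that form does not pass along a functor. The equations that replace it say that
  \<open>u\<close> and \<open>ps\<close> are mutually inverse between the list \<open>As\<close> and
  the list \<open>[P]\<close>; inverses compose, which is how closure of preuniversal arrows under
  composition is obtained. The obstacle in the last step is that a multiarrow must remember its
  domain and still be an element of \<open>'a\<close>. The type \<open>'o\<close> may be larger than
  \<open>'a\<close>, so lists over \<open>'o\<close> cannot be coded in general; but the objects of
  a given category inject into \<open>'a\<close> through their identities, and an infinite
  \<open>'a\<close> has room for a list over \<open>'a\<close> together with an element of
  \<open>'a\<close>. For finite \<open>'a\<close> the equivalence fails, since \<open>fpRep\<close>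
  is then empty while \<open>fpCat\<close> contains a category with one arrow.\<close>

lemma homD:
  assumes "f \<in> hom C A B"
  shows "f \<in> Ar C" "Dom C f = A" "Cod C f = B"
  using assms by (simp_all add: hom_def)

lemma (in category) hom_Ob:
  assumes "f \<in> hom C A B"
  shows "A \<in> Ob C" "B \<in> Ob C"
  using assms dom_in_Ob cod_in_Ob by (auto simp: hom_def)

lemma is_isoI:
  assumes "f \<in> hom C A B" "g \<in> hom C B A" "Comp C g f = Ident C A" "Comp C f g = Ident C B"
  shows "is_iso C f"
  using assms unfolding is_iso_def by (auto simp: hom_def)

lemma is_isoE:
  assumes "is_iso C f" "f \<in> hom C A B"
  obtains g where "g \<in> hom C B A" "Comp C g f = Ident C A" "Comp C f g = Ident C B"
  using assms unfolding is_iso_def by (auto simp: hom_def)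

lemma (in category) id_functor: "cat_functor C C id id"
  by unfold_locales auto

lemma functor_comp:
  assumes "cat_functor C D Fo Fa" "cat_functor D E Go Ga"
  shows "cat_functor C E (Go \<circ> Fo) (Ga \<circ> Fa)"
proof -
  interpret F: cat_functor C D Fo Fa by fact
  interpret G: cat_functor D E Go Ga by fact
  show ?thesis
  proof
    fix f g A B X assume "f \<in> hom C A B" "g \<in> hom C B X"
    then show "(Ga \<circ> Fa) (Comp C g f) = Comp E ((Ga \<circ> Fa) g) ((Ga \<circ> Fa) f)"
      using F.map_comp G.map_comp F.map_hom by (metis comp_apply)
  qed (auto simp: F.map_Ob G.map_Ob F.map_hom G.map_hom F.map_ident G.map_ident)
qed

text \<open>The quasi-inverse chooses for each \<open>Y\<close> an isomorphism \<open>e Y\<close>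
  from the image of some object, and sends \<open>g\<close> to the preimage of its conjugate by
  \<open>e\<close>. Equations in \<open>C\<close> are proved after applying \<open>Fa\<close>, by
  faithfulness, and if needed after cancelling \<open>e Y\<close> on the left. The counit is
  \<open>e\<close>, and the unit is lifted from its inverse.\<close>

lemma equivalent_if_fully_faithful_essentially_surjective:
  assumes "cat_functor C D Fo Fa"
    and faithful: "\<And>A B f g. \<lbrakk>f \<in> hom C A B; g \<in> hom C A B; Fa f = Fa g\<rbrakk> \<Longrightarrow> f = g"
    and full: "\<And>A B h. \<lbrakk>A \<in> Ob C; B \<in> Ob C; h \<in> hom D (Fo A) (Fo B)\<rbrakk>
      \<Longrightarrow> \<exists>f \<in> hom C A B. Fa f = h"
    and ess_surj: "\<And>Y. Y \<in> Ob D \<Longrightarrow> \<exists>A \<in> Ob C. \<exists>e \<in> hom D (Fo A) Y. is_iso D e"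
  shows "equivalent_categories C D"
proof -
  interpret F: cat_functor C D Fo Fa by fact
  have "\<forall>Y. \<exists>A e e'. Y \<in> Ob D \<longrightarrow> A \<in> Ob C \<and> e \<in> hom D (Fo A) Y \<and> e' \<in> hom D Y (Fo A) \<and>
    Comp D e' e = Ident D (Fo A) \<and> Comp D e e' = Ident D Y"
    using ess_surj by (metis is_isoE)
  then obtain Go e e' where G: "\<And>Y. Y \<in> Ob D \<Longrightarrow> Go Y \<in> Ob C"
    and e: "\<And>Y. Y \<in> Ob D \<Longrightarrow> e Y \<in> hom D (Fo (Go Y)) Y"
    and e': "\<And>Y. Y \<in> Ob D \<Longrightarrow> e' Y \<in> hom D Y (Fo (Go Y))"
    and e'e: "\<And>Y. Y \<in> Ob D \<Longrightarrow> Comp D (e' Y) (e Y) = Ident D (Fo (Go Y))"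
    and ee': "\<And>Y. Y \<in> Ob D \<Longrightarrow> Comp D (e Y) (e' Y) = Ident D Y"
    by metis
  define lift where "lift A B h = (SOME f. f \<in> hom C A B \<and> Fa f = h)" for A B h
  have lift: "lift A B h \<in> hom C A B" "Fa (lift A B h) = h"
    if "A \<in> Ob C" "B \<in> Ob C" "h \<in> hom D (Fo A) (Fo B)" for A B h
    using someI_ex[of "\<lambda>f. f \<in> hom C A B \<and> Fa f = h"] full[OF that]
    unfolding lift_def by blast+
  define Ga where "Ga g = lift (Go (Dom D g)) (Go (Cod D g))
    (Comp D (e' (Cod D g)) (Comp D g (e (Dom D g))))" for g
  have Ga: "Ga g \<in> hom C (Go X) (Go Y)" "Fa (Ga g) = Comp D (e' Y) (Comp D g (e X))"
    if g: "g \<in> hom D X Y" for g X Y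
  proof -
    have XY: "X \<in> Ob D" "Y \<in> Ob D" using F.target.hom_Ob g by auto
    have "Comp D (e' Y) (Comp D g (e X)) \<in> hom D (Fo (Go X)) (Fo (Go Y))"
      using F.target.comp_in_hom e[OF XY(1)] e'[OF XY(2)] g by blast
    note lift[OF G[OF XY(1)] G[OF XY(2)] this]
    then show "Ga g \<in> hom C (Go X) (Go Y)" "Fa (Ga g) = Comp D (e' Y) (Comp D g (e X))"
      using g by (simp_all add: Ga_def hom_def)
  qed
  have e_nat: "Comp D (e Y) (Fa (Ga g)) = Comp D g (e X)" if g: "g \<in> hom D X Y" for g X Y
  proof -
    have XY: "X \<in> Ob D" "Y \<in> Ob D" using F.target.hom_Ob g by auto
    have "Comp D g (e X) \<in> hom D (Fo (Go X)) Y" using F.target.comp_in_hom e XY g by blast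
    then show ?thesis
      using F.target.comp_assoc[OF _ e'[OF XY(2)] e[OF XY(2)]] ee'[OF XY(2)] Ga(2)[OF g]
        F.target.ident_left by metis
  qed
  have e_cancel: "x = y" if "Comp D (e Y) x = Comp D (e Y) y" "Y \<in> Ob D"
    "x \<in> hom D Z (Fo (Go Y))" "y \<in> hom D Z (Fo (Go Y))" for x y Y Z
    using that F.target.comp_assoc[OF _ e e'] e'e F.target.ident_left by metis
  have G_functor: "cat_functor D C Go Ga"
  proof
    fix Y assume Y: "Y \<in> Ob D"
    note idY = F.target.ident_in_hom[OF Y]
    have "Fa (Ga (Ident D Y)) = Fa (Ident C (Go Y))"
      using Ga(2)[OF idY] e'e[OF Y] F.target.ident_left[OF e[OF Y]] F.map_ident[OF G[OF Y]] by simp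
    then show "Ga (Ident D Y) = Ident C (Go Y)"
      using faithful[OF Ga(1)[OF idY] F.source.ident_in_hom[OF G[OF Y]]] by simp
  next
    fix f X Y g Z assume f: "f \<in> hom D X Y" and g: "g \<in> hom D Y Z"
    have Z: "Z \<in> Ob D" using F.target.hom_Ob g by auto
    have X: "X \<in> Ob D" using F.target.hom_Ob f by auto
    have Y: "Y \<in> Ob D" using F.target.hom_Ob f by auto
    have gf: "Comp D g f \<in> hom D X Z" using F.target.comp_in_hom f g by auto
    note Gf = Ga(1)[OF f] and Gg = Ga(1)[OF g]
    have "Comp D (e Z) (Fa (Ga (Comp D g f))) = Comp D (Comp D g f) (e X)"
      using e_nat gf by auto
    also have "\<dots> = Comp D g (Comp D (e Y) (Fa (Ga f)))"
      using F.target.comp_assoc[OF e[OF X] f g] e_nat[OF f] by simp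
    also have "\<dots> = Comp D (Comp D (e Z) (Fa (Ga g))) (Fa (Ga f))"
      using F.target.comp_assoc[OF F.map_hom[OF Gf] e[OF Y] g] e_nat[OF g] by simp
    also have "\<dots> = Comp D (e Z) (Fa (Comp C (Ga g) (Ga f)))"
      using F.target.comp_assoc[OF F.map_hom[OF Gf] F.map_hom[OF Gg] e[OF Z]] F.map_comp[OF Gf Gg]
      by simp
    finally have "Fa (Ga (Comp D g f)) = Fa (Comp C (Ga g) (Ga f))"
      
      using e_cancel[OF _ Z F.map_hom[OF Ga(1)[OF gf]] F.map_hom[OF F.source.comp_in_hom[OF Gf Gg]]]
      by simp
    then show "Ga (Comp D g f) = Comp C (Ga g) (Ga f)"
      using faithful[OF Ga(1)[OF gf] F.source.comp_in_hom[OF Gf Gg]] by simp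
  qed (use G Ga in auto)
  interpret G: cat_functor D C Go Ga by fact
  define \<eta> where "\<eta> A = lift A (Go (Fo A)) (e' (Fo A))" for A
  have \<eta>: "\<eta> A \<in> hom C A (Go (Fo A))" "Fa (\<eta> A) = e' (Fo A)" if "A \<in> Ob C" for A
    unfolding \<eta>_def using that lift G F.map_Ob e' by blast+
  have "natural_iso C C id id (Go \<circ> Fo) (Ga \<circ> Fa) \<eta>"
  proof (intro natural_iso.intro F.source.id_functor functor_comp[OF F.cat_functor_axioms G_functor],
      unfold_locales)
    fix A assume A: "A \<in> Ob C"
    then show "\<eta> A \<in> hom C (id A) ((Go \<circ> Fo) A)" using \<eta> by simp
    \<comment> \<open>Candidate inverse of \<open>\<eta> A\<close>: the preimage of
      \<open>e (Fo A)\<close>. Both inverse laws hold after applying \<open>Fa\<close>.\<close>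
    define k where "k = lift (Go (Fo A)) A (e (Fo A))"
    have k: "k \<in> hom C (Go (Fo A)) A" "Fa k = e (Fo A)"
      unfolding k_def using A lift G F.map_Ob e by blast+
    note FA = F.map_Ob[OF A]
    have "Fa (Comp C k (\<eta> A)) = Fa (Ident C A)"
      using F.map_comp[OF \<eta>(1)[OF A] k(1)] k(2) \<eta>(2)[OF A] ee' FA F.map_ident A by simp
    moreover have "Fa (Comp C (\<eta> A) k) = Fa (Ident C (Go (Fo A)))"
      using F.map_comp[OF k(1) \<eta>(1)[OF A]] k(2) \<eta>(2)[OF A] e'e FA F.map_ident G by simp
    ultimately have "Comp C k (\<eta> A) = Ident C A" "Comp C (\<eta> A) k = Ident C (Go (Fo A))"
      using faithful[OF F.source.comp_in_hom[OF \<eta>(1)[OF A] k(1)] F.source.ident_in_hom[OF A]]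
        faithful[OF F.source.comp_in_hom[OF k(1) \<eta>(1)[OF A]] F.source.ident_in_hom[OF G[OF FA]]]
      by simp_all
    then show "is_iso C (\<eta> A)" using is_isoI[OF \<eta>(1)[OF A] k(1)] by simp
  next
    fix f A B assume f: "f \<in> hom C A B"
    then have A: "A \<in> Ob C" and B: "B \<in> Ob C" using F.source.hom_Ob by auto
    note Ff = F.map_hom[OF f] and FA = F.map_Ob[OF A] and FB = F.map_Ob[OF B]
    note GFf = Ga(1)[OF Ff]
    have "Comp D (e (Fo B)) (Fa (Comp C (Ga (Fa f)) (\<eta> A))) =
        Comp D (Comp D (e (Fo B)) (Fa (Ga (Fa f)))) (e' (Fo A))"
      using F.map_comp[OF \<eta>(1)[OF A] GFf] \<eta>(2)[OF A] e'[OF FA] e[OF FB] F.map_hom[OF GFf]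
        F.target.comp_assoc by simp
    also have "\<dots> = Comp D (Fa f) (Comp D (e (Fo A)) (e' (Fo A)))"
      using e_nat[OF Ff] F.target.comp_assoc[OF e'[OF FA] e[OF FA] Ff] by simp
    also have "\<dots> = Fa f" using ee'[OF FA] F.target.ident_right[OF Ff] by simp
    also have "\<dots> = Comp D (Comp D (e (Fo B)) (e' (Fo B))) (Fa f)"
      using ee'[OF FB] F.target.ident_left[OF Ff] by simp
    also have "\<dots> = Comp D (e (Fo B)) (Fa (Comp C (\<eta> B) f))"
      using F.target.comp_assoc[OF Ff e'[OF FB] e[OF FB]] F.map_comp[OF f \<eta>(1)[OF B]] \<eta>(2)[OF B]
      by simp
    finally have "Fa (Comp C (Ga (Fa f)) (\<eta> A)) = Fa (Comp C (\<eta> B) f)"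
      using e_cancel[OF _ FB F.map_hom[OF F.source.comp_in_hom[OF \<eta>(1)[OF A] GFf]]
          F.map_hom[OF F.source.comp_in_hom[OF f \<eta>(1)[OF B]]]] by simp
    then show "Comp C (\<eta> B) (id f) = Comp C ((Ga \<circ> Fa) f) (\<eta> A)"
      using faithful[OF F.source.comp_in_hom[OF \<eta>(1)[OF A] GFf]
          F.source.comp_in_hom[OF f \<eta>(1)[OF B]]] by simp
  qed
  moreover have "natural_iso D D (Fo \<circ> Go) (Fa \<circ> Ga) id id e"
  proof (intro natural_iso.intro F.target.id_functor functor_comp[OF G_functor F.cat_functor_axioms],
      unfold_locales)
    fix Y assume "Y \<in> Ob D"
    then show "e Y \<in> hom D ((Fo \<circ> Go) Y) (id Y)" "is_iso D (e Y)"
      using is_isoI[OF e e' e'e ee'] e by auto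
  qed (use e_nat in auto)
  ultimately show ?thesis
    unfolding equivalent_categories_def using F.cat_functor_axioms G_functor by blast
qed

lemma full_subcategory_simps [simp]:
  "Ob (full_subcategory C S) = Ob C \<inter> S"
  "Ident (full_subcategory C S) = Ident C"
  "Comp (full_subcategory C S) = Comp C"
  by (simp_all add: full_subcategory_def)

lemma hom_full_subcategory:
  "hom (full_subcategory C S) A B = (if A \<in> S \<and> B \<in> S then hom C A B else {})"
  by (auto simp: full_subcategory_def hom_def)

lemma (in category) full_subcategory: "category (full_subcategory C S)"
proof
  fix f assume "f \<in> Ar (full_subcategory C S)"
  then show "Dom (full_subcategory C S) f \<in> Ob (full_subcategory C S)"
    "Cod (full_subcategory C S) f \<in> Ob (full_subcategory C S)"
    using dom_in_Ob cod_in_Ob by (auto simp: full_subcategory_def)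
qed (auto simp: hom_full_subcategory ident_in_hom ident_left ident_right
    intro: comp_in_hom comp_assoc split: if_splits)

section \<open>Categories of structures\<close>

lemma structure_category_simps [simp]:
  "Ob (structure_category S obs ars P) = S"
  "Ident (structure_category S obs ars P) = (\<lambda>X. \<lparr>Src = X, Trg = X,
     OMap = (\<lambda>A \<in> obs X. A), AMap = (\<lambda>f \<in> ars X. f)\<rparr>)"
  "Comp (structure_category S obs ars P) = (\<lambda>G F. \<lparr>Src = Src F, Trg = Trg G,
     OMap = compose (obs (Src F)) (OMap G) (OMap F),
     AMap = compose (ars (Src F)) (AMap G) (AMap F)\<rparr>)"
  by (simp_all add: structure_category_def)

lemma hom_structure_category:
  "F \<in> hom (structure_category S obs ars P) X Y \<longleftrightarrow>
    X \<in> S \<and> Y \<in> S \<and> Src F = X \<and> Trg F = Y \<and> P X Y (OMap F) (AMap F) \<and>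
    OMap F \<in> extensional (obs X) \<and> AMap F \<in> extensional (ars X)"
  by (auto simp: structure_category_def hom_def)

text \<open>The maps of a composite are cut down to the source by \<open>compose\<close>. By
  \<open>closed\<close>, intermediate values lie where the next map is specified, and extensionality
  turns pointwise agreement into equality; so the unit and associativity laws hold strictly.\<close>

lemma structure_category:
  assumes closed: "\<And>X Y Fo Fa. \<lbrakk>X \<in> S; Y \<in> S; P X Y Fo Fa\<rbrakk>
      \<Longrightarrow> Fo \<in> obs X \<rightarrow> obs Y \<and> Fa \<in> ars X \<rightarrow> ars Y"
    and ident: "\<And>X. X \<in> S \<Longrightarrow> P X X (\<lambda>A \<in> obs X. A) (\<lambda>f \<in> ars X. f)"
    and comp: "\<And>X Y Z Fo Fa Go Ga. \<lbrakk>X \<in> S; Y \<in> S; Z \<in> S; P X Y Fo Fa; P Y Z Go Ga\<rbrakk>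
      \<Longrightarrow> P X Z (compose (obs X) Go Fo) (compose (ars X) Ga Fa)"
  shows "category (structure_category S obs ars P)"
proof
  fix F assume "F \<in> Ar (structure_category S obs ars P)"
  then show "Dom (structure_category S obs ars P) F \<in> Ob (structure_category S obs ars P)"
    "Cod (structure_category S obs ars P) F \<in> Ob (structure_category S obs ars P)"
    by (auto simp: structure_category_def)
next
  fix F X Y assume F: "F \<in> hom (structure_category S obs ars P) X Y"
  then have "OMap F \<in> obs X \<rightarrow> obs Y" "AMap F \<in> ars X \<rightarrow> ars Y"
    "OMap F \<in> extensional (obs X)" "AMap F \<in> extensional (ars X)"
    using closed[of X Y "OMap F" "AMap F"] by (auto simp: hom_structure_category)
  then show "Comp (structure_category S obs ars P) (Ident (structure_category S obs ars P) Y) F = F"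
    "Comp (structure_category S obs ars P) F (Ident (structure_category S obs ars P) X) = F"
    using F by (auto simp: hom_structure_category Id_compose compose_Id
        intro!: structure_map.equality)
next
  fix F G H W X Y Z
  assume "F \<in> hom (structure_category S obs ars P) W X"
    "G \<in> hom (structure_category S obs ars P) X Y"
    "H \<in> hom (structure_category S obs ars P) Y Z"
  moreover from this have "OMap F \<in> obs W \<rightarrow> obs X" "AMap F \<in> ars W \<rightarrow> ars X"
    using closed[of W X "OMap F" "AMap F"] by (auto simp: hom_structure_category)
  ultimately show "Comp (structure_category S obs ars P) H (Comp (structure_category S obs ars P) G F) =
      Comp (structure_category S obs ars P) (Comp (structure_category S obs ars P) H G) F"
    by (simp add: hom_structure_category compose_assoc)
next
  fix F G X Y Z
  assume "F \<in> hom (structure_category S obs ars P) X Y" "G \<in> hom (structure_category S obs ars P) Y Z"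
  then show "Comp (structure_category S obs ars P) G F \<in> hom (structure_category S obs ars P) X Z"
    using comp[of X Y Z "OMap F" "AMap F" "OMap G" "AMap G"] by (simp add: hom_structure_category)
qed (auto simp: hom_structure_category ident)

section \<open>Lists\<close>

lemma nth_concat_block:
  assumes "i < length xss" "k < length (xss ! i)"
  shows "block_start (map length xss) i + k < length (concat xss)"
    and "concat xss ! (block_start (map length xss) i + k) = xss ! i ! k"
proof -
  have "concat xss = concat (take i xss) @ xss ! i @ concat (drop (Suc i) xss)"
    using id_take_nth_drop[OF assms(1)] by (metis concat.simps(2) concat_append)
  moreover have "block_start (map length xss) i = length (concat (take i xss))"
    by (simp add: block_start_def length_concat take_map)
  ultimately show "block_start (map length xss) i + k < length (concat xss)"
    "concat xss ! (block_start (map length xss) i + k) = xss ! i ! k"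
    using assms(2) by (simp_all add: nth_append)
qed

text \<open>A mapping \<open>\<sigma>\<close> acts on lists by \<open>map ((!) xs) \<sigma>\<close>,
  and a juxtaposition acts block by block. The entries are objects when a reindexing is checked,
  positions when mappings are composed, and arrows when arguments are reindexed.\<close>

lemma map_juxtaposition:
  assumes "length \<sigma>s = length xss" "\<And>i. i < length xss \<Longrightarrow> set (\<sigma>s ! i) \<subseteq> {..<length (xss ! i)}"
  shows "set (juxtaposition (map length xss) \<sigma>s) \<subseteq> {..<length (concat xss)}"
    and "map ((!) (concat xss)) (juxtaposition (map length xss) \<sigma>s) =
      concat (map (\<lambda>i. map ((!) (xss ! i)) (\<sigma>s ! i)) [0..<length xss])"
proof -
  show "set (juxtaposition (map length xss) \<sigma>s) \<subseteq> {..<length (concat xss)}"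
    using assms nth_concat_block(1)[of _ xss] by (auto simp: juxtaposition_def subset_iff)
  show "map ((!) (concat xss)) (juxtaposition (map length xss) \<sigma>s) =
      concat (map (\<lambda>i. map ((!) (xss ! i)) (\<sigma>s ! i)) [0..<length xss])"
    unfolding juxtaposition_def map_concat map_map
    using assms nth_concat_block(2)[of _ xss]
    by (auto simp: subset_iff intro!: arg_cong[where f = concat])
qed

text \<open>Offsets inside a block are kept, so only whole blocks move. As for juxtapositions, this
  serves for lists of objects, of positions and of arrows.\<close>

lemma map_block_mapping:
  assumes "set \<sigma> \<subseteq> {..<length xss}"
  shows "set (block_mapping (map length xss) \<sigma>) \<subseteq> {..<length (concat xss)}"
    and "map ((!) (concat xss)) (block_mapping (map length xss) \<sigma>) = concat (map ((!) xss) \<sigma>)"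
proof -
  show "set (block_mapping (map length xss) \<sigma>) \<subseteq> {..<length (concat xss)}"
  proof
    fix t assume "t \<in> set (block_mapping (map length xss) \<sigma>)"
    then obtain j where "j < length xss" "block_start (map length xss) j \<le> t"
      "t < length (xss ! j) + block_start (map length xss) j"
      using assms by (auto simp: block_mapping_def subset_iff)
    then show "t \<in> {..<length (concat xss)}"
      using nth_concat_block(1)[of j xss "t - block_start (map length xss) j"] by simp
  qed
  have "map ((!) (concat xss)) (block_mapping (map length xss) \<sigma>) =
      concat (map (\<lambda>j. map (\<lambda>k. xss ! j ! k) [0..<length (xss ! j)]) \<sigma>)"
    unfolding block_mapping_def map_concat map_map
    using assms nth_concat_block(2)[of _ xss]
    by (auto simp: subset_iff intro!: arg_cong[where f = concat])
  then show "map ((!) (concat xss)) (block_mapping (map length xss) \<sigma>) = concat (map ((!) xss) \<sigma>)"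
    by (simp add: map_nth)
qed

text \<open>Induction from the right, since \<open>block_start\<close> is a prefix sum and a new
  last block leaves the earlier starts alone. It serves to show that the inclusions of the blocks,
  taken together, form the identity mapping, which acts trivially.\<close>

lemma block_mapping_id: "block_mapping ms [0..<length ms] = [0..<sum_list ms]"
proof (induction ms rule: rev_induct)
  case (snoc m ms)
  have "block_mapping (ms @ [m]) [0..<length ms] = block_mapping ms [0..<length ms]"
    by (auto simp: block_mapping_def block_start_def nth_append intro!: arg_cong[where f = concat])
  moreover have "map ((+) (sum_list ms)) [0..<m] = [sum_list ms..<sum_list ms + m]"
    by (rule nth_equalityI) simp_all
  ultimately show ?case
    using snoc upt_add_eq_append[of 0 "sum_list ms" m]
    by (simp add: block_mapping_def block_start_def)
qed (simp add: block_mapping_def)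

lemma concat_replicate_concat_replicate:
  "concat (replicate n (concat (replicate m xs))) = concat (replicate (n * m) xs)"
  by (induction n) (simp_all add: replicate_add)

lemma map_nth_concat_replicate:
  "map ((!) xs) (concat (replicate n [0..<length xs])) = concat (replicate n xs)"
  by (simp add: map_concat map_nth)

section \<open>Cartesian multicategories as clones\<close>

lemma mhomD:
  assumes "f \<in> mhom M As B"
  shows "f \<in> mAr M" "mDom M f = As" "mCod M f = B"
  using assms by (simp_all add: mhom_def)

text \<open>To be thought of as a morphism from the context \<open>\<Gamma>\<close> to the context
  \<open>As\<close>.\<close>

abbreviation mhoms :: "('o, 'a, 'm) multicategory_scheme \<Rightarrow> 'o list \<Rightarrow> 'o list \<Rightarrow> 'a list \<Rightarrow> bool"
  where "mhoms M \<Gamma> As gs \<equiv> list_all2 (\<lambda>g A. g \<in> mhom M \<Gamma> A) gs As"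

lemma mhomsD:
  assumes "mhoms M \<Gamma> As gs"
  shows "length gs = length As" "set gs \<subseteq> mAr M" "map (mCod M) gs = As"
    "map (mDom M) gs = replicate (length As) \<Gamma>" "i < length As \<Longrightarrow> gs ! i \<in> mhom M \<Gamma> (As ! i)"
  using assms
  by (auto simp: list_all2_conv_all_nth mhom_def in_set_conv_nth intro!: nth_equalityI)

lemma composable_mhoms: "\<lbrakk>f \<in> mhom M As B; mhoms M \<Gamma> As gs\<rbrakk> \<Longrightarrow> composable M f gs"
  using mhomsD(2,3)[of M \<Gamma> gs As] by (simp add: composable_def mhom_def)

lemma (in multicategory) mhom_Ob:
  assumes "f \<in> mhom M As B"
  shows "set As \<subseteq> mOb M" "B \<in> mOb M"
  using assms mdom_in_Ob mcod_in_Ob by (auto simp: mhom_def)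

definition projection :: "('o, 'a) cartesian_multicategory \<Rightarrow> 'o list \<Rightarrow> nat \<Rightarrow> 'a" where
  "projection M \<Gamma> i = mAct M \<Gamma> [i] (mIdent M (\<Gamma> ! i))"

text \<open>The repeated list \<open>[0..<length \<Gamma>]\<close> is the codiagonal from copies of
  \<open>\<Gamma>\<close> to \<open>\<Gamma>\<close>. The context is an explicit argument because it
  cannot be read off from an empty \<open>gs\<close>, in which case substitution weakens a nullary
  arrow to \<open>\<Gamma>\<close>.\<close>

definition substitute ::
    "('o, 'a) cartesian_multicategory \<Rightarrow> 'o list \<Rightarrow> 'a \<Rightarrow> 'a list \<Rightarrow> 'a" where
  "substitute M \<Gamma> f gs = mAct M \<Gamma> (concat (replicate (length gs) [0..<length \<Gamma>])) (mComp M f gs)"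

context cartesian_multicategory
begin

lemma mcomp_mhoms_in_hom:
  "\<lbrakk>f \<in> mhom M As B; mhoms M \<Gamma> As gs\<rbrakk>
    \<Longrightarrow> mComp M f gs \<in> mhom M (concat (replicate (length As) \<Gamma>)) B"
  using mcomp_in_hom[OF composable_mhoms] mhomsD(4) mhomD(3) by metis

lemma projection_in_hom:
  "\<lbrakk>set \<Gamma> \<subseteq> mOb M; i < length \<Gamma>\<rbrakk> \<Longrightarrow> projection M \<Gamma> i \<in> mhom M \<Gamma> (\<Gamma> ! i)"
  using act_in_hom[of "mIdent M (\<Gamma> ! i)" \<Gamma> "[i]"] mident_in_hom[of "\<Gamma> ! i"]
    subsetD[OF _ nth_mem[of i \<Gamma>], of "mOb M"]
  by (auto simp: projection_def mhom_def reindexing_def)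

lemma projections_in_homs:
  "\<lbrakk>set \<Gamma> \<subseteq> mOb M; reindexing \<sigma> As \<Gamma>\<rbrakk> \<Longrightarrow> mhoms M \<Gamma> As (map (projection M \<Gamma>) \<sigma>)"
  unfolding reindexing_def list_all2_map1 list.rel_map
  by (auto simp: list.rel_map list.rel_refl_strong subset_iff intro!: list.rel_refl_strong projection_in_hom)

lemma substitute_in_hom:
  assumes "f \<in> mhom M As B" "mhoms M \<Gamma> As gs" "set \<Gamma> \<subseteq> mOb M"
  shows "substitute M \<Gamma> f gs \<in> mhom M \<Gamma> B"
proof -
  note h = mcomp_mhoms_in_hom[OF assms(1,2)]
  have "reindexing (concat (replicate (length gs) [0..<length \<Gamma>])) (mDom M (mComp M f gs)) \<Gamma>"
    using mhomD(2)[OF h] mhomsD(1)[OF assms(2)]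
    by (auto simp: reindexing_def map_nth_concat_replicate)
  then show ?thesis
    using act_in_hom[of "mComp M f gs" \<Gamma>] h assms(3) by (simp add: substitute_def mhom_def)
qed

text \<open>Juxtaposing mappings into \<open>\<Gamma>\<close> and then identifying the copies of
  \<open>\<Gamma>\<close> is copairing, and the copairing of lists of values is
  \<open>concat\<close>. So the first compatibility law and functoriality merge the separate actions
  into one. Actions, composites and iterated substitutions are all treated through this
  lemma.\<close>

lemma substitute_acts:
  assumes f: "composable M f gs" and \<Gamma>: "set \<Gamma> \<subseteq> mOb M" and len: "length \<sigma>s = length gs"
    and \<sigma>s: "\<And>i. i < length gs \<Longrightarrow> reindexing (\<sigma>s ! i) (mDom M (gs ! i)) \<Gamma>"
  shows "substitute M \<Gamma> f (map (\<lambda>i. mAct M \<Gamma> (\<sigma>s ! i) (gs ! i)) [0..<length gs]) =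
      mAct M \<Gamma> (concat \<sigma>s) (mComp M f gs)"
proof -
  let ?n = "length gs" and ?d = "length \<Gamma>"
  let ?\<tau> = "juxtaposition (replicate ?n ?d) \<sigma>s" and ?c = "concat (replicate ?n [0..<?d])"
  let ?xss = "replicate ?n \<Gamma>" and ?yss = "replicate ?n [0..<?d]"
  have ran: "set (\<sigma>s ! i) \<subseteq> {..<?d}" "map ((!) \<Gamma>) (\<sigma>s ! i) = mDom M (gs ! i)" if "i < ?n" for i
    using \<sigma>s[OF that] by (auto simp: reindexing_def)
  have fg: "mComp M f gs \<in> mAr M" "mDom M (mComp M f gs) = concat (map (mDom M) gs)"
    using mcomp_in_hom[OF f] by (simp_all add: mhom_def)
  have "set ?\<tau> \<subseteq> {..<length (concat ?xss)}"
    using map_juxtaposition(1)[of \<sigma>s ?xss] ran len by simp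
  moreover have "map ((!) (concat ?xss)) ?\<tau> = concat (map (mDom M) gs)"
  proof -
    have "map (\<lambda>i. map ((!) \<Gamma>) (\<sigma>s ! i)) [0..<?n] = map (mDom M) gs"
      using ran by (auto intro: nth_equalityI)
    moreover have "map (\<lambda>i. map ((!) (?xss ! i)) (\<sigma>s ! i)) [0..<?n] =
        map (\<lambda>i. map ((!) \<Gamma>) (\<sigma>s ! i)) [0..<?n]"
      by simp
    ultimately show ?thesis
      using map_juxtaposition(2)[of \<sigma>s ?xss] ran len by simp
  qed
  ultimately have re: "reindexing ?\<tau> (mDom M (mComp M f gs)) (concat ?xss)"
    by (simp add: reindexing_def fg)
  have re': "reindexing ?c (concat ?xss) \<Gamma>"
    by (auto simp: reindexing_def map_nth_concat_replicate)
  have xss: "set (concat ?xss) \<subseteq> mOb M" using \<Gamma> by auto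
  have "mComp M f (map (\<lambda>i. mAct M \<Gamma> (\<sigma>s ! i) (gs ! i)) [0..<?n]) =
      mComp M f (map (\<lambda>i. mAct M (?xss ! i) (\<sigma>s ! i) (gs ! i)) [0..<?n])"
    by (auto intro!: arg_cong[where f = "mComp M f"])
  also have "\<dots> = mAct M (concat ?xss) ?\<tau> (mComp M f gs)"
    using comp_act[OF f, of ?xss \<sigma>s] len \<Gamma> \<sigma>s by simp
  finally have "substitute M \<Gamma> f (map (\<lambda>i. mAct M \<Gamma> (\<sigma>s ! i) (gs ! i)) [0..<?n]) =
      mAct M \<Gamma> ?c (mAct M (concat ?xss) ?\<tau> (mComp M f gs))"
    by (simp add: substitute_def)
  also have "\<dots> = mAct M \<Gamma> (map ((!) ?c) ?\<tau>) (mComp M f gs)"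
    using act_act[OF fg(1) xss re \<Gamma> re'] .
  \<comment> \<open>The composite mapping is computed by reading the codiagonal as a concatenation
    of lists of positions.\<close>
  also have "map ((!) ?c) ?\<tau> = concat (map (\<lambda>i. map ((!) (?yss ! i)) (\<sigma>s ! i)) [0..<?n])"
    using map_juxtaposition(2)[of \<sigma>s ?yss] ran len by simp
  also have "map (\<lambda>i. map ((!) (?yss ! i)) (\<sigma>s ! i)) [0..<?n] = \<sigma>s"
    using ran(1) len by (auto simp: subset_iff intro!: nth_equalityI)
  finally show ?thesis .
qed

text \<open>Apply \<open>substitute_acts\<close> to the identities of \<open>As\<close>, the one at
  place \<open>i\<close> acted on by the one-element mapping \<open>[\<sigma> ! i]\<close>: each
  becomes a projection, and the one-element mappings concatenate to \<open>\<sigma>\<close>.\<close>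

lemma act_eq_substitute:
  assumes f: "f \<in> mhom M As B" and \<Gamma>: "set \<Gamma> \<subseteq> mOb M" and \<sigma>: "reindexing \<sigma> As \<Gamma>"
  shows "mAct M \<Gamma> \<sigma> f = substitute M \<Gamma> f (map (projection M \<Gamma>) \<sigma>)"
proof -
  let ?gs = "map (mIdent M) As"
  have As: "As = map ((!) \<Gamma>) \<sigma>" and ran: "set \<sigma> \<subseteq> {..<length \<Gamma>}"
    using \<sigma> by (auto simp: reindexing_def)
  have id: "mIdent M (As ! i) \<in> mhom M [As ! i] (As ! i)" if "i < length As" for i
    using mident_in_hom mhom_Ob(1)[OF f] that by (meson nth_mem subsetD)
  have "composable M f ?gs"
    using mhomD[OF f] mident_in_hom mhom_Ob(1)[OF f]
    by (auto simp: composable_def mhom_def subset_iff intro!: map_idI)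
  moreover have "reindexing (map (\<lambda>k. [k]) \<sigma> ! i) (mDom M (?gs ! i)) \<Gamma>" if "i < length ?gs" for i
    using id[of i] that ran As by (auto simp: reindexing_def mhom_def subset_iff)
  ultimately have "substitute M \<Gamma> f (map (\<lambda>i. mAct M \<Gamma> (map (\<lambda>k. [k]) \<sigma> ! i) (?gs ! i)) [0..<length ?gs]) =
      mAct M \<Gamma> (concat (map (\<lambda>k. [k]) \<sigma>)) (mComp M f ?gs)"
    using substitute_acts[OF _ \<Gamma>, of f ?gs "map (\<lambda>k. [k]) \<sigma>"] As by simp
  moreover have "map (\<lambda>i. mAct M \<Gamma> (map (\<lambda>k. [k]) \<sigma> ! i) (?gs ! i)) [0..<length ?gs] =
      map (projection M \<Gamma>) \<sigma>"
    using As by (auto simp: projection_def intro!: nth_equalityI)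
  moreover have "mComp M f ?gs = f" using mident_right mhomD[OF f] by metis
  moreover have "concat (map (\<lambda>k. [k]) \<sigma>) = \<sigma>" by (induction \<sigma>) auto
  ultimately show ?thesis by simp
qed

lemma substitute_projections:
  assumes f: "f \<in> mhom M As B"
  shows "substitute M As f (map (projection M As) [0..<length As]) = f"
  using act_eq_substitute[OF f mhom_Ob(1)[OF f], of "[0..<length As]"] act_id[of f] mhomD[OF f]
  by (simp add: reindexing_def map_nth atLeast0LessThan)

text \<open>Each arrow of \<open>gs\<close> is weakened to the concatenated context along the
  inclusion of its block. By \<open>block_mapping_id\<close> these inclusions form the identity, so
  \<open>substitute_acts\<close> gives back the plain composite. Writing the weakenings as
  substitutions of projections leaves a formula in the clone operations alone.\<close>

lemma comp_eq_substitute: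
  assumes f: "composable M f gs"
  defines "ms \<equiv> map (\<lambda>g. length (mDom M g)) gs" and "\<Gamma> \<equiv> concat (map (mDom M) gs)"
  shows "mComp M f gs = substitute M \<Gamma> f
    (map (\<lambda>i. substitute M \<Gamma> (gs ! i)
      (map (projection M \<Gamma>) (map (\<lambda>k. block_start ms i + k) [0..<ms ! i]))) [0..<length gs])"
    and "\<And>i. i < length gs \<Longrightarrow>
      reindexing (map (\<lambda>k. block_start ms i + k) [0..<ms ! i]) (mDom M (gs ! i)) \<Gamma>"
proof -
  define \<sigma>s where "\<sigma>s = map (\<lambda>i. map (\<lambda>k. block_start ms i + k) [0..<ms ! i]) [0..<length gs]"
  have ms: "ms = map length (map (mDom M) gs)" by (simp add: ms_def)
  have \<Gamma>: "set \<Gamma> \<subseteq> mOb M"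
    using f mdom_in_Ob by (force simp: \<Gamma>_def composable_def)
  show re: "reindexing (map (\<lambda>k. block_start ms i + k) [0..<ms ! i]) (mDom M (gs ! i)) \<Gamma>"
    if i: "i < length gs" for i
  proof -
    have *: "block_start ms i + k < length \<Gamma>" "\<Gamma> ! (block_start ms i + k) = mDom M (gs ! i) ! k"
      if "k < length (mDom M (gs ! i))" for k
      using nth_concat_block[of i "map (mDom M) gs" k] i that unfolding ms \<Gamma>_def by simp_all
    have "ms ! i = length (mDom M (gs ! i))" using i by (simp add: ms_def)
    then show ?thesis
      unfolding reindexing_def using *
      by (auto simp del: image_add_atLeastLessThan image_add_atLeastLessThan' intro!: nth_equalityI)
  qed
  have "concat \<sigma>s = block_mapping ms [0..<length ms]"
    by (simp add: \<sigma>s_def block_mapping_def ms_def)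
  then have "concat \<sigma>s = [0..<length \<Gamma>]"
    using block_mapping_id[of ms] by (simp add: \<Gamma>_def length_concat ms_def comp_def)
  moreover have "mComp M f gs \<in> mAr M" "mDom M (mComp M f gs) = \<Gamma>"
    using mcomp_in_hom[OF f] by (simp_all add: mhom_def \<Gamma>_def)
  ultimately have "mComp M f gs = mAct M \<Gamma> (concat \<sigma>s) (mComp M f gs)"
    using act_id[of "mComp M f gs"] by simp
  also have "\<dots> = substitute M \<Gamma> f (map (\<lambda>i. mAct M \<Gamma> (\<sigma>s ! i) (gs ! i)) [0..<length gs])"
    using substitute_acts[OF f \<Gamma>, of \<sigma>s] re by (simp add: \<sigma>s_def)
  also have "map (\<lambda>i. mAct M \<Gamma> (\<sigma>s ! i) (gs ! i)) [0..<length gs] =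
      map (\<lambda>i. substitute M \<Gamma> (gs ! i)
        (map (projection M \<Gamma>) (map (\<lambda>k. block_start ms i + k) [0..<ms ! i]))) [0..<length gs]"
  proof (rule map_cong[OF refl])
    fix i assume "i \<in> set [0..<length gs]"
    then have i: "i < length gs" by simp
    then have "gs ! i \<in> mhom M (mDom M (gs ! i)) (mCod M (gs ! i))"
      using f by (auto simp: composable_def mhom_def)
    then show "mAct M \<Gamma> (\<sigma>s ! i) (gs ! i) = substitute M \<Gamma> (gs ! i)
        (map (projection M \<Gamma>) (map (\<lambda>k. block_start ms i + k) [0..<ms ! i]))"
      using act_eq_substitute[OF _ \<Gamma> re[OF i]] i by (simp add: \<sigma>s_def)
  qed
  finally show "mComp M f gs = substitute M \<Gamma> f
    (map (\<lambda>i. substitute M \<Gamma> (gs ! i)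
      (map (projection M \<Gamma>) (map (\<lambda>k. block_start ms i + k) [0..<ms ! i]))) [0..<length gs])" .
qed

text \<open>This comes from the second compatibility law. All arrows of \<open>hs\<close> have
  domain \<open>\<Delta>\<close>, so all blocks have the same length, and a block mapping followed
  by the codiagonal is again a codiagonal, with one copy for each entry of
  \<open>\<sigma>\<close>.\<close>

lemma substitute_act:
  assumes f: "f \<in> mhom M As B" and \<sigma>: "reindexing \<sigma> As \<Gamma>" and hs: "mhoms M \<Delta> \<Gamma> hs"
    and \<Gamma>: "set \<Gamma> \<subseteq> mOb M" and \<Delta>: "set \<Delta> \<subseteq> mOb M"
  shows "mhoms M \<Delta> As (map ((!) hs) \<sigma>)"
    and "substitute M \<Delta> (mAct M \<Gamma> \<sigma> f) hs = substitute M \<Delta> f (map ((!) hs) \<sigma>)"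
proof -
  let ?m = "length hs" and ?d = "length \<Delta>"
  let ?c = "concat (replicate ?m [0..<?d])" and ?b = "block_mapping (replicate ?m ?d) \<sigma>"
  let ?xss = "replicate ?m \<Delta>" and ?yss = "replicate ?m [0..<?d]"
  note hs' = mhomsD[OF hs] and f' = mhomD[OF f]
  have ran: "set \<sigma> \<subseteq> {..<?m}" and As: "As = map ((!) \<Gamma>) \<sigma>"
    using \<sigma> hs'(1) by (auto simp: reindexing_def)
  show gs: "mhoms M \<Delta> As (map ((!) hs) \<sigma>)"
    using ran hs'(1,5) As by (auto simp: list_all2_conv_all_nth subset_iff)
  note fg = mcomp_mhoms_in_hom[OF f gs]
  have "set ?b \<subseteq> {..<length (concat ?xss)}"
    using map_block_mapping(1)[of \<sigma> ?xss] ran by simp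
  moreover have "map ((!) (concat ?xss)) ?b = concat (map ((!) ?xss) \<sigma>)"
    using map_block_mapping(2)[of \<sigma> ?xss] ran by simp
  moreover have "map ((!) ?xss) \<sigma> = replicate (length As) \<Delta>"
    using ran As by (auto simp: subset_iff intro!: nth_equalityI)
  ultimately have re: "reindexing ?b (mDom M (mComp M f (map ((!) hs) \<sigma>))) (concat ?xss)"
    using mhomD(2)[OF fg] by (simp add: reindexing_def)
  have re': "reindexing ?c (concat ?xss) \<Delta>"
    by (auto simp: reindexing_def map_nth_concat_replicate)
  have xss: "set (concat ?xss) \<subseteq> mOb M" using \<Delta> by auto
  have ms: "map (\<lambda>g. length (mDom M g)) hs = replicate ?m ?d"
    using arg_cong[OF hs'(4), of "map length"] hs'(1) by (simp add: comp_def)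
  have "substitute M \<Delta> (mAct M \<Gamma> \<sigma> f) hs = mAct M \<Delta> ?c (mAct M (concat ?xss) ?b
      (mComp M f (map ((!) hs) \<sigma>)))"
    using act_comp[OF f'(1) hs'(2), of \<sigma>] \<sigma> f' hs' ms by (simp add: substitute_def)
  also have "\<dots> = mAct M \<Delta> (map ((!) ?c) ?b) (mComp M f (map ((!) hs) \<sigma>))"
    using act_act[OF mhomD(1)[OF fg] xss re \<Delta> re'] .
  also have "map ((!) ?c) ?b = concat (map ((!) ?yss) \<sigma>)"
    using map_block_mapping(2)[of \<sigma> ?yss] ran by simp
  also have "map ((!) ?yss) \<sigma> = replicate (length \<sigma>) [0..<?d]"
    using ran by (auto simp: subset_iff intro!: nth_equalityI)
  finally show "substitute M \<Delta> (mAct M \<Gamma> \<sigma> f) hs = substitute M \<Delta> f (map ((!) hs) \<sigma>)"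
    by (simp add: substitute_def)
qed

lemma substitute_unary:
  assumes "f \<in> mhom M [A] B" "g \<in> mhom M \<Gamma> A"
  shows "substitute M \<Gamma> f [g] = mComp M f [g]"
  using act_id[of "mComp M f [g]"] mcomp_mhoms_in_hom[OF assms(1), of \<Gamma> "[g]"] assms(2)
  by (simp add: substitute_def mhom_def)

lemma mcomp_unary_in_hom:
  assumes "f \<in> mhom M [A] B" "g \<in> mhom M \<Gamma> A"
  shows "mComp M f [g] \<in> mhom M \<Gamma> B"
  using mcomp_mhoms_in_hom[OF assms(1), of \<Gamma> "[g]"] assms(2) by simp

lemma mident_comp: "g \<in> mhom M \<Gamma> A \<Longrightarrow> mComp M (mIdent M A) [g] = g"
  using mident_left by (auto simp: mhom_def)

lemma mcomp_ident: "f \<in> mhom M [A] B \<Longrightarrow> mComp M f [mIdent M A] = f"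
  using mident_right[of f] by (auto simp: mhom_def)

text \<open>A projection is an identity acted on by \<open>[i]\<close>, so
  \<open>substitute_act\<close> selects the argument at place \<open>i\<close>.\<close>

lemma substitute_projection:
  assumes hs: "mhoms M \<Delta> \<Gamma> hs" and i: "i < length \<Gamma>"
    and \<Gamma>: "set \<Gamma> \<subseteq> mOb M" and \<Delta>: "set \<Delta> \<subseteq> mOb M"
  shows "substitute M \<Delta> (projection M \<Gamma> i) hs = hs ! i"
proof -
  have id: "mIdent M (\<Gamma> ! i) \<in> mhom M [\<Gamma> ! i] (\<Gamma> ! i)"
    using mident_in_hom \<Gamma> i by (meson nth_mem subsetD)
  have hi: "hs ! i \<in> mhom M \<Delta> (\<Gamma> ! i)" using mhomsD(5)[OF hs i] .
  have "reindexing [i] [\<Gamma> ! i] \<Gamma>" using i by (simp add: reindexing_def)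
  from substitute_act(2)[OF id this hs \<Gamma> \<Delta>] show ?thesis
    using substitute_unary[OF id hi] mident_comp[OF hi] by (simp add: projection_def)
qed

text \<open>Rests on associativity of composition, with two contractions to move out of the way:
  that of \<open>\<Gamma>\<close> turns into copies of \<open>hs\<close>, and that of
  \<open>\<Delta>\<close> is carried out in two stages.\<close>

lemma substitute_substitute:
  assumes f: "f \<in> mhom M As B" and gs: "mhoms M \<Gamma> As gs" and hs: "mhoms M \<Delta> \<Gamma> hs"
    and \<Gamma>: "set \<Gamma> \<subseteq> mOb M" and \<Delta>: "set \<Delta> \<subseteq> mOb M"
  shows "substitute M \<Delta> (substitute M \<Gamma> f gs) hs =
    substitute M \<Delta> f (map (\<lambda>g. substitute M \<Delta> g hs) gs)"
proof -
  let ?n = "length gs" and ?m = "length hs" and ?d = "length \<Delta>"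
  let ?c = "concat (replicate ?m [0..<?d])" and ?ks = "map (\<lambda>g. mComp M g hs) gs"
  have len: "length gs = length As" "length hs = length \<Gamma>" using mhomsD(1) gs hs by auto
  have k: "mComp M (gs ! i) hs \<in> mhom M (concat (replicate ?m \<Delta>)) (As ! i)" if "i < ?n" for i
    using mcomp_mhoms_in_hom[OF mhomsD(5)[OF gs] hs] that len by simp
  then have ks: "mhoms M (concat (replicate ?m \<Delta>)) As ?ks"
    using len by (simp add: list_all2_conv_all_nth)
  note fks = composable_mhoms[OF f ks]
  \<comment> \<open>The inner contraction is an action, so by \<open>substitute_act\<close> it
    passes to the arguments and repeats \<open>hs\<close> once for each arrow of
    \<open>gs\<close>.\<close>
  have "reindexing (concat (replicate ?n [0..<length \<Gamma>])) (concat (replicate (length As) \<Gamma>)) \<Gamma>"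
    using len by (auto simp: reindexing_def map_nth_concat_replicate)
  from substitute_act(2)[OF mcomp_mhoms_in_hom[OF f gs] this hs \<Gamma> \<Delta>]
  have "substitute M \<Delta> (substitute M \<Gamma> f gs) hs =
      substitute M \<Delta> (mComp M f gs) (concat (replicate ?n hs))"
    by (simp add: substitute_def map_nth_concat_replicate flip: len(2))
  also have "mComp M (mComp M f gs) (concat (replicate ?n hs)) = mComp M f ?ks"
  proof -
    have "list_all2 (composable M) gs (replicate ?n hs)"
      using composable_mhoms[OF mhomsD(5)[OF gs] hs] len by (simp add: list_all2_conv_all_nth)
    moreover have "map2 (mComp M) gs (replicate ?n hs) = ?ks" by (auto intro: nth_equalityI)
    ultimately show ?thesis using mcomp_assoc[OF composable_mhoms[OF f gs]] by simp
  qed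
  then have "substitute M \<Delta> (mComp M f gs) (concat (replicate ?n hs)) =
      mAct M \<Delta> (concat (replicate ?n ?c)) (mComp M f ?ks)"
    by (simp add: substitute_def concat_replicate_concat_replicate length_concat sum_list_replicate)
  \<comment> \<open>Contracting all \<open>n * m\<close> copies of \<open>\<Delta>\<close> at once
    is contracting \<open>m\<close> copies inside each argument and then the \<open>n\<close>
    results.\<close>
  also have "\<dots> = substitute M \<Delta> f (map (\<lambda>i. mAct M \<Delta> (replicate ?n ?c ! i) (?ks ! i)) [0..<length ?ks])"
    using substitute_acts[OF fks \<Delta>, of "replicate ?n ?c"] mhomD(2)[OF k]
    by (simp add: reindexing_def map_nth_concat_replicate atLeast0LessThan)
  also have "map (\<lambda>i. mAct M \<Delta> (replicate ?n ?c ! i) (?ks ! i)) [0..<length ?ks] =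
      map (\<lambda>g. substitute M \<Delta> g hs) gs"
    by (rule nth_equalityI) (simp_all add: substitute_def)
  finally show ?thesis .
qed

end

section \<open>Universal arrows and products\<close>

text \<open>The first equation says that \<open>u\<close> followed by \<open>ps\<close> is the
  identity of the context \<open>As\<close>, the second that \<open>ps\<close> followed by
  \<open>u\<close> is the identity of \<open>[P]\<close>.\<close>

definition universal_tuple ::
    "('o, 'a) cartesian_multicategory \<Rightarrow> 'o list \<Rightarrow> 'o \<Rightarrow> 'a \<Rightarrow> 'a list \<Rightarrow> bool" where
  "universal_tuple M As P u ps \<longleftrightarrow> u \<in> mhom M As P \<and> mhoms M [P] As ps \<and>
    map (\<lambda>p. mComp M p [u]) ps = map (projection M As) [0..<length As] \<and>
    substitute M [P] u ps = mIdent M P"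

definition unary_category :: "('o, 'a) cartesian_multicategory \<Rightarrow> ('o, 'a) category" where
  "unary_category M =
    \<lparr>Ob = mOb M, Ar = {f \<in> mAr M. length (mDom M f) = 1}, Dom = (\<lambda>f. hd (mDom M f)), Cod = mCod M,
     Ident = mIdent M, Comp = (\<lambda>g f. mComp M g [f])\<rparr>"

lemma unary_category_simps [simp]:
  "Ob (unary_category M) = mOb M"
  "Ar (unary_category M) = {f \<in> mAr M. length (mDom M f) = 1}"
  "Ident (unary_category M) = mIdent M"
  "Comp (unary_category M) g f = mComp M g [f]"
  by (simp_all add: unary_category_def)

lemma hom_unary_category [simp]: "hom (unary_category M) A B = mhom M [A] B"
  by (auto simp: unary_category_def hom_def mhom_def length_Suc_conv)

context cartesian_multicategory
begin

text \<open>Associativity of substitution with a unary outer arrow;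
  \<open>comp_substitute_left\<close> is the case of a unary inner arrow. Calculations with
  universal tuples use these two forms.\<close>

lemma comp_substitute_right:
  assumes "g \<in> mhom M [B] C" "f \<in> mhom M As B" "mhoms M \<Gamma> As gs" "set \<Gamma> \<subseteq> mOb M"
  shows "mComp M g [substitute M \<Gamma> f gs] = substitute M \<Gamma> (mComp M g [f]) gs"
  using substitute_substitute[OF assms(1), of As "[f]" \<Gamma> gs] assms mhom_Ob(1)[OF assms(2)]
  by (simp add: substitute_unary substitute_in_hom)

lemma comp_substitute_left:
  assumes "f \<in> mhom M As B" "mhoms M [P] As gs" "h \<in> mhom M \<Gamma> P"
  shows "mComp M (substitute M [P] f gs) [h] = substitute M \<Gamma> f (map (\<lambda>g. mComp M g [h]) gs)"
proof -
  have Ob: "set [P] \<subseteq> mOb M" "set \<Gamma> \<subseteq> mOb M" using mhom_Ob[OF assms(3)] by auto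
  have "substitute M \<Gamma> g [h] = mComp M g [h]" if "g \<in> set gs" for g
    using that assms(2,3) substitute_unary[of g P _ h \<Gamma>] unfolding list_all2_conv_all_nth
    by (metis in_set_conv_nth)
  then show ?thesis
    using substitute_substitute[OF assms(1,2), of \<Gamma> "[h]"] Ob assms(3)
      substitute_unary[OF substitute_in_hom[OF assms(1,2) Ob(1)] assms(3)]
    by (simp cong: map_cong)
qed

lemma unary_assoc:
  assumes "f \<in> mhom M \<Gamma> A" "g \<in> mhom M [A] B" "h \<in> mhom M [B] C"
  shows "mComp M h [mComp M g [f]] = mComp M (mComp M h [g]) [f]"
  using mcomp_assoc[of h "[g]" "[[f]]"] assms by (simp add: composable_def mhom_def)

lemma category_unary_category: "category (unary_category M)"
proof
  fix f assume "f \<in> Ar (unary_category M)"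
  then show "Dom (unary_category M) f \<in> Ob (unary_category M)"
    "Cod (unary_category M) f \<in> Ob (unary_category M)"
    using mdom_in_Ob[of f] mcod_in_Ob[of f] by (auto simp: unary_category_def length_Suc_conv)
qed (auto intro: mident_in_hom mcomp_unary_in_hom mident_comp mcomp_ident unary_assoc)

lemma universal_tupleD:
  assumes "universal_tuple M As P u ps"
  shows "u \<in> mhom M As P" "mhoms M [P] As ps" "substitute M [P] u ps = mIdent M P"
    "set As \<subseteq> mOb M" "P \<in> mOb M" "i < length As \<Longrightarrow> mComp M (ps ! i) [u] = projection M As i"
proof -
  show u: "u \<in> mhom M As P" and ps: "mhoms M [P] As ps"
    and "substitute M [P] u ps = mIdent M P"
    using assms by (auto simp: universal_tuple_def)
  show "set As \<subseteq> mOb M" "P \<in> mOb M" using mhom_Ob[OF u] by auto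
  have "map (\<lambda>p. mComp M p [u]) ps = map (projection M As) [0..<length As]"
    using assms by (simp add: universal_tuple_def)
  from arg_cong[OF this, of "\<lambda>xs. xs ! i"]
  show "i < length As \<Longrightarrow> mComp M (ps ! i) [u] = projection M As i"
    using mhomsD(1)[OF ps] by simp
qed

text \<open>The chain is \<open>f = f[\<pi>\<^sub>1, ..., \<pi>\<^sub>n] =
  f[p\<^sub>1 u, ..., p\<^sub>n u] = f[p\<^sub>1, ..., p\<^sub>n] u\<close>.\<close>

lemma universal_tuple_factor:
  assumes u: "universal_tuple M As P u ps" and f: "f \<in> mhom M As B"
  shows "substitute M [P] f ps \<in> mhom M [P] B" "mComp M (substitute M [P] f ps) [u] = f"
proof -
  note u' = universal_tupleD[OF u]
  show "substitute M [P] f ps \<in> mhom M [P] B"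
    using substitute_in_hom[OF f u'(2)] u'(5) by simp
  show "mComp M (substitute M [P] f ps) [u] = f"
    using comp_substitute_left[OF f u'(2,1)] substitute_projections[OF f] u
    by (simp add: universal_tuple_def)
qed

lemma universal_tuple_factor_unique:
  assumes u: "universal_tuple M As P u ps" and g: "g \<in> mhom M [P] B"
  shows "substitute M [P] (mComp M g [u]) ps = g"
  using comp_substitute_right[OF g universal_tupleD(1,2)[OF u]] universal_tupleD(3,5)[OF u]
    mcomp_ident[OF g] by simp

text \<open>Composing \<open>p\<^sub>i\<close> with \<open>u[fs]\<close> gives
  \<open>\<pi>\<^sub>i[fs]\<close>, which is \<open>f\<^sub>i\<close>: tupling is substitution into
  \<open>u\<close>.\<close>

lemma universal_tuple_pairing:
  assumes u: "universal_tuple M As P u ps" and fs: "mhoms M \<Gamma> As fs" and \<Gamma>: "set \<Gamma> \<subseteq> mOb M"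
  shows "substitute M \<Gamma> u fs \<in> mhom M \<Gamma> P"
    and "map (\<lambda>p. mComp M p [substitute M \<Gamma> u fs]) ps = fs"
proof -
  note u' = universal_tupleD[OF u]
  show "substitute M \<Gamma> u fs \<in> mhom M \<Gamma> P" using substitute_in_hom[OF u'(1) fs \<Gamma>] .
  show "map (\<lambda>p. mComp M p [substitute M \<Gamma> u fs]) ps = fs"
  proof (rule nth_equalityI)
    fix i assume "i < length (map (\<lambda>p. mComp M p [substitute M \<Gamma> u fs]) ps)"
    then have i: "i < length As" "i < length ps" using mhomsD(1)[OF u'(2)] by auto
    show "map (\<lambda>p. mComp M p [substitute M \<Gamma> u fs]) ps ! i = fs ! i"
      using comp_substitute_right[OF mhomsD(5)[OF u'(2) i(1)] u'(1) fs \<Gamma>] u'(6)[OF i(1)]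
        substitute_projection[OF fs i(1) u'(4) \<Gamma>] i by simp
  qed (use mhomsD(1)[OF fs] mhomsD(1)[OF u'(2)] in simp)
qed

text \<open>The chain is \<open>h = id h = u[p\<^sub>1, ..., p\<^sub>n] h =
  u[p\<^sub>1 h, ..., p\<^sub>n h]\<close>.\<close>

lemma universal_tuple_pairing_unique:
  assumes u: "universal_tuple M As P u ps" and h: "h \<in> mhom M \<Gamma> P"
  shows "substitute M \<Gamma> u (map (\<lambda>p. mComp M p [h]) ps) = h"
  using comp_substitute_left[OF universal_tupleD(1,2)[OF u] h] universal_tupleD(3)[OF u]
    mident_comp[OF h] by simp

text \<open>Forward, each \<open>p\<^sub>i\<close> is the preimage of a projection under composition
  with \<open>u\<close>, and \<open>u[ps]\<close> is the identity because both become
  \<open>u\<close> after composition with \<open>u\<close>. Backward, substituting \<open>ps\<close>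
  inverts composition with \<open>u\<close>.\<close>

lemma preuniversal_iff_universal_tuple:
  assumes u: "u \<in> mhom M As P"
  shows "preuniversal M u \<longleftrightarrow> (\<exists>ps. universal_tuple M As P u ps)"
proof
  assume pre: "preuniversal M u"
  have bij: "bij_betw (\<lambda>g. mComp M g [u]) (mhom M [P] B) (mhom M As B)" if "B \<in> mOb M" for B
    using pre u that by (auto simp: preuniversal_def mhom_def)
  have As: "set As \<subseteq> mOb M" and P: "P \<in> mOb M" using mhom_Ob[OF u] by auto
  have "\<exists>p. p \<in> mhom M [P] (As ! i) \<and> mComp M p [u] = projection M As i" if i: "i < length As" for i
  proof -
    have "projection M As i \<in> mhom M As (As ! i)" using projection_in_hom[OF As i] .
    then have "projection M As i \<in> (\<lambda>g. mComp M g [u]) ` mhom M [P] (As ! i)"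
      using bij_betw_imp_surj_on[OF bij[OF subsetD[OF As nth_mem[OF i]]]] by simp
    then show ?thesis by (elim imageE) metis
  qed
  then obtain p where p: "\<And>i. i < length As \<Longrightarrow> p i \<in> mhom M [P] (As ! i)"
    "\<And>i. i < length As \<Longrightarrow> mComp M (p i) [u] = projection M As i"
    by metis
  define ps where "ps = map p [0..<length As]"
  have ps: "mhoms M [P] As ps" using p by (simp add: ps_def list_all2_conv_all_nth)
  have psu: "map (\<lambda>p. mComp M p [u]) ps = map (projection M As) [0..<length As]"
    using p by (simp add: ps_def)
  have "mComp M (substitute M [P] u ps) [u] = mComp M (mIdent M P) [u]"
    using comp_substitute_left[OF u ps u] psu substitute_projections[OF u] mident_comp[OF u] by simp
  then have "substitute M [P] u ps = mIdent M P"
    using bij_betw_imp_inj_on[OF bij[OF P]] substitute_in_hom[OF u ps] mident_in_hom[OF P] P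
    by (simp add: inj_on_def)
  then show "\<exists>ps. universal_tuple M As P u ps"
    using u ps psu by (auto simp: universal_tuple_def)
next
  assume "\<exists>ps. universal_tuple M As P u ps"
  then obtain ps where ps: "universal_tuple M As P u ps" by blast
  have "bij_betw (\<lambda>g. mComp M g [u]) (mhom M [P] B) (mhom M As B)" for B
    by (rule bij_betwI[where g = "\<lambda>f. substitute M [P] f ps"])
      (auto intro: mcomp_unary_in_hom[OF _ u] universal_tuple_factor[OF ps]
        universal_tuple_factor_unique[OF ps])
  then show "preuniversal M u" using u by (simp add: preuniversal_def mhom_def)
qed

text \<open>Isomorphisms of contexts compose: an inverse of the composite splits \<open>P\<close> by
  the inverse \<open>ps\<close> of \<open>u\<close>, and then each component by the inverse
  \<open>qs i\<close> of the corresponding arrow of \<open>us\<close>.\<close>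

lemma preuniversal_comp:
  assumes comp: "composable M u us" and "preuniversal M u" and "\<forall>v \<in> set us. preuniversal M v"
  shows "preuniversal M (mComp M u us)"
proof -
  define n As P where "n = length us" and "As = mDom M u" and "P = mCod M u"
  define ms \<Gamma> where "ms = map (\<lambda>g. length (mDom M g)) us" and "\<Gamma> = concat (map (mDom M) us)"
  define \<rho> where "\<rho> i = map (\<lambda>k. block_start ms i + k) [0..<ms ! i]" for i
  have n: "length As = n"
    using comp by (auto simp: composable_def As_def n_def dest: arg_cong[where f = length])
  have u: "u \<in> mhom M As P" using comp by (auto simp: composable_def mhom_def As_def P_def)
  obtain ps where ps: "universal_tuple M As P u ps"
    using preuniversal_iff_universal_tuple[OF u] assms(2) by blast
  note ps' = universal_tupleD[OF ps]
  have lps: "length ps = n" using mhomsD(1)[OF ps'(2)] n by simp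
  have us: "us ! i \<in> mhom M (mDom M (us ! i)) (As ! i)" if "i < n" for i
    using that comp by
      (auto simp: composable_def mhom_def As_def n_def subset_iff dest: arg_cong[where f = "\<lambda>xs. xs ! i"])
  have "\<exists>qs. universal_tuple M (mDom M (us ! i)) (As ! i) (us ! i) qs" if "i < n" for i
    using preuniversal_iff_universal_tuple[OF us[OF that]] assms(3) that by (auto simp: n_def)
  then obtain qs where qs: "\<And>i. i < n \<Longrightarrow> universal_tuple M (mDom M (us ! i)) (As ! i) (us ! i) (qs i)"
    by metis
  note qs' = universal_tupleD[OF qs]
  have \<Gamma>: "set \<Gamma> \<subseteq> mOb M" using comp mdom_in_Ob by (force simp: \<Gamma>_def composable_def)
  \<comment> \<open>The arrow \<open>us ! i\<close>, weakened from its own domain to the whole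
    context \<open>\<Gamma>\<close>.\<close>
  define v where "v i = substitute M \<Gamma> (us ! i) (map (projection M \<Gamma>) (\<rho> i))" for i
  define vs where "vs = map v [0..<n]"
  have w: "mComp M u us = substitute M \<Gamma> u vs"
    using comp_eq_substitute(1)[OF comp] by
      (simp add: vs_def v_def[abs_def] n_def ms_def \<Gamma>_def \<rho>_def)
  have re: "reindexing (\<rho> i) (mDom M (us ! i)) \<Gamma>" if "i < n" for i
    using comp_eq_substitute(2)[OF comp] that by (simp add: n_def ms_def \<Gamma>_def \<rho>_def)
  have \<rho>s: "mhoms M \<Gamma> (mDom M (us ! i)) (map (projection M \<Gamma>) (\<rho> i))" if "i < n" for i
    using projections_in_homs[OF \<Gamma> re[OF that]] .
  have v: "v i \<in> mhom M \<Gamma> (As ! i)" if "i < n" for i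
    using substitute_in_hom[OF us[OF that] \<rho>s[OF that] \<Gamma>] by (simp add: v_def)
  have vs: "mhoms M \<Gamma> As vs" using v n by (simp add: vs_def list_all2_conv_all_nth)
  have w_in: "mComp M u us \<in> mhom M \<Gamma> P" using substitute_in_hom[OF u vs \<Gamma>] w by simp
  \<comment> \<open>Candidate projections: from \<open>P\<close> to the component
    \<open>As ! i\<close>, and from there to the objects of block \<open>i\<close>.\<close>
  define t where "t i = map (\<lambda>q. mComp M q [ps ! i]) (qs i)" for i
  define ts where "ts = concat (map t [0..<n])"
  have len_t: "length (t i) = length (mDom M (us ! i))" if "i < n" for i
    using mhomsD(1)[OF qs'(2)[OF that]] by (simp add: t_def)
  have p_in: "ps ! i \<in> mhom M [P] (As ! i)" if "i < n" for i
    using mhomsD(5)[OF ps'(2)] that n by simp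
  have q_in: "qs i ! j \<in> mhom M [As ! i] (mDom M (us ! i) ! j)"
    if "i < n" "j < length (mDom M (us ! i))" for i j
    using mhomsD(5)[OF qs'(2)] that by simp
  have t_in: "mhoms M [P] (mDom M (us ! i)) (t i)" if "i < n" for i
    using mcomp_unary_in_hom[OF q_in p_in] that len_t[OF that]
    by (simp add: list_all2_conv_all_nth t_def)
  have \<Gamma>': "\<Gamma> = concat (map (\<lambda>i. mDom M (us ! i)) [0..<n])"
    unfolding \<Gamma>_def by (rule arg_cong[where f = concat], rule nth_equalityI) (simp_all add: n_def)
  have ts_in: "mhoms M [P] \<Gamma> ts"
  proof -
    have "mhoms M [P] (concat (map (\<lambda>i. mDom M (us ! i)) is)) (concat (map t is))"
      if "set is \<subseteq> {..<n}" for "is"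
      using that t_in by (induction "is") (auto intro!: list_all2_appendI)
    then show ?thesis unfolding ts_def \<Gamma>' by (simp add: atLeast0LessThan)
  qed
  have pw: "mComp M (ps ! i) [mComp M u us] = v i" if i: "i < n" for i
    using universal_tuple_pairing(2)[OF ps vs \<Gamma>, THEN arg_cong[where f = "\<lambda>xs. xs ! i"]]
      i lps by (simp add: w vs_def)
  have "map (\<lambda>x. mComp M x [mComp M u us]) (t i) = map (projection M \<Gamma>) (\<rho> i)" if i: "i < n" for i
  proof -
    have "mComp M (mComp M (qs i ! j) [ps ! i]) [mComp M u us] = mComp M (qs i ! j) [v i]"
      if "j < length (mDom M (us ! i))" for j
      using unary_assoc[OF w_in p_in[OF i] q_in[OF i that]] pw[OF i] by simp
    then have "map (\<lambda>x. mComp M x [mComp M u us]) (t i) = map (\<lambda>q. mComp M q [v i]) (qs i)"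
      using len_t[OF i] by (auto simp: t_def in_set_conv_nth)
    then show ?thesis
      using universal_tuple_pairing(2)[OF qs[OF i] \<rho>s[OF i] \<Gamma>] by (simp add: v_def)
  qed
  then have "map (\<lambda>x. mComp M x [mComp M u us]) ts = map (projection M \<Gamma>) (concat (map \<rho> [0..<n]))"
    unfolding ts_def map_concat map_map by (auto intro!: arg_cong[where f = concat])
  moreover have "concat (map \<rho> [0..<n]) = [0..<length \<Gamma>]"
    using block_mapping_id[of ms]
    by (simp add: \<rho>_def[abs_def] block_mapping_def ms_def n_def \<Gamma>_def length_concat comp_def)
  ultimately have ts_w: "map (\<lambda>x. mComp M x [mComp M u us]) ts = map (projection M \<Gamma>) [0..<length \<Gamma>]"
    by simp
  have P: "set [P] \<subseteq> mOb M" using ps'(5) by simp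
  have ms: "ms = map length (map t [0..<n])"
    using len_t by (auto simp: ms_def n_def intro!: nth_equalityI)
  \<comment> \<open>The arrow \<open>v i\<close> sees only block \<open>i\<close> of
    \<open>ts\<close>, which is \<open>t i\<close>; and tupling the components \<open>t i\<close> of
    \<open>ps ! i\<close> with \<open>us ! i\<close> gives back \<open>ps ! i\<close>.\<close>
  have "substitute M [P] (v i) ts = ps ! i" if i: "i < n" for i
  proof -
    have "map (\<lambda>r. substitute M [P] r ts) (map (projection M \<Gamma>) (\<rho> i)) = t i"
    proof (rule nth_equalityI)
      fix j assume "j < length (map (\<lambda>r. substitute M [P] r ts) (map (projection M \<Gamma>) (\<rho> i)))"
      then have j: "j < ms ! i" by (simp add: \<rho>_def)
      then have j': "j < length (t i)" using i by (simp add: ms)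
      have "ts ! (block_start ms i + j) = t i ! j" "block_start ms i + j < length \<Gamma>"
        using nth_concat_block[of i "map t [0..<n]" j] i j' mhomsD(1)[OF ts_in]
        unfolding ms[symmetric] by (simp_all add: ts_def)
      then show "map (\<lambda>r. substitute M [P] r ts) (map (projection M \<Gamma>) (\<rho> i)) ! j = t i ! j"
        using substitute_projection[OF ts_in _ \<Gamma> P] j by (simp add: \<rho>_def)
    qed (use i in \<open>simp add: \<rho>_def ms\<close>)
    then have "substitute M [P] (v i) ts = substitute M [P] (us ! i) (t i)"
      using substitute_substitute[OF us[OF i] \<rho>s[OF i] ts_in \<Gamma> P] by (simp add: v_def)
    also have "\<dots> = ps ! i"
      using universal_tuple_pairing_unique[OF qs[OF i] p_in[OF i]] by (simp add: t_def)
    finally show ?thesis .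
  qed
  then have "map (\<lambda>v. substitute M [P] v ts) vs = ps"
    using lps by (auto simp: vs_def intro!: nth_equalityI)
  then have "substitute M [P] (mComp M u us) ts = mIdent M P"
    using substitute_substitute[OF u vs ts_in \<Gamma> P] ps'(3) by (simp add: w)
  then have "universal_tuple M \<Gamma> P (mComp M u us) ts"
    using w_in ts_in ts_w by (simp add: universal_tuple_def)
  then show ?thesis using preuniversal_iff_universal_tuple[OF w_in] by blast
qed

text \<open>The closure clause of \<open>representable\<close> is supplied by
  \<open>preuniversal_comp\<close>, the existence clause by the equational form of
  preuniversality.\<close>

lemma representable_iff_universal_tuples:
  "representable M \<longleftrightarrow> (\<forall>As. set As \<subseteq> mOb M \<longrightarrow> (\<exists>P u ps. universal_tuple M As P u ps))"
proof
  assume rep: "representable M"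
  show "\<forall>As. set As \<subseteq> mOb M \<longrightarrow> (\<exists>P u ps. universal_tuple M As P u ps)"
  proof (intro allI impI)
    fix As assume "set As \<subseteq> mOb M"
    then obtain u where "preuniversal M u" "mDom M u = As"
      using rep by (auto simp: representable_def)
    then show "\<exists>P u ps. universal_tuple M As P u ps"
      using preuniversal_iff_universal_tuple[of u As "mCod M u"]
      by (auto simp: preuniversal_def mhom_def)
  qed
next
  assume "\<forall>As. set As \<subseteq> mOb M \<longrightarrow> (\<exists>P u ps. universal_tuple M As P u ps)"
  then show "representable M"
    unfolding representable_def
    using preuniversal_comp preuniversal_iff_universal_tuple universal_tupleD(1) mhomD(2) by metis
qed

lemma universal_tuple_is_product:
  assumes u: "universal_tuple M As P u ps"
  shows "is_product (unary_category M) As P ps"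
proof -
  note u' = universal_tupleD[OF u]
  have "\<exists>!h. h \<in> mhom M [X] P \<and> map (\<lambda>p. mComp M p [h]) ps = fs"
    if X: "X \<in> mOb M" and fs: "mhoms M [X] As fs" for X fs
  proof (rule ex1I)
    show "substitute M [X] u fs \<in> mhom M [X] P \<and>
        map (\<lambda>p. mComp M p [substitute M [X] u fs]) ps = fs"
      using universal_tuple_pairing[OF u fs] X by simp
  qed (use universal_tuple_pairing_unique[OF u] in auto)
  then show ?thesis using u' by (simp add: is_product_def)
qed

text \<open>A product speaks only of cones of unary arrows, whereas a universal tuple needs an arrow
  out of \<open>As\<close>. Representability supplies one into another product \<open>P'\<close>,
  and it is carried over to \<open>P\<close> by the comparison arrow \<open>k\<close>.\<close>

lemma is_product_universal_tuple:
  assumes "representable M" "set As \<subseteq> mOb M" and prod: "is_product (unary_category M) As P ps"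
  obtains u where "universal_tuple M As P u ps"
proof -
  obtain P' u' ps' where u': "universal_tuple M As P' u' ps'"
    using assms(1,2) representable_iff_universal_tuples by blast
  note u'' = universal_tupleD[OF u']
  have P: "P \<in> mOb M" and ps: "mhoms M [P] As ps" using prod by (auto simp: is_product_def)
  have uniq: "\<exists>!h. h \<in> mhom M [X] P \<and> map (\<lambda>p. mComp M p [h]) ps = fs"
    if "X \<in> mOb M" "mhoms M [X] As fs" for X fs
    using prod that by (auto simp: is_product_def)
  obtain k where k: "k \<in> mhom M [P'] P" "map (\<lambda>p. mComp M p [k]) ps = ps'"
    using uniq[OF u''(5,2)] by auto
  \<comment> \<open>Comparison in the other direction; \<open>k\<close> after \<open>j\<close> is
    the identity because both have the same components along \<open>ps\<close>.\<close>
  define j where "j = substitute M [P] u' ps"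
  have P1: "set [P] \<subseteq> mOb M" using P by simp
  have j: "j \<in> mhom M [P] P'" "map (\<lambda>p. mComp M p [j]) ps' = ps"
    using universal_tuple_pairing[OF u' ps P1] by (simp_all add: j_def)
  have p_in: "\<exists>B. p \<in> mhom M [P] B" if "p \<in> set ps" for p
    using ps that by (auto simp: list_all2_conv_all_nth in_set_conv_nth)
  have "map (\<lambda>p. mComp M p [mComp M k [j]]) ps = map (\<lambda>p. mComp M p [j]) (map (\<lambda>p. mComp M p [k]) ps)"
    using p_in unary_assoc[OF j(1) k(1)] by auto
  then have "map (\<lambda>p. mComp M p [mComp M k [j]]) ps = ps" using j k by simp
  moreover have "map (\<lambda>p. mComp M p [mIdent M P]) ps = ps"
    using p_in mcomp_ident by (auto intro!: map_idI)
  ultimately have kj: "mComp M k [j] = mIdent M P"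
    using uniq[OF P ps] mcomp_unary_in_hom[OF k(1) j(1)] mident_in_hom[OF P] by blast
  have ku: "mComp M k [u'] \<in> mhom M As P" using mcomp_unary_in_hom[OF k(1) u''(1)] .
  have "map (\<lambda>p. mComp M p [mComp M k [u']]) ps = map (\<lambda>p. mComp M p [u']) (map (\<lambda>p. mComp M p [k]) ps)"
    using p_in unary_assoc[OF u''(1) k(1)] by auto
  then have "map (\<lambda>p. mComp M p [mComp M k [u']]) ps = map (projection M As) [0..<length As]"
    using k u' by (simp add: universal_tuple_def)
  moreover have "substitute M [P] (mComp M k [u']) ps = mIdent M P"
    using comp_substitute_right[OF k(1) u''(1) ps P1] kj by (simp add: j_def)
  ultimately have "universal_tuple M As P (mComp M k [u']) ps"
    using ku ps by (simp add: universal_tuple_def)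
  then show thesis by (rule that)
qed

lemma finite_product_category_unary_category:
  assumes "representable M"
  shows "finite_product_category (unary_category M)"
proof (intro finite_product_category.intro category_unary_category finite_product_category_axioms.intro)
  fix As assume "set As \<subseteq> Ob (unary_category M)"
  then show "\<exists>P ps. is_product (unary_category M) As P ps"
    using assms representable_iff_universal_tuples universal_tuple_is_product by fastforce
qed

end

section \<open>Cartesian functors\<close>

lemma reindexing_map: "reindexing \<sigma> As Bs \<Longrightarrow> reindexing \<sigma> (map F As) (map F Bs)"
  by (auto simp: reindexing_def subset_iff)

lemma mhoms_elem: "\<lbrakk>mhoms M \<Gamma> As gs; g \<in> set gs\<rbrakk> \<Longrightarrow> \<exists>A. g \<in> mhom M \<Gamma> A"
  by (auto simp: list_all2_conv_all_nth in_set_conv_nth)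

lemma mhoms_map:
  assumes "mhoms M \<Gamma> As gs" "\<And>g A. \<lbrakk>A \<in> set As; g \<in> mhom M \<Gamma> A\<rbrakk> \<Longrightarrow> F g \<in> mhom N \<Delta> (G A)"
  shows "mhoms N \<Delta> (map G As) (map F gs)"
  using assms by (auto simp: list_all2_conv_all_nth)

text \<open>An inverse is determined: \<open>u' = u[p\<^sub>1 u', ..., p\<^sub>n u'] =
  u[\<pi>\<^sub>1, ..., \<pi>\<^sub>n] = u\<close>. This compares the images of one universal arrow
  under two functors.\<close>

lemma (in cartesian_multicategory) universal_tuple_unique:
  assumes "universal_tuple M As P u ps" "universal_tuple M As P u' ps"
  shows "u = u'"
  using universal_tuple_pairing_unique[OF assms(1) universal_tupleD(1)[OF assms(2)]]
    universal_tuple_pairing_unique[OF assms(1) universal_tupleD(1)[OF assms(1)]] assms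
  by (simp add: universal_tuple_def)

context cartesian_functor
begin

lemma map_mhoms: "mhoms M \<Gamma> As gs \<Longrightarrow> mhoms N (map Fo \<Gamma>) (map Fo As) (map Fa gs)"
  by (rule mhoms_map) (auto intro: map_mhom)

lemma map_projection:
  assumes "set \<Gamma> \<subseteq> mOb M" "i < length \<Gamma>"
  shows "Fa (projection M \<Gamma> i) = projection N (map Fo \<Gamma>) i"
proof -
  have A: "\<Gamma> ! i \<in> mOb M" using assms by auto
  have "mIdent M (\<Gamma> ! i) \<in> mAr M" "reindexing [i] (mDom M (mIdent M (\<Gamma> ! i))) \<Gamma>"
    using source.mident_in_hom[OF A] assms by (auto simp: mhom_def reindexing_def)
  then show ?thesis
    using map_act[of _ \<Gamma>] map_mident[OF A] assms by (simp add: projection_def)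
qed

lemma map_substitute:
  assumes f: "f \<in> mhom M As B" and gs: "mhoms M \<Gamma> As gs" and \<Gamma>: "set \<Gamma> \<subseteq> mOb M"
  shows "Fa (substitute M \<Gamma> f gs) = substitute N (map Fo \<Gamma>) (Fa f) (map Fa gs)"
proof -
  note fg = source.mcomp_mhoms_in_hom[OF f gs]
  have "reindexing (concat (replicate (length gs) [0..<length \<Gamma>])) (mDom M (mComp M f gs)) \<Gamma>"
    using mhomD(2)[OF fg] mhomsD(1)[OF gs]
    by (auto simp: reindexing_def map_nth_concat_replicate)
  then show ?thesis
    using map_act[OF mhomD(1)[OF fg] \<Gamma>] map_mcomp[OF composable_mhoms[OF f gs]]
    by (simp add: substitute_def)
qed

lemma map_universal_tuple:
  assumes u: "universal_tuple M As P u ps"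
  shows "universal_tuple N (map Fo As) (Fo P) (Fa u) (map Fa ps)"
proof -
  note u' = source.universal_tupleD[OF u]
  have "map (\<lambda>p. mComp N p [Fa u]) (map Fa ps) = map Fa (map (\<lambda>p. mComp M p [u]) ps)"
  proof -
    have "composable M p [u]" if "p \<in> set ps" for p
      using that u'(1,2) by
        (auto simp: list_all2_conv_all_nth in_set_conv_nth composable_def mhom_def)
    then show ?thesis using map_mcomp by simp
  qed
  also have "\<dots> = map (projection N (map Fo As)) [0..<length (map Fo As)]"
    using u u'(4) map_projection by (simp add: universal_tuple_def)
  finally show ?thesis
    using map_mhom[OF u'(1)] map_mhoms[OF u'(2)] map_substitute[OF u'(1,2)] u'(3,5) map_mident
    by (simp add: universal_tuple_def)
qed

text \<open>A product cone in the unary part of \<open>M\<close> belongs to a universal tuple, whose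
  image is again a universal tuple and hence a product cone.\<close>

lemma finite_product_functor_unary_category:
  assumes "representable M"
  shows "finite_product_functor (unary_category M) (unary_category N) Fo Fa"
proof (intro finite_product_functor.intro finite_product_functor_axioms.intro cat_functor.intro
    source.category_unary_category target.category_unary_category cat_functor_axioms.intro)
  fix f A B assume "f \<in> hom (unary_category M) A B"
  then show "Fa f \<in> hom (unary_category N) (Fo A) (Fo B)" using map_mhom by fastforce
next
  fix f A B g E assume "f \<in> hom (unary_category M) A B" "g \<in> hom (unary_category M) B E"
  then show "Fa (Comp (unary_category M) g f) = Comp (unary_category N) (Fa g) (Fa f)"
    using map_mcomp[of g "[f]"] by (simp add: composable_def mhom_def)
next
  fix As P ps assume "set As \<subseteq> Ob (unary_category M)" "is_product (unary_category M) As P ps"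
  then obtain u where "universal_tuple M As P u ps"
    using source.is_product_universal_tuple[OF assms] by (metis unary_category_simps(1))
  then show "is_product (unary_category N) (map Fo As) (Fo P) (map Fa ps)"
    using map_universal_tuple target.universal_tuple_is_product by blast
qed (use map_mOb map_mident in auto)

end

text \<open>Agreement on unary arrows spreads first to \<open>u\<close>, whose image is determined
  by the images of \<open>ps\<close>, and then to \<open>f\<close>, which is a unary arrow composed
  with \<open>u\<close>.\<close>

lemma cartesian_functor_eqI:
  assumes "cartesian_functor M N Fo Fa" "cartesian_functor M N Fo Ga" "representable M"
    and eq: "\<And>A B g. g \<in> mhom M [A] B \<Longrightarrow> Fa g = Ga g"
    and f: "f \<in> mAr M"
  shows "Fa f = Ga f"
proof -
  interpret F: cartesian_functor M N Fo Fa by fact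
  interpret G: cartesian_functor M N Fo Ga by fact
  define As B where "As = mDom M f" and "B = mCod M f"
  have f: "f \<in> mhom M As B" using f by (simp add: As_def B_def mhom_def)
  obtain P u ps where u: "universal_tuple M As P u ps"
    using F.source.representable_iff_universal_tuples assms(3) F.source.mhom_Ob(1)[OF f] by blast
  note u' = F.source.universal_tupleD[OF u]
  define g where "g = substitute M [P] f ps"
  have g: "g \<in> mhom M [P] B" "mComp M g [u] = f"
    using F.source.universal_tuple_factor[OF u f] by (simp_all add: g_def)
  then have comp: "composable M g [u]" using u'(1) by (simp add: composable_def mhom_def)
  have "map Fa ps = map Ga ps"
    using mhoms_elem[OF u'(2)] eq by (metis map_cong)
  then have "Fa u = Ga u"
    using F.map_universal_tuple[OF u] G.map_universal_tuple[OF u] F.target.universal_tuple_unique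
    by metis
  then show ?thesis
    using F.map_mcomp[OF comp] G.map_mcomp[OF comp] eq[OF g(1)] g(2) by simp
qed

text \<open>By \<open>comp_eq_substitute\<close> and \<open>act_eq_substitute\<close>, composition
  and action are terms in projections and substitution.\<close>

lemma cartesian_functorI:
  assumes "cartesian_multicategory M" "cartesian_multicategory N"
    and Ob: "\<And>A. A \<in> mOb M \<Longrightarrow> Fo A \<in> mOb N"
    and homs: "\<And>f As B. f \<in> mhom M As B \<Longrightarrow> Fa f \<in> mhom N (map Fo As) (Fo B)"
    and ident: "\<And>A. A \<in> mOb M \<Longrightarrow> Fa (mIdent M A) = mIdent N (Fo A)"
    and proj: "\<And>\<Gamma> i. \<lbrakk>set \<Gamma> \<subseteq> mOb M; i < length \<Gamma>\<rbrakk>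
      \<Longrightarrow> Fa (projection M \<Gamma> i) = projection N (map Fo \<Gamma>) i"
    and subst: "\<And>\<Gamma> f gs As B. \<lbrakk>f \<in> mhom M As B; mhoms M \<Gamma> As gs; set \<Gamma> \<subseteq> mOb M\<rbrakk>
      \<Longrightarrow> Fa (substitute M \<Gamma> f gs) = substitute N (map Fo \<Gamma>) (Fa f) (map Fa gs)"
  shows "cartesian_functor M N Fo Fa"
proof -
  interpret M: cartesian_multicategory M by fact
  interpret N: cartesian_multicategory N by fact
  have projs: "map Fa (map (projection M \<Gamma>) \<sigma>) = map (projection N (map Fo \<Gamma>)) \<sigma>"
    if "set \<Gamma> \<subseteq> mOb M" "reindexing \<sigma> As \<Gamma>" for \<Gamma> \<sigma> As
    using that proj by (auto simp: reindexing_def)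
  have Obs: "set (map Fo \<Gamma>) \<subseteq> mOb N" if "set \<Gamma> \<subseteq> mOb M" for \<Gamma>
    using that Ob by auto
  show ?thesis
  proof
    fix f gs assume c: "composable M f gs"
    define ms \<Gamma> where "ms = map (\<lambda>g. length (mDom M g)) gs" and "\<Gamma> = concat (map (mDom M) gs)"
    define \<rho> where "\<rho> i = map (\<lambda>k. block_start ms i + k) [0..<ms ! i]" for i
    define v where "v i = substitute M \<Gamma> (gs ! i) (map (projection M \<Gamma>) (\<rho> i))" for i
    have \<Gamma>: "set \<Gamma> \<subseteq> mOb M" using c M.mdom_in_Ob by (force simp: \<Gamma>_def composable_def)
    have f: "f \<in> mhom M (map (mCod M) gs) (mCod M f)" using c by (simp add: composable_def mhom_def)
    have g: "gs ! i \<in> mhom M (mDom M (gs ! i)) (mCod M (gs ! i))" if "i < length gs" for i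
      using c that by (auto simp: composable_def mhom_def)
    have re: "reindexing (\<rho> i) (mDom M (gs ! i)) \<Gamma>" if "i < length gs" for i
      using M.comp_eq_substitute(2)[OF c that] by (simp add: ms_def \<Gamma>_def \<rho>_def)
    have v: "v i \<in> mhom M \<Gamma> (mCod M (gs ! i))" if "i < length gs" for i
      using M.substitute_in_hom[OF g[OF that] M.projections_in_homs[OF \<Gamma> re[OF that]] \<Gamma>]
      by (simp add: v_def)
    have Fv: "Fa (v i) = substitute N (map Fo \<Gamma>) (Fa (gs ! i)) (map (projection N (map Fo \<Gamma>)) (\<rho> i))"
      if "i < length gs" for i
      using subst[OF g[OF that] M.projections_in_homs[OF \<Gamma> re[OF that]] \<Gamma>] projs[OF \<Gamma> re[OF that]]
      by (simp add: v_def del: map_map)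
    have "mComp M f gs = substitute M \<Gamma> f (map v [0..<length gs])"
      using M.comp_eq_substitute(1)[OF c] by (simp add: v_def[abs_def] ms_def \<Gamma>_def \<rho>_def)
    then have "Fa (mComp M f gs) = substitute N (map Fo \<Gamma>) (Fa f) (map (\<lambda>i. Fa (v i)) [0..<length gs])"
      using subst[OF f _ \<Gamma>, of "map v [0..<length gs]"] v by
        (simp add: list_all2_conv_all_nth comp_def)
    also have "map (\<lambda>i. Fa (v i)) [0..<length gs] = map (\<lambda>i. substitute N (map Fo \<Gamma>) (map Fa gs ! i)
        (map (projection N (map Fo \<Gamma>)) (\<rho> i))) [0..<length (map Fa gs)]"
      using Fv by simp
    \<comment> \<open>The same formula read backwards in \<open>N\<close>; the block lengths agree
      because \<open>Fa\<close> keeps arities.\<close>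
    also have "substitute N (map Fo \<Gamma>) (Fa f) \<dots> = mComp N (Fa f) (map Fa gs)"
    proof -
      have Fg: "Fa g \<in> mhom N (map Fo (mDom M g)) (Fo (mCod M g))" if "g \<in> set gs" for g
        using that c homs by (auto simp: composable_def mhom_def)
      then have "composable N (Fa f) (map Fa gs)"
        using homs[OF f] by (auto simp: composable_def mhom_def)
      moreover have "map (\<lambda>g. length (mDom N g)) (map Fa gs) = ms"
        "concat (map (mDom N) (map Fa gs)) = map Fo \<Gamma>"
        using Fg by (auto simp: ms_def \<Gamma>_def mhom_def map_concat intro!: arg_cong[where f = concat])
      ultimately show ?thesis
        using N.comp_eq_substitute(1)[of "Fa f" "map Fa gs"] by (simp add: \<rho>_def)
    qed
    finally show "Fa (mComp M f gs) = mComp N (Fa f) (map Fa gs)" .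
  next
    fix f Bs \<sigma> assume f: "f \<in> mAr M" and Bs: "set Bs \<subseteq> mOb M" and \<sigma>: "reindexing \<sigma> (mDom M f) Bs"
    have f: "f \<in> mhom M (mDom M f) (mCod M f)" using f by (simp add: mhom_def)
    show "Fa (mAct M Bs \<sigma> f) = mAct N (map Fo Bs) \<sigma> (Fa f)"
      using M.act_eq_substitute[OF f Bs \<sigma>]
        N.act_eq_substitute[OF homs[OF f] Obs[OF Bs] reindexing_map[OF \<sigma>]]
        subst[OF f M.projections_in_homs[OF Bs \<sigma>] Bs] projs[OF Bs \<sigma>]
      by (simp del: map_map)
  qed (use Ob homs ident in auto)
qed

text \<open>The relation \<open>extends\<close> mentions no chosen universal tuple, so the clone
  laws for \<open>Fa\<close> are obtained by checking that the expected value satisfies it. Its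
  existence and uniqueness come from a universal tuple of \<open>M\<close> whose projections are
  taken by \<open>Ha\<close> to those of a universal tuple of \<open>N\<close>.\<close>

lemma finite_product_functor_extension:
  assumes "cartesian_multicategory M" "cartesian_multicategory N" "representable M" "representable N"
    and H: "finite_product_functor (unary_category M) (unary_category N) Fo Ha"
  obtains Fa where "cartesian_functor M N Fo Fa" "\<And>A B f. f \<in> mhom M [A] B \<Longrightarrow> Fa f = Ha f"
proof -
  interpret M: cartesian_multicategory M by fact
  interpret N: cartesian_multicategory N by fact
  interpret H: finite_product_functor "unary_category M" "unary_category N" Fo Ha by fact
  have Ob: "Fo A \<in> mOb N" if "A \<in> mOb M" for A using H.map_Ob that by simp
  have Obs: "set (map Fo \<Gamma>) \<subseteq> mOb N" if "set \<Gamma> \<subseteq> mOb M" for \<Gamma> using that Ob by auto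
  have Ha: "Ha f \<in> mhom N [Fo A] (Fo B)" if "f \<in> mhom M [A] B" for f A B
    using H.map_hom[of f A B] that by simp
  have Ha_comp: "Ha (mComp M g [f]) = mComp N (Ha g) [Ha f]"
    if "f \<in> mhom M [A] B" "g \<in> mhom M [B] C" for f g A B C
    using H.map_comp[of f A B g C] that by simp
  have Has: "mhoms N [Fo X] (map Fo As) (map Ha fs)" if "mhoms M [X] As fs" for X As fs
    by (rule mhoms_map[OF that]) (rule Ha)
  define extends where "extends As B f f' \<longleftrightarrow> f' \<in> mhom N (map Fo As) (Fo B) \<and>
    (\<forall>X \<in> mOb M. \<forall>fs. mhoms M [X] As fs \<longrightarrow>
      substitute N [Fo X] f' (map Ha fs) = Ha (substitute M [X] f fs))" for As B f f'
  \<comment> \<open>The functor on unary arrows says nothing about \<open>u\<close>. Its counterpart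
    \<open>v\<close> is found in \<open>N\<close> from the product cone
    \<open>map Ha ps\<close>.\<close>
  have tuples: "\<exists>P u ps v. universal_tuple M As P u ps \<and>
      universal_tuple N (map Fo As) (Fo P) v (map Ha ps)" if As: "set As \<subseteq> mOb M" for As
  proof -
    obtain P u ps where u: "universal_tuple M As P u ps"
      using M.representable_iff_universal_tuples assms(3) As by blast
    then have "is_product (unary_category N) (map Fo As) (Fo P) (map Ha ps)"
      using H.preserves_products M.universal_tuple_is_product As by simp
    then show ?thesis
      using N.is_product_universal_tuple[OF assms(4) Obs[OF As]] u by metis
  qed
  have ex: "\<exists>f'. extends As B f f'" if f: "f \<in> mhom M As B" for f As B
  proof -
    obtain P u ps v where u: "universal_tuple M As P u ps"
      and v: "universal_tuple N (map Fo As) (Fo P) v (map Ha ps)"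
      using tuples[OF M.mhom_Ob(1)[OF f]] by blast
    note u' = M.universal_tupleD[OF u] and v' = N.universal_tupleD[OF v]
    \<comment> \<open>As \<open>f\<close> is \<open>g\<close> composed with \<open>u\<close>, the
      witness is \<open>Ha g\<close> composed with \<open>v\<close>.\<close>
    define g where "g = substitute M [P] f ps"
    have g: "g \<in> mhom M [P] B" "mComp M g [u] = f"
      using M.universal_tuple_factor[OF u f] by (simp_all add: g_def)
    have "substitute N [Fo X] (mComp N (Ha g) [v]) (map Ha fs) = Ha (substitute M [X] f fs)"
      if X: "X \<in> mOb M" and fs: "mhoms M [X] As fs" for X fs
    proof -
      have X1: "set [X] \<subseteq> mOb M" "set [Fo X] \<subseteq> mOb N" using X Ob by auto
      define h where "h = substitute M [X] u fs"
      have h: "h \<in> mhom M [X] P" "map (\<lambda>p. mComp M p [h]) ps = fs"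
        using M.universal_tuple_pairing[OF u fs X1(1)] by (simp_all add: h_def)
      have "map (\<lambda>p. mComp N p [Ha h]) (map Ha ps) = map Ha (map (\<lambda>p. mComp M p [h]) ps)"
        using mhoms_elem[OF u'(2)] Ha_comp[OF h(1)] by fastforce
      then have "substitute N [Fo X] v (map Ha fs) = Ha h"
        using N.universal_tuple_pairing_unique[OF v Ha[OF h(1)]] h(2) by simp
      then have "substitute N [Fo X] (mComp N (Ha g) [v]) (map Ha fs) = mComp N (Ha g) [Ha h]"
        using N.comp_substitute_right[OF Ha[OF g(1)] v'(1) Has[OF fs] X1(2)] by simp
      also have "\<dots> = Ha (mComp M g [h])" using Ha_comp[OF h(1) g(1)] by simp
      also have "mComp M g [h] = substitute M [X] f fs"
        using M.comp_substitute_right[OF g(1) u'(1) fs X1(1)] g(2) by (simp add: h_def)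
      finally show ?thesis .
    qed
    then show ?thesis
      using N.mcomp_unary_in_hom[OF Ha[OF g(1)] v'(1)] unfolding extends_def by blast
  qed
  have unique: "f' = f''" if "extends As B f f'" "extends As B f f''" and f: "f \<in> mhom M As B"
    for f f' f'' As B
  proof -
    obtain P u ps v where u: "universal_tuple M As P u ps"
      and v: "universal_tuple N (map Fo As) (Fo P) v (map Ha ps)"
      using tuples[OF M.mhom_Ob(1)[OF f]] by blast
    note u' = M.universal_tupleD[OF u]
    \<comment> \<open>Testing at \<open>X = P\<close> and \<open>fs = ps\<close> is decisive,
      because an arrow out of \<open>map Fo As\<close> is recovered from its substitution by the
      projections \<open>map Ha ps\<close>.\<close>
    have "substitute N [Fo P] f' (map Ha ps) = substitute N [Fo P] f'' (map Ha ps)"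
      using that u'(2,5) by (simp add: extends_def)
    then show ?thesis
      using N.universal_tuple_factor(2)[OF v] that unfolding extends_def by metis
  qed
  define Fa where "Fa f = (SOME f'. extends (mDom M f) (mCod M f) f f')" for f
  have Fa: "extends As B f (Fa f)" if "f \<in> mhom M As B" for f As B
    using someI_ex[OF ex[OF that]] that by (simp add: Fa_def mhom_def)
  have Fa_eq: "Fa f = f'" if "f \<in> mhom M As B" "extends As B f f'" for f f' As B
    using unique[OF Fa[OF that(1)] that(2,1)] .
  have unary: "Fa f = Ha f" if f: "f \<in> mhom M [A] B" for f A B
  proof (rule Fa_eq[OF f])
    have "substitute N [Fo X] (Ha f) (map Ha fs) = Ha (substitute M [X] f fs)"
      if "mhoms M [X] [A] fs" for X fs
    proof -
      obtain h where h: "fs = [h]" "h \<in> mhom M [X] A"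
        using \<open>mhoms M [X] [A] fs\<close> by (auto simp: list_all2_Cons2)
      then show ?thesis
        using M.substitute_unary[OF f h(2)] N.substitute_unary[OF Ha[OF f] Ha[OF h(2)]]
          Ha_comp[OF h(2) f] by simp
    qed
    then show "extends [A] B f (Ha f)" using Ha[OF f] by (simp add: extends_def)
  qed
  have Fa_hom: "Fa f \<in> mhom N (map Fo As) (Fo B)" if "f \<in> mhom M As B" for f As B
    using Fa[OF that] by (simp add: extends_def)
  have Fa_subst: "substitute N [Fo X] (Fa f) (map Ha fs) = Ha (substitute M [X] f fs)"
    if "f \<in> mhom M As B" "X \<in> mOb M" "mhoms M [X] As fs" for f As B X fs
    using Fa[OF that(1)] that(2,3) by (simp add: extends_def)
  have "cartesian_functor M N Fo Fa"
  proof (rule cartesian_functorI)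
    fix A assume A: "A \<in> mOb M"
    then show "Fa (mIdent M A) = mIdent N (Fo A)"
      using unary[OF M.mident_in_hom[OF A]] H.map_ident[of A] by simp
  next
    fix \<Gamma> i assume \<Gamma>: "set \<Gamma> \<subseteq> mOb M" and i: "i < length \<Gamma>"
    note \<Gamma>' = Obs[OF \<Gamma>]
    have "substitute N [Fo X] (projection N (map Fo \<Gamma>) i) (map Ha hs) =
        Ha (substitute M [X] (projection M \<Gamma> i) hs)"
      if X: "X \<in> mOb M" and hs: "mhoms M [X] \<Gamma> hs" for X hs
      using N.substitute_projection[OF Has[OF hs] _ \<Gamma>', of i] Ob[OF X]
        M.substitute_projection[OF hs i \<Gamma>] X i mhomsD(1)[OF hs] by simp
    then have "extends \<Gamma> (\<Gamma> ! i) (projection M \<Gamma> i) (projection N (map Fo \<Gamma>) i)"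
      using N.projection_in_hom[OF \<Gamma>', of i] i by (simp add: extends_def)
    then show "Fa (projection M \<Gamma> i) = projection N (map Fo \<Gamma>) i"
      using Fa_eq M.projection_in_hom[OF \<Gamma> i] by blast
  next
    fix \<Gamma> f gs As B assume f: "f \<in> mhom M As B" and gs: "mhoms M \<Gamma> As gs" and \<Gamma>: "set \<Gamma> \<subseteq> mOb M"
    note \<Gamma>' = Obs[OF \<Gamma>]
    have Fgs: "mhoms N (map Fo \<Gamma>) (map Fo As) (map Fa gs)"
      by (rule mhoms_map[OF gs]) (rule Fa_hom)
    have "substitute N [Fo X] (substitute N (map Fo \<Gamma>) (Fa f) (map Fa gs)) (map Ha hs) =
        Ha (substitute M [X] (substitute M \<Gamma> f gs) hs)"
      if X: "X \<in> mOb M" and hs: "mhoms M [X] \<Gamma> hs" for X hs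
    proof -
      have X1: "set [X] \<subseteq> mOb M" "set [Fo X] \<subseteq> mOb N" using X Ob by auto
      have gs_hs: "mhoms M [X] As (map (\<lambda>g. substitute M [X] g hs) gs)"
        using M.substitute_in_hom[OF _ hs X1(1)] gs by (simp add: list_all2_conv_all_nth)
      have "map (\<lambda>g. substitute N [Fo X] g (map Ha hs)) (map Fa gs) =
          map Ha (map (\<lambda>g. substitute M [X] g hs) gs)"
        using Fa_subst[OF _ X hs] mhoms_elem[OF gs] by fastforce
      then show ?thesis
        using N.substitute_substitute[OF Fa_hom[OF f] Fgs Has[OF hs] \<Gamma>' X1(2)]
          Fa_subst[OF f X gs_hs] M.substitute_substitute[OF f gs hs \<Gamma> X1(1)]
        by (simp del: map_map)
    qed
    then have "extends \<Gamma> B (substitute M \<Gamma> f gs) (substitute N (map Fo \<Gamma>) (Fa f) (map Fa gs))"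
      using N.substitute_in_hom[OF Fa_hom[OF f] Fgs \<Gamma>'] by (simp add: extends_def)
    then show "Fa (substitute M \<Gamma> f gs) = substitute N (map Fo \<Gamma>) (Fa f) (map Fa gs)"
      using Fa_eq M.substitute_in_hom[OF f gs \<Gamma>] by blast
  qed (use assms Ob Fa_hom in auto)
  then show thesis using that unary by blast
qed

section \<open>The unary part of a representable cartesian multicategory\<close>

text \<open>Morphisms of structures carry maps cut down to their source. Laws are proved for
  \<open>id\<close> and for ordinary composites, and congruence lemmas such as this transfer them to
  the restricted maps.\<close>

lemma cat_functor_cong:
  assumes "cat_functor C D Fo Fa"
    and Ob: "\<And>A. A \<in> Ob C \<Longrightarrow> Go A = Fo A" and Ar: "\<And>f. f \<in> Ar C \<Longrightarrow> Ga f = Fa f"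
  shows "cat_functor C D Go Ga"
proof -
  interpret F: cat_functor C D Fo Fa by fact
  have hom: "Go A = Fo A \<and> Go B = Fo B \<and> Ga f = Fa f" if "f \<in> hom C A B" for f A B
    using Ob Ar F.source.hom_Ob[OF that] homD(1)[OF that] by simp
  show ?thesis
  proof
    fix f g A B E assume "f \<in> hom C A B" "g \<in> hom C B E"
    then show "Ga (Comp C g f) = Comp D (Ga g) (Ga f)"
      using hom F.source.comp_in_hom F.map_comp by metis
  next
    fix f A B assume f: "f \<in> hom C A B"
    show "Ga f \<in> hom D (Go A) (Go B)" using F.map_hom[OF f] hom[OF f] by simp
  next
    fix A assume A: "A \<in> Ob C"
    show "Ga (Ident C A) = Ident D (Go A)"
      using F.map_ident[OF A] hom[OF F.source.ident_in_hom[OF A]] by simp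
  qed (use F.map_Ob Ob in auto)
qed

lemma finite_product_functor_cong:
  assumes "finite_product_functor C D Fo Fa"
    and Ob: "\<And>A. A \<in> Ob C \<Longrightarrow> Go A = Fo A" and Ar: "\<And>f. f \<in> Ar C \<Longrightarrow> Ga f = Fa f"
  shows "finite_product_functor C D Go Ga"
proof -
  interpret F: finite_product_functor C D Fo Fa by fact
  show ?thesis
  proof (intro finite_product_functor.intro finite_product_functor_axioms.intro
      cat_functor_cong[OF F.cat_functor_axioms Ob Ar])
    fix As P ps assume As: "set As \<subseteq> Ob C" and prod: "is_product C As P ps"
    have P: "P \<in> Ob C" "list_all2 (\<lambda>p A. p \<in> hom C P A) ps As"
      using prod by (auto simp: is_product_def)
    then have "set ps \<subseteq> Ar C" by (auto simp: list_all2_conv_all_nth hom_def in_set_conv_nth)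
    then have "map Go As = map Fo As" "map Ga ps = map Fa ps" "Go P = Fo P"
      using As Ob Ar P by (auto simp: subset_iff)
    then show "is_product D (map Go As) (Go P) (map Ga ps)"
      using F.preserves_products[OF As prod] by metis
  qed
qed

lemma finite_product_functor_id: "category C \<Longrightarrow> finite_product_functor C C id id"
  by (intro finite_product_functor.intro finite_product_functor_axioms.intro category.id_functor)
    simp_all

lemma finite_product_functor_comp:
  assumes "finite_product_functor C D Fo Fa" "finite_product_functor D E Go Ga"
  shows "finite_product_functor C E (Go \<circ> Fo) (Ga \<circ> Fa)"
proof -
  interpret F: finite_product_functor C D Fo Fa by fact
  interpret G: finite_product_functor D E Go Ga by fact
  show ?thesis
  proof (intro finite_product_functor.intro finite_product_functor_axioms.intro
      functor_comp[OF F.cat_functor_axioms G.cat_functor_axioms])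
    fix As P ps assume As: "set As \<subseteq> Ob C" "is_product C As P ps"
    then have "set (map Fo As) \<subseteq> Ob D" using F.map_Ob by auto
    from G.preserves_products[OF this F.preserves_products[OF As]]
    show "is_product E (map (Go \<circ> Fo) As) ((Go \<circ> Fo) P) (map (Ga \<circ> Fa) ps)" by simp
  qed
qed

lemma cartesian_functor_cong:
  assumes "cartesian_functor M N Fo Fa"
    and Ob: "\<And>A. A \<in> mOb M \<Longrightarrow> Go A = Fo A" and Ar: "\<And>f. f \<in> mAr M \<Longrightarrow> Ga f = Fa f"
  shows "cartesian_functor M N Go Ga"
proof -
  interpret F: cartesian_functor M N Fo Fa by fact
  have Obs: "map Go As = map Fo As" if "set As \<subseteq> mOb M" for As
    using that Ob by (auto simp: subset_iff)
  have hom: "map Go As = map Fo As \<and> Go B = Fo B \<and> Ga f = Fa f" if "f \<in> mhom M As B" for f As B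
    using Obs Ob Ar F.source.mhom_Ob[OF that] mhomD(1)[OF that] by simp
  show ?thesis
  proof
    fix f gs assume c: "composable M f gs"
    then have "map Ga gs = map Fa gs" "Ga f = Fa f"
      using Ar by (auto simp: composable_def subset_iff)
    then show "Ga (mComp M f gs) = mComp N (Ga f) (map Ga gs)"
      using F.map_mcomp[OF c] hom[OF F.source.mcomp_in_hom[OF c]] by metis
  next
    fix f Bs \<sigma> assume f: "f \<in> mAr M" "set Bs \<subseteq> mOb M" "reindexing \<sigma> (mDom M f) Bs"
    show "Ga (mAct M Bs \<sigma> f) = mAct N (map Go Bs) \<sigma> (Ga f)"
      using hom[OF F.source.act_in_hom[OF f]] F.map_act[OF f] Obs[OF f(2)] Ar[OF f(1)]
      by metis
  next
    fix f As B assume f: "f \<in> mhom M As B"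
    show "Ga f \<in> mhom N (map Go As) (Go B)" using F.map_mhom[OF f] hom[OF f] by metis
  next
    fix A assume A: "A \<in> mOb M"
    show "Ga (mIdent M A) = mIdent N (Go A)"
      using F.map_mident[OF A] hom[OF F.source.mident_in_hom[OF A]] by simp
  qed (use F.map_mOb Ob in auto)
qed

lemma cartesian_functor_id:
  assumes "cartesian_multicategory M"
  shows "cartesian_functor M M id id"
proof -
  interpret cartesian_multicategory M by fact
  show ?thesis by unfold_locales auto
qed

lemma cartesian_functor_comp:
  assumes "cartesian_functor M N Fo Fa" "cartesian_functor N K Go Ga"
  shows "cartesian_functor M K (Go \<circ> Fo) (Ga \<circ> Fa)"
proof -
  interpret F: cartesian_functor M N Fo Fa by fact
  interpret G: cartesian_functor N K Go Ga by fact
  show ?thesis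
  proof
    fix f gs assume c: "composable M f gs"
    have g: "Fa g \<in> mhom N (map Fo (mDom M g)) (Fo (mCod M g))" if "g \<in> set gs \<union> {f}" for g
      using that c F.map_mhom by (auto simp: composable_def mhom_def)
    then have "map (mCod N) (map Fa gs) = map Fo (map (mCod M) gs)" by (auto simp: mhom_def)
    moreover have "Fa f \<in> mAr N" "mDom N (Fa f) = map Fo (mDom M f)" "set (map Fa gs) \<subseteq> mAr N"
      using g by (auto simp: mhom_def)
    ultimately have "composable N (Fa f) (map Fa gs)"
      using c unfolding composable_def by metis
    then show "(Ga \<circ> Fa) (mComp M f gs) = mComp K ((Ga \<circ> Fa) f) (map (Ga \<circ> Fa) gs)"
      using F.map_mcomp[OF c] G.map_mcomp by simp
  next
    fix f Bs \<sigma> assume f: "f \<in> mAr M" "set Bs \<subseteq> mOb M" "reindexing \<sigma> (mDom M f) Bs"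
    have "Fa f \<in> mAr N" "set (map Fo Bs) \<subseteq> mOb N" "reindexing \<sigma> (mDom N (Fa f)) (map Fo Bs)"
      using F.map_mhom[of f "mDom M f" "mCod M f"] f F.map_mOb reindexing_map[OF f(3), of Fo]
      by (auto simp: mhom_def)
    then show "(Ga \<circ> Fa) (mAct M Bs \<sigma> f) = mAct K (map (Go \<circ> Fo) Bs) \<sigma> ((Ga \<circ> Fa) f)"
      using F.map_act[OF f] G.map_act by simp
  next
    fix f As B assume "f \<in> mhom M As B"
    then show "(Ga \<circ> Fa) f \<in> mhom K (map (Go \<circ> Fo) As) ((Go \<circ> Fo) B)"
      using G.map_mhom[OF F.map_mhom] by fastforce
  qed (auto simp: F.map_mOb G.map_mOb F.map_mident G.map_mident)
qed

section \<open>The categories of structures and their hom-sets\<close>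

lemma category_fpCat: "category fpCat"
  unfolding fpCat_def
proof (rule structure_category, goal_cases)
  case (1 X Y Fo Fa)
  then interpret finite_product_functor X Y Fo Fa by simp
  show ?case using map_Ob map_hom by (auto simp: hom_def)
next
  case (2 X)
  then interpret finite_product_category X by simp
  show ?case
    by (rule finite_product_functor_cong[OF finite_product_functor_id[OF category_axioms]]) auto
next
  case (3 X Y Z Fo Fa Go Ga)
  show ?case
    by (rule finite_product_functor_cong[OF finite_product_functor_comp[OF 3(4,5)]])
      (auto simp: compose_def)
qed

lemma category_fpMlt: "category fpMlt"
  unfolding fpMlt_def
proof (rule structure_category, goal_cases)
  case (1 X Y Fo Fa)
  then interpret cartesian_functor X Y Fo Fa by simp
  show ?case using map_mOb map_mhom by (auto simp: mhom_def)
next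
  case (2 X)
  show ?case
    by (rule cartesian_functor_cong[OF cartesian_functor_id]) (use 2 in auto)
next
  case (3 X Y Z Fo Fa Go Ga)
  show ?case
    by (rule cartesian_functor_cong[OF cartesian_functor_comp[OF 3(4,5)]])
      (auto simp: compose_def)
qed

lemma category_fpRep: "category fpRep"
  unfolding fpRep_def by (rule category.full_subcategory[OF category_fpMlt])

lemma hom_fpCat:
  "F \<in> hom fpCat X Y \<longleftrightarrow>
    finite_product_category X \<and> finite_product_category Y \<and> Src F = X \<and> Trg F = Y \<and>
    finite_product_functor X Y (OMap F) (AMap F) \<and>
    OMap F \<in> extensional (Ob X) \<and> AMap F \<in> extensional (Ar X)"
  by (simp add: fpCat_def hom_structure_category)

lemma Ob_fpCat: "Ob fpCat = {C. finite_product_category C}"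
  by (simp add: fpCat_def)

lemma Ob_fpRep: "Ob fpRep = {M. cartesian_multicategory M \<and> representable M}"
  by (auto simp: fpRep_def fpMlt_def)

lemma hom_fpRep:
  "F \<in> hom fpRep M N \<longleftrightarrow> M \<in> Ob fpRep \<and> N \<in> Ob fpRep \<and> Src F = M \<and> Trg F = N \<and>
    cartesian_functor M N (OMap F) (AMap F) \<and>
    OMap F \<in> extensional (mOb M) \<and> AMap F \<in> extensional (mAr M)"
  by (auto simp: fpRep_def fpMlt_def hom_full_subcategory hom_structure_category)

section \<open>The functor taking unary parts, and its full faithfulness\<close>

definition unary_map ::
    "(('o, 'a) cartesian_multicategory, 'o, 'a) structure_map \<Rightarrow>
     (('o, 'a) category, 'o, 'a) structure_map" where
  "unary_map F = \<lparr>Src = unary_category (Src F), Trg = unary_category (Trg F), OMap = OMap F,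
    AMap = restrict (AMap F) (Ar (unary_category (Src F)))\<rparr>"

lemma unary_functor:
  "cat_functor (fpRep :: (('o, 'a) cartesian_multicategory, _) category) fpCat unary_category unary_map"
proof (intro cat_functor.intro cat_functor_axioms.intro category_fpRep category_fpCat)
  fix M :: "('o, 'a) cartesian_multicategory" assume M: "M \<in> Ob fpRep"
  then show "unary_category M \<in> Ob fpCat"
    by (auto simp: Ob_fpRep Ob_fpCat cartesian_multicategory.finite_product_category_unary_category)
  show "unary_map (Ident fpRep M) = Ident fpCat (unary_category M)"
    by (auto simp: unary_map_def fpRep_def fpMlt_def fpCat_def restrict_def)
next
  fix F :: "(('o, 'a) cartesian_multicategory, 'o, 'a) structure_map" and M N
  assume F: "F \<in> hom fpRep M N"
  then have "finite_product_functor (unary_category M) (unary_category N) (OMap F) (AMap F)"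
    using cartesian_functor.finite_product_functor_unary_category by (auto simp: hom_fpRep Ob_fpRep)
  then have "finite_product_functor (unary_category M) (unary_category N) (OMap F)
      (restrict (AMap F) (Ar (unary_category M)))"
    by (rule finite_product_functor_cong) auto
  then show "unary_map F \<in> hom fpCat (unary_category M) (unary_category N)"
    using F by (auto simp: hom_fpRep Ob_fpRep hom_fpCat unary_map_def
        cartesian_multicategory.finite_product_category_unary_category)
next
  fix F G :: "(('o, 'a) cartesian_multicategory, 'o, 'a) structure_map" and M N K
  assume F: "F \<in> hom fpRep M N" and G: "G \<in> hom fpRep N K"
  then interpret F: cartesian_functor M N "OMap F" "AMap F" by (simp add: hom_fpRep)
  \<comment> \<open>Unary arrows go to unary arrows, so restriction to them commutes with
    composition of maps.\<close>
  have "AMap F f \<in> mAr N \<and> length (mDom N (AMap F f)) = 1"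
    if "f \<in> mAr M" "length (mDom M f) = 1" for f
    using F.map_mhom[of f "mDom M f" "mCod M f"] that by (auto simp: mhom_def)
  then show "unary_map (Comp fpRep G F) = Comp fpCat (unary_map G) (unary_map F)"
    using F G by (auto simp: unary_map_def fpRep_def[symmetric] hom_fpRep fun_eq_iff compose_def)
      (auto simp: fpRep_def fpMlt_def fpCat_def compose_def fun_eq_iff)
qed

lemma unary_map_faithful:
  assumes F: "F \<in> hom fpRep M N" and G: "G \<in> hom fpRep M N" and eq: "unary_map F = unary_map G"
  shows "F = G"
proof -
  have OMap: "OMap F = OMap G"
    and unary: "restrict (AMap F) (Ar (unary_category M)) = restrict (AMap G) (Ar (unary_category M))"
    using eq F G by (simp_all add: unary_map_def hom_fpRep)
  have "AMap F g = AMap G g" if "g \<in> mhom M [A] B" for g A B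
    using fun_cong[OF unary, of g] that by (simp add: mhom_def)
  then have "AMap F f = AMap G f" if "f \<in> mAr M" for f
    using cartesian_functor_eqI[of M N "OMap F" "AMap F" "AMap G"] F G OMap that
    by (simp add: hom_fpRep Ob_fpRep)
  then have "AMap F = AMap G"
    using F G by (auto simp: hom_fpRep intro: extensionalityI)
  then show ?thesis using OMap F G by (simp add: hom_fpRep)
qed

lemma unary_map_full:
  assumes M: "M \<in> Ob fpRep" and N: "N \<in> Ob fpRep"
    and H: "H \<in> hom fpCat (unary_category M) (unary_category N)"
  shows "\<exists>F \<in> hom fpRep M N. unary_map F = H"
proof -
  obtain Fa where Fa: "cartesian_functor M N (OMap H) Fa"
    "\<And>A B f. f \<in> mhom M [A] B \<Longrightarrow> Fa f = AMap H f"
    using finite_product_functor_extension[of M N "OMap H" "AMap H"] M N H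
    by (auto simp: Ob_fpRep hom_fpCat)
  define F where "F = \<lparr>Src = M, Trg = N, OMap = OMap H, AMap = restrict Fa (mAr M)\<rparr>"
  have "cartesian_functor M N (OMap H) (restrict Fa (mAr M))"
    by (rule cartesian_functor_cong[OF Fa(1)]) auto
  then have "F \<in> hom fpRep M N"
    using M N H by (auto simp: F_def hom_fpRep hom_fpCat)
  \<comment> \<open>The unary restriction of the extension is \<open>AMap H\<close> itself, which is
    extensional on the unary arrows.\<close>
  moreover have "restrict (restrict Fa (mAr M)) (Ar (unary_category M)) = AMap H"
  proof (rule extensionalityI[where A = "Ar (unary_category M)"])
    fix f assume "f \<in> Ar (unary_category M)"
    then show "restrict (restrict Fa (mAr M)) (Ar (unary_category M)) f = AMap H f"
      using Fa(2)[of f] by (auto simp: mhom_def length_Suc_conv)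
  qed (use H in \<open>simp_all only: restrict_extensional hom_fpCat\<close>)
  then have "unary_map F = H"
    using H by (simp add: unary_map_def F_def hom_fpCat)
  ultimately show ?thesis by blast
qed

section \<open>The cartesian multicategory of a finite product category\<close>

text \<open>A composite multiarrow receives one flat list of arguments and has to share it out among
  its inner arrows, according to their arities.\<close>

fun blocks :: "nat list \<Rightarrow> 'b list \<Rightarrow> 'b list list" where
  "blocks [] xs = []"
| "blocks (n # ns) xs = take n xs # blocks ns (drop n xs)"

lemma blocks_concat: "blocks (map length xss) (concat xss) = xss"
  by (induction xss) auto

lemma concat_map_concat: "concat (map concat xsss) = concat (concat xsss)"
  by (induction xsss) auto

abbreviation homs :: "('o, 'a) category \<Rightarrow> 'o \<Rightarrow> 'o list \<Rightarrow> 'a list \<Rightarrow> bool" where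
  "homs C X As fs \<equiv> list_all2 (\<lambda>f A. f \<in> hom C X A) fs As"

lemma homs_concatE:
  assumes "homs C X (concat Ass) xs"
  obtains xss where "xs = concat xss" "list_all2 (\<lambda>xs As. homs C X As xs) xss Ass"
  using assms
proof (induction Ass arbitrary: xs thesis)
  case (Cons As Ass)
  obtain ys zs where "xs = ys @ zs" "homs C X As ys" "homs C X (concat Ass) zs"
    using Cons.prems(2) by (auto simp: list_all2_append2)
  moreover from this obtain zss where "zs = concat zss" "list_all2 (\<lambda>xs As. homs C X As xs) zss Ass"
    using Cons.IH by blast
  ultimately show ?case using Cons.prems(1)[of "ys # zss"] by simp
qed simp

lemma homs_concat:
  "list_all2 (\<lambda>xs As. homs C X As xs) xss Ass \<Longrightarrow> homs C X (concat Ass) (concat xss)"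
  by (induction rule: list_all2_induct) (auto intro: list_all2_appendI)

lemma homs_reindex:
  assumes "homs C X Bs xs" "reindexing \<sigma> As Bs"
  shows "homs C X As (map ((!) xs) \<sigma>)"
  using assms by (auto simp: reindexing_def list_all2_conv_all_nth subset_iff)

text \<open>
  A multiarrow from \<open>As\<close> to \<open>B\<close> amounts to a natural transformation from the product of the
  presheaves represented by \<open>As\<close> to the one represented by \<open>B\<close>, which makes the axioms
  independent of the coherence of the chosen products. By the Yoneda lemma it is determined
  by its value at the projections, so that it can be stored as an arrow from the product \<open>Prod As\<close>
  together with \<open>As\<close>; \<open>enc\<close> codes such pairs as elements of the type of arrows.
\<close>

locale encoded_products = finite_product_category C for C :: "('o, 'a) category" +
  fixes Prod :: "'o list \<Rightarrow> 'o" and Proj :: "'o list \<Rightarrow> 'a list"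
    and enc :: "'o list \<times> 'a \<Rightarrow> 'a" and dec :: "'a \<Rightarrow> 'o list \<times> 'a"
  assumes product: "set As \<subseteq> Ob C \<Longrightarrow> is_product C As (Prod As) (Proj As)"
    and dec_enc: "\<lbrakk>set As \<subseteq> Ob C; f \<in> Ar C\<rbrakk> \<Longrightarrow> dec (enc (As, f)) = (As, f)"
begin

section \<open>Mediating arrows into the chosen products\<close>

lemma comp_homs: "\<lbrakk>homs C X As xs; k \<in> hom C Y X\<rbrakk> \<Longrightarrow> homs C Y As (map (\<lambda>x. Comp C x k) xs)"
  by (auto simp: list_all2_conv_all_nth intro: comp_in_hom)

lemma homs_elem: "\<lbrakk>homs C X As xs; x \<in> set xs\<rbrakk> \<Longrightarrow> \<exists>A. x \<in> hom C X A"
  by (auto simp: list_all2_conv_all_nth in_set_conv_nth)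

definition pair :: "'o list \<Rightarrow> 'o \<Rightarrow> 'a list \<Rightarrow> 'a" where
  "pair As X fs = (THE h. h \<in> hom C X (Prod As) \<and> map (\<lambda>p. Comp C p h) (Proj As) = fs)"

lemma Prod_Ob: "set As \<subseteq> Ob C \<Longrightarrow> Prod As \<in> Ob C"
  and Proj_homs: "set As \<subseteq> Ob C \<Longrightarrow> homs C (Prod As) As (Proj As)"
  using product by (auto simp: is_product_def)

lemma pair:
  assumes "set As \<subseteq> Ob C" "X \<in> Ob C" "homs C X As fs"
  shows "pair As X fs \<in> hom C X (Prod As)" "map (\<lambda>p. Comp C p (pair As X fs)) (Proj As) = fs"
proof -
  have "\<exists>!h. h \<in> hom C X (Prod As) \<and> map (\<lambda>p. Comp C p h) (Proj As) = fs"
    using product assms by (auto simp: is_product_def)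
  from theI'[OF this] show "pair As X fs \<in> hom C X (Prod As)"
    "map (\<lambda>p. Comp C p (pair As X fs)) (Proj As) = fs"
    by (simp_all add: pair_def)
qed

lemma pair_Proj_comp:
  assumes As: "set As \<subseteq> Ob C" and h: "h \<in> hom C X (Prod As)"
  shows "pair As X (map (\<lambda>p. Comp C p h) (Proj As)) = h"
proof -
  have "homs C X As (map (\<lambda>p. Comp C p h) (Proj As))" using comp_homs[OF Proj_homs[OF As] h] .
  then have "\<exists>!k. k \<in> hom C X (Prod As) \<and>
      map (\<lambda>p. Comp C p k) (Proj As) = map (\<lambda>p. Comp C p h) (Proj As)"
    using product[OF As] hom_Ob(1)[OF h] unfolding is_product_def by blast
  then show ?thesis using h unfolding pair_def by (intro the1_equality) auto
qed

lemma map_comp_comp: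
  assumes "homs C X As xs" "h \<in> hom C Y X" "k \<in> hom C Z Y"
  shows "map (\<lambda>x. Comp C x (Comp C h k)) xs = map (\<lambda>x. Comp C x k) (map (\<lambda>x. Comp C x h) xs)"
  using homs_elem[OF assms(1)] comp_assoc[OF assms(3,2)] by auto

lemma map_comp_ident: "homs C X As xs \<Longrightarrow> map (\<lambda>x. Comp C x (Ident C X)) xs = xs"
  using homs_elem ident_right by (metis map_idI)

lemma pair_comp:
  assumes As: "set As \<subseteq> Ob C" and fs: "homs C X As fs" and k: "k \<in> hom C Y X"
  shows "Comp C (pair As X fs) k = pair As Y (map (\<lambda>f. Comp C f k) fs)"
proof -
  note p = pair[OF As hom_Ob(2)[OF k] fs]
  show ?thesis
    using pair_Proj_comp[OF As comp_in_hom[OF k p(1)]] map_comp_comp[OF Proj_homs[OF As] p(1) k]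
      p(2)
    by simp
qed

text \<open>The transformation coded by \<open>a\<close>: the stored arrow, applied after the
  mediating arrow of the tuple \<open>xs\<close>.\<close>

definition interp :: "'a \<Rightarrow> 'o \<Rightarrow> 'a list \<Rightarrow> 'a" where
  "interp a X xs = Comp C (snd (dec a)) (pair (fst (dec a)) X xs)"

text \<open>The Yoneda lemma in the other direction: only the value at the universal tuple
  \<open>Proj As\<close> is stored.\<close>

definition code :: "'o list \<Rightarrow> ('o \<Rightarrow> 'a list \<Rightarrow> 'a) \<Rightarrow> 'a" where
  "code As \<phi> = enc (As, \<phi> (Prod As) (Proj As))"

definition natural :: "'o list \<Rightarrow> 'o \<Rightarrow> ('o \<Rightarrow> 'a list \<Rightarrow> 'a) \<Rightarrow> bool" where
  "natural As B \<phi> \<longleftrightarrow> set As \<subseteq> Ob C \<and> (\<forall>X \<in> Ob C. \<forall>xs. homs C X As xs \<longrightarrow> \<phi> X xs \<in> hom C X B \<and>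
    (\<forall>Y. \<forall>k \<in> hom C Y X. \<phi> Y (map (\<lambda>x. Comp C x k) xs) = Comp C (\<phi> X xs) k))"

text \<open>The operations are specified on transformations and then coded. There, composition is
  application to shared-out arguments and the action is reindexing of arguments, so the axioms turn
  into identities between lists.\<close>

definition multi :: "('o, 'a) cartesian_multicategory" where
  "multi = \<lparr>mOb = Ob C,
    mAr = {enc (As, f) | As f. set As \<subseteq> Ob C \<and> f \<in> Ar C \<and> Dom C f = Prod As},
    mDom = (\<lambda>a. fst (dec a)), mCod = (\<lambda>a. Cod C (snd (dec a))),
    mIdent = (\<lambda>A. code [A] (\<lambda>X xs. hd xs)),
    mComp = (\<lambda>f gs. code (concat (map (\<lambda>g. fst (dec g)) gs)) (\<lambda>X xs. interp f X
      (map2 (\<lambda>g ys. interp g X ys) gs (blocks (map (\<lambda>g. length (fst (dec g))) gs) xs)))),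
    mAct = (\<lambda>Bs \<sigma> f. code Bs (\<lambda>X xs. interp f X (map ((!) xs) \<sigma>)))\<rparr>"

lemma mOb_multi [simp]: "mOb multi = Ob C"
  by (simp add: multi_def)

lemma mhom_multi:
  "a \<in> mhom multi As B \<longleftrightarrow> (\<exists>f. a = enc (As, f) \<and> set As \<subseteq> Ob C \<and> f \<in> hom C (Prod As) B)"
proof
  assume "a \<in> mhom multi As B"
  then obtain Bs f where a: "a = enc (Bs, f)" and Bs: "set Bs \<subseteq> Ob C" "f \<in> Ar C" "Dom C f = Prod Bs"
    and dom: "fst (dec a) = As" "Cod C (snd (dec a)) = B"
    by (auto simp: multi_def mhom_def)
  have "dec a = (Bs, f)" using dec_enc[OF Bs(1,2)] a by simp
  then show "\<exists>f. a = enc (As, f) \<and> set As \<subseteq> Ob C \<and> f \<in> hom C (Prod As) B"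
    using a Bs dom by (auto simp: hom_def)
next
  assume "\<exists>f. a = enc (As, f) \<and> set As \<subseteq> Ob C \<and> f \<in> hom C (Prod As) B"
  then show "a \<in> mhom multi As B"
    using dec_enc by (auto simp: multi_def mhom_def hom_def)
qed

lemma naturalD:
  assumes "natural As B \<phi>" "homs C X As xs" "X \<in> Ob C"
  shows "\<phi> X xs \<in> hom C X B" "k \<in> hom C Y X \<Longrightarrow> \<phi> Y (map (\<lambda>x. Comp C x k) xs) = Comp C (\<phi> X xs) k"
  using assms by (auto simp: natural_def)

lemma code_in_hom:
  assumes "natural As B \<phi>"
  shows "code As \<phi> \<in> mhom multi As B"
proof -
  have As: "set As \<subseteq> Ob C" using assms by (simp add: natural_def)
  show ?thesis
    using naturalD(1)[OF assms Proj_homs[OF As] Prod_Ob[OF As]] As by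
      (auto simp: mhom_multi code_def)
qed

text \<open>Every tuple \<open>xs\<close> is \<open>Proj As\<close> composed with its mediating
  arrow, so naturality along that arrow determines \<open>\<phi>\<close> from its value at
  \<open>Proj As\<close>.\<close>

lemma interp_code:
  assumes nat: "natural As B \<phi>" and X: "X \<in> Ob C" and xs: "homs C X As xs"
  shows "interp (code As \<phi>) X xs = \<phi> X xs"
proof -
  have As: "set As \<subseteq> Ob C" using nat by (simp add: natural_def)
  note n = naturalD[OF nat Proj_homs[OF As] Prod_Ob[OF As]] and p = pair[OF As X xs]
  show ?thesis
    using n(2)[OF p(1)] p(2) dec_enc[OF As homD(1)[OF n(1)]] by (simp add: interp_def code_def)
qed

lemma interp_natural:
  assumes "a \<in> mhom multi As B"
  shows "natural As B (interp a)"
proof -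
  obtain f where a: "a = enc (As, f)" and As: "set As \<subseteq> Ob C" and f: "f \<in> hom C (Prod As) B"
    using assms by (auto simp: mhom_multi)
  have dec: "dec a = (As, f)" using dec_enc[OF As homD(1)[OF f]] a by simp
  have "Comp C f (pair As Y (map (\<lambda>x. Comp C x k) xs)) = Comp C (Comp C f (pair As X xs)) k"
    if "X \<in> Ob C" "homs C X As xs" "k \<in> hom C Y X" for X xs k Y
    using pair_comp[OF As that(2,3)] comp_assoc[OF that(3) pair(1)[OF As that(1,2)] f] by simp
  then show ?thesis
    using comp_in_hom[OF pair(1)[OF As] f] As by (simp add: natural_def interp_def dec)
qed

lemma interp_in_hom:
  "\<lbrakk>a \<in> mhom multi As B; X \<in> Ob C; homs C X As xs\<rbrakk> \<Longrightarrow> interp a X xs \<in> hom C X B"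
  using naturalD(1)[OF interp_natural] by blast

lemma interp_comp:
  "\<lbrakk>a \<in> mhom multi As B; X \<in> Ob C; homs C X As xs; k \<in> hom C Y X\<rbrakk>
    \<Longrightarrow> interp a Y (map (\<lambda>x. Comp C x k) xs) = Comp C (interp a X xs) k"
  using naturalD(2)[OF interp_natural] by blast

text \<open>The mediating arrow of \<open>Proj As\<close> is the identity, so coding
  \<open>interp a\<close> returns \<open>a\<close>. The equations among the axioms for
  \<open>multi\<close> are all checked on interpretations by this lemma.\<close>

lemma multi_eqI:
  assumes "a \<in> mhom multi As B" "b \<in> mhom multi As B'"
    and eq: "\<And>X xs. \<lbrakk>X \<in> Ob C; homs C X As xs\<rbrakk> \<Longrightarrow> interp a X xs = interp b X xs"
  shows "a = b"
proof -
  have "code As (interp c) = c" if c: "c \<in> mhom multi As D" for c D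
  proof -
    obtain f where f': "c = enc (As, f)" and As: "set As \<subseteq> Ob C" and f: "f \<in> hom C (Prod As) D"
      using c by (auto simp: mhom_multi)
    have "pair As (Prod As) (Proj As) = Ident C (Prod As)"
      using pair_Proj_comp[OF As ident_in_hom[OF Prod_Ob[OF As]]]
        map_comp_ident[OF Proj_homs[OF As]]
      by simp
    then show ?thesis
      using dec_enc[OF As homD(1)[OF f]] f' ident_right[OF f] by (simp add: code_def interp_def)
  qed
  moreover have "set As \<subseteq> Ob C" using assms(1) by (auto simp: mhom_multi)
  then have "code As (interp a) = code As (interp b)"
    using eq[OF Prod_Ob Proj_homs] by (simp add: code_def)
  ultimately show ?thesis using assms(1,2) by metis
qed

lemma natural_hd: "A \<in> Ob C \<Longrightarrow> natural [A] A (\<lambda>X xs. hd xs)"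
  by (auto simp: natural_def list_all2_Cons2)

lemma mIdent_in_hom: "A \<in> Ob C \<Longrightarrow> mIdent multi A \<in> mhom multi [A] A"
  using code_in_hom[OF natural_hd] by (simp add: multi_def)

lemma interp_mIdent: "\<lbrakk>A \<in> Ob C; x \<in> hom C X A\<rbrakk> \<Longrightarrow> interp (mIdent multi A) X [x] = x"
  using interp_code[OF natural_hd, of A X "[x]"] hom_Ob[of x X A] by (simp add: multi_def)

lemma natural_act:
  assumes f: "f \<in> mhom multi As B" and Bs: "set Bs \<subseteq> Ob C" and \<sigma>: "reindexing \<sigma> As Bs"
  shows "natural Bs B (\<lambda>X xs. interp f X (map ((!) xs) \<sigma>))"
proof -
  have "interp f Y (map ((!) (map (\<lambda>x. Comp C x k) xs)) \<sigma>) = Comp C (interp f X (map ((!) xs) \<sigma>)) k"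
    if X: "X \<in> Ob C" and xs: "homs C X Bs xs" and k: "k \<in> hom C Y X" for X xs k Y
  proof -
    have "map ((!) (map (\<lambda>x. Comp C x k) xs)) \<sigma> = map (\<lambda>x. Comp C x k) (map ((!) xs) \<sigma>)"
      using \<sigma> xs by (auto simp: reindexing_def subset_iff list_all2_lengthD)
    then show ?thesis using interp_comp[OF f X homs_reindex[OF xs \<sigma>] k] by metis
  qed
  then show ?thesis
    using interp_in_hom[OF f _ homs_reindex[OF _ \<sigma>]] Bs by (auto simp: natural_def)
qed

lemma mAct_in_hom:
  "\<lbrakk>f \<in> mhom multi As B; set Bs \<subseteq> Ob C; reindexing \<sigma> As Bs\<rbrakk> \<Longrightarrow> mAct multi Bs \<sigma> f \<in> mhom multi Bs B"
  using code_in_hom[OF natural_act] by (simp add: multi_def)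

lemma interp_mAct:
  "\<lbrakk>f \<in> mhom multi As B; reindexing \<sigma> As Bs; set Bs \<subseteq> Ob C; X \<in> Ob C; homs C X Bs xs\<rbrakk>
    \<Longrightarrow> interp (mAct multi Bs \<sigma> f) X xs = interp f X (map ((!) xs) \<sigma>)"
  using interp_code[OF natural_act] by (simp add: multi_def)

abbreviation homss :: "'o \<Rightarrow> 'a list \<Rightarrow> 'a list list \<Rightarrow> bool" where
  "homss X gs xss \<equiv> list_all2 (\<lambda>xs g. homs C X (mDom multi g) xs) xss gs"

abbreviation interps :: "'o \<Rightarrow> 'a list \<Rightarrow> 'a list list \<Rightarrow> 'a list" where
  "interps X gs xss \<equiv> map2 (\<lambda>g xs. interp g X xs) gs xss"

lemma mAr_multi_mhom: "g \<in> mAr multi \<Longrightarrow> g \<in> mhom multi (mDom multi g) (mCod multi g)"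
  by (simp add: mhom_def)

lemma mDom_Ob: "g \<in> mAr multi \<Longrightarrow> set (mDom multi g) \<subseteq> Ob C"
  using mAr_multi_mhom[of g] by (auto simp: mhom_multi)

lemma interps_homs:
  assumes "set gs \<subseteq> mAr multi" "homss X gs xss" "X \<in> Ob C"
  shows "homs C X (map (mCod multi) gs) (interps X gs xss)"
proof -
  have "interp (gs ! i) X (xss ! i) \<in> hom C X (mCod multi (gs ! i))" if "i < length gs" for i
    using assms that interp_in_hom[OF mAr_multi_mhom] by
      (auto simp: list_all2_conv_all_nth subset_iff)
  then show ?thesis using assms(2) by (simp add: list_all2_conv_all_nth)
qed

lemma blocks_homss:
  assumes "homss X gs xss"
  shows "blocks (map (\<lambda>g. length (fst (dec g))) gs) (concat xss) = xss"
proof -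
  have "map (\<lambda>g. length (fst (dec g))) gs = map length xss"
    using assms by (auto simp: list_all2_conv_all_nth multi_def intro!: nth_equalityI)
  then show ?thesis using blocks_concat[of xss] by simp
qed

lemma homs_concat_mDomE:
  assumes "homs C X (concat (map (mDom multi) gs)) xs"
  obtains xss where "xs = concat xss" "homss X gs xss"
  using homs_concatE[OF assms] by (auto simp: list_all2_map2)

lemma homss_concat: "homss X gs xss \<Longrightarrow> homs C X (concat (map (mDom multi) gs)) (concat xss)"
  by (rule homs_concat) (simp add: list_all2_map2)

text \<open>Precomposition with \<open>k\<close> acts entry by entry and so commutes with cutting a
  list into blocks; naturality reduces to that of \<open>f\<close> and of each arrow of
  \<open>gs\<close>.\<close>

lemma natural_comp:
  assumes f: "composable multi f gs"
  shows "natural (concat (map (mDom multi) gs)) (mCod multi f) (\<lambda>X xs. interp f X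
    (interps X gs (blocks (map (\<lambda>g. length (fst (dec g))) gs) xs)))"
proof -
  have f': "f \<in> mhom multi (map (mCod multi) gs) (mCod multi f)" and gs: "set gs \<subseteq> mAr multi"
    using f by (auto simp: composable_def mhom_def)
  have "set (concat (map (mDom multi) gs)) \<subseteq> Ob C" using gs mDom_Ob by fastforce
  moreover have "interp f X (interps X gs xss) \<in> hom C X (mCod multi f)"
    if "X \<in> Ob C" "homss X gs xss" for X xss
    using interp_in_hom[OF f' that(1) interps_homs[OF gs that(2,1)]] .
  moreover have "interp f Y (interps Y gs (blocks (map (\<lambda>g. length (fst (dec g))) gs)
      (map (\<lambda>x. Comp C x k) (concat xss)))) = Comp C (interp f X (interps X gs xss)) k"
    if X: "X \<in> Ob C" and xss: "homss X gs xss" and k: "k \<in> hom C Y X" for X xss k Y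
  proof -
    define yss where "yss = map (map (\<lambda>x. Comp C x k)) xss"
    have yss: "homss Y gs yss"
      using xss comp_homs[OF _ k] by (simp add: yss_def list_all2_conv_all_nth)
    have "interps Y gs yss = map (\<lambda>x. Comp C x k) (interps X gs xss)"
    proof (rule nth_equalityI)
      fix i assume "i < length (interps Y gs yss)"
      then have i: "i < length gs" "i < length xss" by (simp_all add: yss_def)
      have "homs C X (mDom multi (gs ! i)) (xss ! i)"
        using xss i by (simp add: list_all2_conv_all_nth)
      moreover have "gs ! i \<in> mAr multi" using gs i by auto
      ultimately show "interps Y gs yss ! i = map (\<lambda>x. Comp C x k) (interps X gs xss) ! i"
        using interp_comp[OF mAr_multi_mhom X _ k] i by (simp add: yss_def)
    qed (simp add: yss_def)
    moreover have "map (\<lambda>x. Comp C x k) (concat xss) = concat yss"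
      by (simp add: yss_def map_concat)
    ultimately show ?thesis
      using interp_comp[OF f' X interps_homs[OF gs xss X] k] blocks_homss[OF yss] by simp
  qed
  ultimately show ?thesis
    unfolding natural_def by (metis homs_concat_mDomE blocks_homss)
qed

lemma mComp_in_hom:
  "composable multi f gs \<Longrightarrow> mComp multi f gs \<in> mhom multi (concat (map (mDom multi) gs)) (mCod multi f)"
  using code_in_hom[OF natural_comp] by (simp add: multi_def)

lemma interp_mComp:
  assumes "composable multi f gs" "X \<in> Ob C" "homss X gs xss"
  shows "interp (mComp multi f gs) X (concat xss) = interp f X (interps X gs xss)"
  using interp_code[OF natural_comp[OF assms(1)] assms(2) homss_concat[OF assms(3)]]
    blocks_homss[OF assms(3)] by (simp add: multi_def)

section \<open>The axioms of a cartesian multicategory for \<open>multi\<close>\<close>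

lemma mComp_ident_left:
  assumes "f \<in> mAr multi"
  shows "mComp multi (mIdent multi (mCod multi f)) [f] = f"
proof -
  note f = mAr_multi_mhom[OF assms]
  have B: "mCod multi f \<in> Ob C" using f hom_Ob by (auto simp: mhom_multi)
  have c: "composable multi (mIdent multi (mCod multi f)) [f]"
    using mIdent_in_hom[OF B] assms by (simp add: composable_def mhom_def)
  show ?thesis
  proof (rule multi_eqI[OF _ f])
    show "mComp multi (mIdent multi (mCod multi f)) [f] \<in> mhom multi (mDom multi f) (mCod multi f)"
      using mComp_in_hom[OF c] mIdent_in_hom[OF B] by (simp add: mhom_def)
    fix X xs assume "X \<in> Ob C" "homs C X (mDom multi f) xs"
    then show "interp (mComp multi (mIdent multi (mCod multi f)) [f]) X xs = interp f X xs"
      using interp_mComp[OF c, of X "[xs]"] interp_mIdent[OF B] interp_in_hom[OF f] by simp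
  qed
qed

lemma mComp_ident_right:
  assumes "f \<in> mAr multi"
  shows "mComp multi f (map (mIdent multi) (mDom multi f)) = f"
proof -
  note f = mAr_multi_mhom[OF assms]
  define As gs where "As = mDom multi f" and "gs = map (mIdent multi) As"
  have As: "set As \<subseteq> Ob C" using mDom_Ob[OF assms] by (simp add: As_def)
  have gs: "mDom multi (mIdent multi A) = [A]" "mCod multi (mIdent multi A) = A" "mIdent multi A \<in> mAr multi"
    if "A \<in> set As" for A
    using mIdent_in_hom that As by (auto simp: mhom_def subset_iff)
  then have c: "composable multi f gs"
    using assms by (auto simp: composable_def As_def gs_def intro!: map_idI)
  have dom: "concat (map (mDom multi) gs) = As"
  proof -
    have "map (mDom multi) gs = map (\<lambda>A. [A]) As" using gs(1) by (simp add: gs_def)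
    then show ?thesis by simp
  qed
  show ?thesis
    unfolding As_def[symmetric] gs_def[symmetric]
  proof (rule multi_eqI)
    show "mComp multi f gs \<in> mhom multi As (mCod multi f)" using mComp_in_hom[OF c] dom by simp
    show "f \<in> mhom multi As (mCod multi f)" using f by (simp add: As_def)
    fix X xs assume X: "X \<in> Ob C" and xs: "homs C X As xs"
    have len: "length gs = length xs" using list_all2_lengthD[OF xs] by (simp add: gs_def)
    have "homss X gs (map (\<lambda>x. [x]) xs)"
      using xs gs(1) by (simp add: gs_def list_all2_conv_all_nth)
    moreover have "interps X gs (map (\<lambda>x. [x]) xs) = xs"
      using xs As len interp_mIdent by
        (auto simp: gs_def list_all2_conv_all_nth subset_iff intro!: nth_equalityI)
    ultimately show "interp (mComp multi f gs) X xs = interp f X xs"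
      using interp_mComp[OF c X, of "map (\<lambda>x. [x]) xs"] by simp
  qed
qed

text \<open>On a tuple, both sides apply \<open>f\<close> to values of \<open>gs\<close> at values
  of the arrows in \<open>hss\<close>. The work lies in cutting the flat tuple consistently at two
  levels.\<close>

lemma mComp_assoc:
  assumes c: "composable multi f gs" and d: "list_all2 (composable multi) gs hss"
  shows "mComp multi (mComp multi f gs) (concat hss) = mComp multi f (map2 (mComp multi) gs hss)"
proof -
  define ks where "ks = map2 (mComp multi) gs hss"
  have len: "length hss = length gs" using d by (simp add: list_all2_lengthD)
  have ci: "composable multi (gs ! i) (hss ! i)" if "i < length gs" for i
    using d that by (simp add: list_all2_conv_all_nth)
  have k: "ks ! i \<in> mhom multi (concat (map (mDom multi) (hss ! i))) (mCod multi (gs ! i))"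
    if "i < length gs" for i
    using mComp_in_hom[OF ci[OF that]] that len by (simp add: ks_def)
  have "map (mCod multi) ks = map (mCod multi) gs"
    using k len by (auto simp: ks_def mhom_def intro!: nth_equalityI)
  moreover have "set ks \<subseteq> mAr multi"
    using k len by (auto simp: ks_def mhom_def in_set_conv_nth)
  ultimately have e: "composable multi f ks"
    using c by (simp add: composable_def)
  note fg = mComp_in_hom[OF c]
  have dom: "map (mDom multi) gs = map (map (mCod multi)) hss"
    using ci len by (auto simp: composable_def intro!: nth_equalityI)
  have hs: "set (concat hss) \<subseteq> mAr multi"
    using ci len by (fastforce simp: composable_def in_set_conv_nth)
  have c': "composable multi (mComp multi f gs) (concat hss)"
    using fg hs dom by (simp add: composable_def mhom_def map_concat)
  have dom': "concat (map (mDom multi) ks) = concat (map (mDom multi) (concat hss))"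
  proof -
    have "map (mDom multi) ks = map (\<lambda>hs. concat (map (mDom multi) hs)) hss"
      using k len by (auto simp: ks_def mhom_def intro!: nth_equalityI)
    then show ?thesis by (simp add: map_concat comp_def flip: concat_map_concat)
  qed
  show ?thesis
    unfolding ks_def[symmetric]
  proof (rule multi_eqI[OF mComp_in_hom[OF c']])
    show "mComp multi f ks \<in> mhom multi (concat (map (mDom multi) (concat hss))) (mCod multi f)"
      using mComp_in_hom[OF e] dom' by simp
    fix X xs assume X: "X \<in> Ob C" and "homs C X (concat (map (mDom multi) (concat hss))) xs"
    then have "homs C X (concat (map (mDom multi) ks)) xs" using dom' by simp
    \<comment> \<open>The first cut has one block for each arrow of \<open>gs\<close>; each block is
      then cut again, with one piece for each arrow in the corresponding list of
      \<open>hss\<close>.\<close>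
    then obtain xss where xs: "xs = concat xss" and xss: "homss X ks xss"
      by (rule homs_concat_mDomE)
    have lenx: "length xss = length gs" using list_all2_lengthD[OF xss] len by (simp add: ks_def)
    have "\<exists>yss. xss ! i = concat yss \<and> homss X (hss ! i) yss" if "i < length gs" for i
    proof -
      have "homs C X (concat (map (mDom multi) (hss ! i))) (xss ! i)"
        using list_all2_nthD[OF xss, of i] mhomD(2)[OF k[OF that]] that lenx by simp
      then show ?thesis by (rule homs_concat_mDomE) blast
    qed
    then obtain ys where ys: "\<And>i. i < length gs \<Longrightarrow> xss ! i = concat (ys i)"
      "\<And>i. i < length gs \<Longrightarrow> homss X (hss ! i) (ys i)"
      by metis
    define ysss where "ysss = map ys [0..<length gs]"
    define zss where "zss = map2 (interps X) hss ysss"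
    have leny: "length ysss = length gs" by (simp add: ysss_def)
    have ysi: "ysss ! i = ys i" if "i < length gs" for i using that by (simp add: ysss_def)
    have xss': "xss = map concat ysss"
      using ys(1) lenx leny by (auto simp: ysi intro!: nth_equalityI)
    have zsi: "zss ! i = interps X (hss ! i) (ys i)" if "i < length gs" for i
      using that len leny ysi by (simp add: zss_def)
    have zss: "homss X gs zss"
    proof -
      have "homs C X (mDom multi (gs ! i)) (zss ! i)" if "i < length gs" for i
        using interps_homs[OF _ ys(2)[OF that] X] ci[OF that] zsi[OF that] by
          (simp add: composable_def)
      moreover have "length zss = length gs" using len leny by (simp add: zss_def)
      ultimately show ?thesis using list_all2_all_nthI[of zss gs "\<lambda>xs g. homs C X (mDom multi g) xs"] by simp
    qed
    \<comment> \<open>Interpreting the flattened list of inner arrows gives the flattened list of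
      their values, by induction on the outer list.\<close>
    have "homss X (concat hss) (concat ysss) \<and> interps X (concat hss) (concat ysss) = concat zss"
    proof -
      have "list_all2 (\<lambda>yss hs. homss X hs yss) ysss hss"
        using ys(2) len leny ysi by (simp add: list_all2_conv_all_nth)
      then show ?thesis
        unfolding zss_def
        by (induction rule: list_all2_induct)
          (auto intro: list_all2_appendI simp: zip_append list_all2_lengthD)
    qed
    then have "interp (mComp multi (mComp multi f gs) (concat hss)) X (concat (concat ysss)) =
        interp f X (interps X gs zss)"
      using interp_mComp[OF c' X] interp_mComp[OF c X zss] by simp
    also have "interps X gs zss = interps X ks xss"
    proof (rule nth_equalityI)
      fix i assume "i < length (interps X gs zss)"
      then have i: "i < length gs" by simp
      have "interp (ks ! i) X (xss ! i) = interp (gs ! i) X (zss ! i)"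
        using interp_mComp[OF ci[OF i] X ys(2)[OF i]] ys(1)[OF i] zsi[OF i] i len by
          (simp add: ks_def)
      then show "interps X gs zss ! i = interps X ks xss ! i"
        using i len leny lenx by (simp add: ks_def zss_def)
    qed (use len leny lenx in \<open>simp add: ks_def zss_def\<close>)
    also have "interp f X (interps X ks xss) = interp (mComp multi f ks) X xs"
      using interp_mComp[OF e X xss] xs by simp
    finally show "interp (mComp multi (mComp multi f gs) (concat hss)) X xs = interp (mComp multi f ks) X xs"
      by (simp add: xs xss' concat_map_concat)
  qed
qed

text \<open>On a tuple, the left side reindexes each block of arguments by its own mapping and the
  right side reindexes the whole tuple by the juxtaposition; \<open>map_juxtaposition\<close> makes
  the two agree.\<close>

lemma mComp_mAct:
  assumes c: "composable multi f gs" and lenB: "length Bss = length gs" and lens: "length \<sigma>s = length gs"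
    and re: "\<And>i. i < length gs \<Longrightarrow> set (Bss ! i) \<subseteq> Ob C \<and> reindexing (\<sigma>s ! i) (mDom multi (gs ! i)) (Bss ! i)"
  shows "mComp multi f (map (\<lambda>i. mAct multi (Bss ! i) (\<sigma>s ! i) (gs ! i)) [0..<length gs]) =
    mAct multi (concat Bss) (juxtaposition (map length Bss) \<sigma>s) (mComp multi f gs)"
proof -
  let ?\<tau> = "juxtaposition (map length Bss) \<sigma>s"
  define ks where "ks = map (\<lambda>i. mAct multi (Bss ! i) (\<sigma>s ! i) (gs ! i)) [0..<length gs]"
  have g: "gs ! i \<in> mhom multi (mDom multi (gs ! i)) (mCod multi (gs ! i))" if "i < length gs" for i
    using c that by (auto simp: composable_def mhom_def)
  have k: "ks ! i \<in> mhom multi (Bss ! i) (mCod multi (gs ! i))" if "i < length gs" for i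
    using mAct_in_hom[OF g[OF that]] re[OF that] that by (simp add: ks_def)
  have lenk: "length ks = length gs" by (simp add: ks_def)
  have "map (mCod multi) ks = map (mCod multi) gs" "map (mDom multi) ks = Bss"
    using k lenk lenB by (auto simp: mhom_def intro!: nth_equalityI)
  moreover have "set ks \<subseteq> mAr multi"
    using k lenk by (auto simp: mhom_def in_set_conv_nth)
  ultimately have d: "composable multi f ks" and dom: "map (mDom multi) ks = Bss"
    using c by (simp_all add: composable_def)
  have Bs: "set (concat Bss) \<subseteq> Ob C"
    using re lenB by (fastforce simp: in_set_conv_nth)
  have ran: "set (\<sigma>s ! i) \<subseteq> {..<length (Bss ! i)}" if "i < length gs" for i
    using re[OF that] by (simp add: reindexing_def)
  have "map (\<lambda>i. map ((!) (Bss ! i)) (\<sigma>s ! i)) [0..<length Bss] = map (mDom multi) gs"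
    using re lenB by (auto simp: reindexing_def intro!: nth_equalityI)
  then have \<tau>: "reindexing ?\<tau> (concat (map (mDom multi) gs)) (concat Bss)"
    using map_juxtaposition[of \<sigma>s Bss] ran lenB lens by (simp add: reindexing_def)
  note fg = mComp_in_hom[OF c]
  show ?thesis
    unfolding ks_def[symmetric]
  proof (rule multi_eqI)
    show "mComp multi f ks \<in> mhom multi (concat Bss) (mCod multi f)"
      using mComp_in_hom[OF d] dom by simp
    show "mAct multi (concat Bss) ?\<tau> (mComp multi f gs) \<in> mhom multi (concat Bss) (mCod multi f)"
      using mAct_in_hom[OF fg Bs \<tau>] .
    fix X xs assume X: "X \<in> Ob C" and xs: "homs C X (concat Bss) xs"
    have "homs C X (concat (map (mDom multi) ks)) xs" using xs dom by simp
    then obtain xss where xs': "xs = concat xss" and xss: "homss X ks xss"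
      by (rule homs_concat_mDomE)
    have xss': "list_all2 (\<lambda>xs As. homs C X As xs) xss Bss"
      using xss by (simp add: dom[symmetric] list_all2_map2)
    define yss where "yss = map (\<lambda>i. map ((!) (xss ! i)) (\<sigma>s ! i)) [0..<length xss]"
    have lenx: "length xss = length gs" using list_all2_lengthD[OF xss] lenk by simp
    have xi: "homs C X (Bss ! i) (xss ! i)" if "i < length gs" for i
      using xss' that lenx by (simp add: list_all2_conv_all_nth)
    have lenxi: "map length Bss = map length xss"
      using lenx lenB by (intro nth_equalityI) (simp_all add: list_all2_lengthD[OF xi])
    have "homs C X (mDom multi (gs ! i)) (yss ! i)" if "i < length gs" for i
      using homs_reindex[OF xi[OF that]] re[OF that] that lenx by (simp add: yss_def)
    then have yss: "homss X gs yss" using lenx by (simp add: list_all2_conv_all_nth yss_def)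
    have "map ((!) xs) ?\<tau> = concat yss"
      using map_juxtaposition(2)[of \<sigma>s xss] ran lens lenx list_all2_lengthD[OF xi]
      by (simp add: xs' lenxi yss_def)
    then have "interp (mAct multi (concat Bss) ?\<tau> (mComp multi f gs)) X xs = interp f X (interps X gs yss)"
      using interp_mAct[OF fg \<tau> Bs X xs] interp_mComp[OF c X yss] by simp
    also have "interps X gs yss = interps X ks xss"
    proof (rule nth_equalityI)
      fix i assume "i < length (interps X gs yss)"
      then have i: "i < length gs" by simp
      then show "interps X gs yss ! i = interps X ks xss ! i"
        using interp_mAct[OF g[OF i] _ _ X xi[OF i]] re[OF i] lenx lenk
        by (simp add: yss_def ks_def)
    qed (use lenx lenk in \<open>simp add: yss_def\<close>)
    finally show "interp (mComp multi f ks) X xs =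
        interp (mAct multi (concat Bss) ?\<tau> (mComp multi f gs)) X xs"
      using interp_mComp[OF d X xss] xs' by simp
  qed
qed

text \<open>On a tuple, selecting blocks of arguments by \<open>\<sigma>\<close> before applying the
  arrows of \<open>gs\<close>, or selecting their values afterwards, gives \<open>f\<close> the same
  list.\<close>

lemma mAct_mComp:
  assumes f: "f \<in> mAr multi" and gs: "set gs \<subseteq> mAr multi"
    and \<sigma>: "reindexing \<sigma> (mDom multi f) (map (mCod multi) gs)"
  shows "mComp multi (mAct multi (map (mCod multi) gs) \<sigma> f) gs =
    mAct multi (concat (map (mDom multi) gs)) (block_mapping (map (\<lambda>g. length (mDom multi g)) gs) \<sigma>)
      (mComp multi f (map ((!) gs) \<sigma>))"
proof -
  let ?\<Gamma> = "concat (map (mDom multi) gs)"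
  let ?\<tau> = "block_mapping (map (\<lambda>g. length (mDom multi g)) gs) \<sigma>"
  define ks where "ks = map ((!) gs) \<sigma>"
  note f' = mAr_multi_mhom[OF f]
  have ran: "set \<sigma> \<subseteq> {..<length gs}" and dom: "mDom multi f = map ((!) (map (mCod multi) gs)) \<sigma>"
    using \<sigma> by (auto simp: reindexing_def)
  have g: "gs ! i \<in> mhom multi (mDom multi (gs ! i)) (mCod multi (gs ! i))" if "i < length gs" for i
    using gs that by (auto simp: mhom_def)
  have Cods: "set (map (mCod multi) gs) \<subseteq> Ob C"
    using gs mAr_multi_mhom hom_Ob(2) by (fastforce simp: mhom_multi)
  have act: "mAct multi (map (mCod multi) gs) \<sigma> f \<in> mhom multi (map (mCod multi) gs) (mCod multi f)"
    using mAct_in_hom[OF f' Cods \<sigma>] .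
  then have c: "composable multi (mAct multi (map (mCod multi) gs) \<sigma> f) gs"
    using gs by (simp add: composable_def mhom_def)
  have "map (mCod multi) ks = mDom multi f" "set ks \<subseteq> mAr multi"
    using ran gs by (auto simp: ks_def dom subset_iff)
  then have d: "composable multi f ks" using f by (simp add: composable_def)
  note fk = mComp_in_hom[OF d]
  have \<Gamma>: "set ?\<Gamma> \<subseteq> Ob C" using gs mDom_Ob by fastforce
  have "map ((!) (map (mDom multi) gs)) \<sigma> = map (mDom multi) ks"
    using ran by (auto simp: ks_def subset_iff)
  then have \<tau>: "reindexing ?\<tau> (concat (map (mDom multi) ks)) ?\<Gamma>"
    using map_block_mapping[of \<sigma> "map (mDom multi) gs"] ran by (simp add: reindexing_def comp_def)
  show ?thesis
    unfolding ks_def[symmetric]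
  proof (rule multi_eqI)
    show "mComp multi (mAct multi (map (mCod multi) gs) \<sigma> f) gs \<in> mhom multi ?\<Gamma> (mCod multi f)"
      using mComp_in_hom[OF c] mhomD(3)[OF act] by simp
    show "mAct multi ?\<Gamma> ?\<tau> (mComp multi f ks) \<in> mhom multi ?\<Gamma> (mCod multi f)"
      using mAct_in_hom[OF fk \<Gamma> \<tau>] .
    fix X xs assume X: "X \<in> Ob C" and xs: "homs C X ?\<Gamma> xs"
    obtain xss where xs': "xs = concat xss" and xss: "homss X gs xss"
      using xs by (rule homs_concat_mDomE)
    have lenx: "length xss = length gs" using list_all2_lengthD[OF xss] .
    have xi: "homs C X (mDom multi (gs ! i)) (xss ! i)" if "i < length gs" for i
      using xss that by (simp add: list_all2_conv_all_nth)
    have lens: "map (\<lambda>g. length (mDom multi g)) gs = map length xss"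
      using lenx by (intro nth_equalityI) (simp_all add: list_all2_lengthD[OF xi])
    have yss: "homss X ks (map ((!) xss) \<sigma>)"
      using ran xi by (auto simp: ks_def list_all2_conv_all_nth subset_iff)
    have "map ((!) xs) ?\<tau> = concat (map ((!) xss) \<sigma>)"
      using map_block_mapping(2)[of \<sigma> xss] ran lenx by (simp add: xs' lens)
    then have "interp (mAct multi ?\<Gamma> ?\<tau> (mComp multi f ks)) X xs = interp f X (interps X ks (map ((!) xss) \<sigma>))"
      using interp_mAct[OF fk \<tau> \<Gamma> X xs] interp_mComp[OF d X yss] by simp
    also have "interps X ks (map ((!) xss) \<sigma>) = map ((!) (interps X gs xss)) \<sigma>"
      using ran lenx by (auto simp: ks_def subset_iff intro!: nth_equalityI)
    also have "interp f X \<dots> = interp (mAct multi (map (mCod multi) gs) \<sigma> f) X (interps X gs xss)"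
      using interp_mAct[OF f' \<sigma> Cods X interps_homs[OF gs xss X]] by simp
    finally show "interp (mComp multi (mAct multi (map (mCod multi) gs) \<sigma> f) gs) X xs =
        interp (mAct multi ?\<Gamma> ?\<tau> (mComp multi f ks)) X xs"
      using interp_mComp[OF c X xss] xs' by simp
  qed
qed

lemma cartesian_multicategory_multi: "cartesian_multicategory multi"
proof (intro cartesian_multicategory.intro multicategory.intro cartesian_multicategory_axioms.intro)
  fix f assume f: "f \<in> mAr multi"
  note f' = mAr_multi_mhom[OF f]
  show "set (mDom multi f) \<subseteq> mOb multi" using mDom_Ob[OF f] by simp
  show "mCod multi f \<in> mOb multi" using f' hom_Ob by (auto simp: mhom_multi)
  show "mAct multi (mDom multi f) [0..<length (mDom multi f)] f = f"
  proof (rule multi_eqI[OF _ f'])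
    have re: "reindexing [0..<length (mDom multi f)] (mDom multi f) (mDom multi f)"
      by (simp add: reindexing_def map_nth atLeast0LessThan)
    show "mAct multi (mDom multi f) [0..<length (mDom multi f)] f \<in> mhom multi (mDom multi f) (mCod multi f)"
      using mAct_in_hom[OF f' mDom_Ob[OF f] re] .
    fix X xs assume X: "X \<in> Ob C" and xs: "homs C X (mDom multi f) xs"
    have "map ((!) xs) [0..<length (mDom multi f)] = xs"
      using list_all2_lengthD[OF xs] map_nth[of xs] by simp
    then show "interp (mAct multi (mDom multi f) [0..<length (mDom multi f)] f) X xs = interp f X xs"
      using interp_mAct[OF f' re mDom_Ob[OF f] X xs] by simp
  qed
next
  fix f Bs \<sigma> Cs \<rho>
  assume f: "f \<in> mAr multi" and Bs: "set Bs \<subseteq> mOb multi" and \<sigma>: "reindexing \<sigma> (mDom multi f) Bs"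
    and Cs: "set Cs \<subseteq> mOb multi" and \<rho>: "reindexing \<rho> Bs Cs"
  note f' = mAr_multi_mhom[OF f]
  have BC: "set Bs \<subseteq> Ob C" "set Cs \<subseteq> Ob C" using Bs Cs by simp_all
  note act = mAct_in_hom[OF f' BC(1) \<sigma>]
  have len: "length Bs = length \<rho>" using \<rho> by (auto simp: reindexing_def)
  have "Bs = map ((!) Cs) \<rho>" "set \<sigma> \<subseteq> {..<length \<rho>}"
    using \<sigma> \<rho> by (auto simp: reindexing_def)
  then have "map ((!) Bs) \<sigma> = map ((!) Cs) (map ((!) \<rho>) \<sigma>)"
    by (auto simp: subset_iff)
  then have \<rho>\<sigma>: "reindexing (map ((!) \<rho>) \<sigma>) (mDom multi f) Cs"
    using \<sigma> \<rho> len unfolding reindexing_def by (auto simp: subset_iff simp del: map_map)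
  show "mAct multi Cs \<rho> (mAct multi Bs \<sigma> f) = mAct multi Cs (map ((!) \<rho>) \<sigma>) f"
  proof (rule multi_eqI[OF mAct_in_hom[OF act BC(2) \<rho>] mAct_in_hom[OF f' BC(2) \<rho>\<sigma>]])
    fix X xs assume X: "X \<in> Ob C" and xs: "homs C X Cs xs"
    have "map ((!) (map ((!) xs) \<rho>)) \<sigma> = map ((!) xs) (map ((!) \<rho>) \<sigma>)"
      using \<sigma> len by (auto simp: reindexing_def subset_iff)
    then show "interp (mAct multi Cs \<rho> (mAct multi Bs \<sigma> f)) X xs =
        interp (mAct multi Cs (map ((!) \<rho>) \<sigma>) f) X xs"
      using interp_mAct[OF act \<rho> BC(2) X xs] interp_mAct[OF f' \<sigma> BC(1) X homs_reindex[OF xs \<rho>]]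
        interp_mAct[OF f' \<rho>\<sigma> BC(2) X xs] by metis
  qed
next
  fix f Bs \<sigma> assume "f \<in> mAr multi" "set Bs \<subseteq> mOb multi" "reindexing \<sigma> (mDom multi f) Bs"
  then show "mAct multi Bs \<sigma> f \<in> mhom multi Bs (mCod multi f)"
    using mAct_in_hom[OF mAr_multi_mhom] by simp
qed (simp_all add: mIdent_in_hom mComp_in_hom mComp_ident_left mComp_ident_right mComp_assoc mComp_mAct
    mAct_mComp)

sublocale multi: cartesian_multicategory multi
  by (rule cartesian_multicategory_multi)

section \<open>Representability of \<open>multi\<close> and its unary part\<close>

lemma interp_projection:
  assumes \<Gamma>: "set \<Gamma> \<subseteq> Ob C" and i: "i < length \<Gamma>" and X: "X \<in> Ob C" and xs: "homs C X \<Gamma> xs"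
  shows "interp (projection multi \<Gamma> i) X xs = xs ! i"
proof -
  have A: "\<Gamma> ! i \<in> Ob C" using \<Gamma> i by auto
  have "reindexing [i] [\<Gamma> ! i] \<Gamma>" using i by (simp add: reindexing_def)
  then show ?thesis
    using interp_mAct[OF mIdent_in_hom[OF A] _ \<Gamma> X xs] interp_mIdent[OF A] xs i
    by (simp add: projection_def list_all2_conv_all_nth)
qed

text \<open>The contraction hands the same tuple \<open>xs\<close> to every arrow of
  \<open>gs\<close>.\<close>

lemma interp_substitute:
  assumes f: "f \<in> mhom multi As B" and gs: "mhoms multi \<Gamma> As gs" and \<Gamma>: "set \<Gamma> \<subseteq> Ob C"
    and X: "X \<in> Ob C" and xs: "homs C X \<Gamma> xs"
  shows "interp (substitute multi \<Gamma> f gs) X xs = interp f X (map (\<lambda>g. interp g X xs) gs)"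
proof -
  note fg = multi.mcomp_mhoms_in_hom[OF f gs]
  let ?c = "concat (replicate (length gs) [0..<length \<Gamma>])"
  have len: "length xs = length \<Gamma>" using list_all2_lengthD[OF xs] .
  have "reindexing ?c (concat (replicate (length As) \<Gamma>)) \<Gamma>"
    using mhomsD(1)[OF gs] by (auto simp: reindexing_def map_nth_concat_replicate)
  then have "interp (substitute multi \<Gamma> f gs) X xs =
      interp (mComp multi f gs) X (concat (replicate (length gs) xs))"
    using interp_mAct[OF fg _ \<Gamma> X xs] by
      (simp add: substitute_def map_nth_concat_replicate flip: len)
  also have "\<dots> = interp f X (interps X gs (replicate (length gs) xs))"
    using gs xs by (intro interp_mComp[OF composable_mhoms[OF f gs] X])
      (simp add: list_all2_conv_all_nth mhom_def)
  also have "interps X gs (replicate (length gs) xs) = map (\<lambda>g. interp g X xs) gs"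
    by (rule nth_equalityI) simp_all
  finally show ?thesis .
qed

lemma interp_mComp_unary:
  assumes "f \<in> mhom multi [A] B" "g \<in> mhom multi \<Gamma> A" "X \<in> Ob C" "homs C X \<Gamma> xs"
  shows "interp (mComp multi f [g]) X xs = interp f X [interp g X xs]"
  using interp_mComp[of f "[g]" X "[xs]"] assms by (simp add: composable_def mhom_def)

text \<open>The Yoneda embedding on arrows. What is stored is \<open>f\<close> after the projection
  from \<open>Prod [Dom C f]\<close>, since this chosen product need not be \<open>Dom C f\<close>
  itself.\<close>

definition lift :: "'a \<Rightarrow> 'a" where
  "lift f = code [Dom C f] (\<lambda>X xs. Comp C f (hd xs))"

lemma natural_lift:
  assumes f: "f \<in> hom C A B"
  shows "natural [A] B (\<lambda>X xs. Comp C f (hd xs))"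
  using comp_in_hom[OF _ f] comp_assoc[OF _ _ f] hom_Ob(1)[OF f]
  by (auto simp: natural_def list_all2_Cons2)

lemma lift_in_hom: "f \<in> hom C A B \<Longrightarrow> lift f \<in> mhom multi [A] B"
  using code_in_hom[OF natural_lift] homD(2) unfolding lift_def by metis

lemma interp_lift: "\<lbrakk>f \<in> hom C A B; x \<in> hom C X A\<rbrakk> \<Longrightarrow> interp (lift f) X [x] = Comp C f x"
  using interp_code[OF natural_lift, of f A B X "[x]"] hom_Ob[of x X A] by
    (simp add: lift_def hom_def)

text \<open>The transformation \<open>pair As\<close> is universal for \<open>As\<close>, with the
  lifted \<open>Proj As\<close> as projections. The two equations of a universal tuple become
  existence and uniqueness of mediating arrows.\<close>

lemma representable_multi: "representable multi"
proof -
  have "\<exists>u ps. universal_tuple multi As (Prod As) u ps" if "set As \<subseteq> mOb multi" for As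
  proof -
    have As: "set As \<subseteq> Ob C" using that by simp
    note P = Prod_Ob[OF As] and ps = Proj_homs[OF As]
    have nat: "natural As (Prod As) (pair As)"
      using pair(1)[OF As] pair_comp[OF As] As by (simp add: natural_def)
    define u where "u = code As (pair As)"
    have u: "u \<in> mhom multi As (Prod As)" using code_in_hom[OF nat] by (simp add: u_def)
    have iu: "interp u X xs = pair As X xs" if "X \<in> Ob C" "homs C X As xs" for X xs
      using interp_code[OF nat that] by (simp add: u_def)
    have lps: "mhoms multi [Prod As] As (map lift (Proj As))"
      using ps lift_in_hom by (auto simp: list_all2_conv_all_nth)
    have "mComp multi (lift (Proj As ! i)) [u] = projection multi As i" if i: "i < length As" for i
    proof (rule multi_eqI)
      have p: "Proj As ! i \<in> hom C (Prod As) (As ! i)"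
        using ps i by (simp add: list_all2_conv_all_nth)
      show "mComp multi (lift (Proj As ! i)) [u] \<in> mhom multi As (As ! i)"
        using multi.mcomp_unary_in_hom[OF lift_in_hom[OF p] u] .
      show "projection multi As i \<in> mhom multi As (As ! i)"
        using multi.projection_in_hom[of As i] As i by simp
      fix X xs assume X: "X \<in> Ob C" and xs: "homs C X As xs"
      note q = pair[OF As X xs]
      have "Comp C (Proj As ! i) (pair As X xs) = xs ! i"
        using arg_cong[OF q(2), of "\<lambda>ys. ys ! i"] i list_all2_lengthD[OF ps] by simp
      then show "interp (mComp multi (lift (Proj As ! i)) [u]) X xs = interp (projection multi As i) X xs"
        using interp_mComp_unary[OF lift_in_hom[OF p] u X xs] iu[OF X xs] interp_lift[OF p q(1)]
          interp_projection[OF As i X xs] by simp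
    qed
    then have "map (\<lambda>p. mComp multi p [u]) (map lift (Proj As)) =
        map (projection multi As) [0..<length As]"
      using list_all2_lengthD[OF ps] by (auto intro!: nth_equalityI)
    moreover have "substitute multi [Prod As] u (map lift (Proj As)) = mIdent multi (Prod As)"
    proof (rule multi_eqI)
      show "substitute multi [Prod As] u (map lift (Proj As)) \<in> mhom multi [Prod As] (Prod As)"
        using multi.substitute_in_hom[OF u lps] P by simp
      show "mIdent multi (Prod As) \<in> mhom multi [Prod As] (Prod As)" using mIdent_in_hom[OF P] .
      fix X xs assume X: "X \<in> Ob C" and xs: "homs C X [Prod As] xs"
      obtain h where h: "xs = [h]" "h \<in> hom C X (Prod As)" using xs by (auto simp: list_all2_Cons2)
      have l: "map (\<lambda>g. interp g X [h]) (map lift (Proj As)) = map (\<lambda>p. Comp C p h) (Proj As)"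
        using homs_elem[OF ps] interp_lift h(2) by fastforce
      have "interp (substitute multi [Prod As] u (map lift (Proj As))) X xs =
          pair As X (map (\<lambda>p. Comp C p h) (Proj As))"
        using interp_substitute[OF u lps _ X xs] P iu[OF X comp_homs[OF ps h(2)]] l h(1)
        by (simp del: map_map)
      then show "interp (substitute multi [Prod As] u (map lift (Proj As))) X xs =
          interp (mIdent multi (Prod As)) X xs"
        using pair_Proj_comp[OF As h(2)] interp_mIdent[OF P h(2)] h(1) by simp
    qed
    ultimately show ?thesis using u lps unfolding universal_tuple_def by blast
  qed
  then show ?thesis using multi.representable_iff_universal_tuples by blast
qed

text \<open>A unary transformation is recovered from its value at the identity, as in the Yoneda
  lemma.\<close>

definition eval_ident :: "'a \<Rightarrow> 'a" where
  "eval_ident a = interp a (hd (mDom multi a)) [Ident C (hd (mDom multi a))]"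

lemma eval_ident_in_hom: "a \<in> mhom multi [A] B \<Longrightarrow> eval_ident a \<in> hom C A B"
  using interp_in_hom[of a "[A]" B A "[Ident C A]"] ident_in_hom[of A]
    multi.mhom_Ob(1)[of a "[A]" B]
  by (simp add: eval_ident_def mhom_def)

lemma eval_ident_lift: "f \<in> hom C A B \<Longrightarrow> eval_ident (lift f) = f"
  using interp_lift[of f A B "Ident C A" A] ident_in_hom[of A] ident_right lift_in_hom[of f A B]
    hom_Ob(1)[of f A B]
  by (simp add: eval_ident_def mhom_def)

text \<open>By naturality along \<open>h\<close>, the value of \<open>a\<close> at \<open>h\<close>
  is its value at the identity of \<open>A\<close> precomposed with \<open>h\<close>.\<close>

lemma lift_eval_ident:
  assumes a: "a \<in> mhom multi [A] B"
  shows "lift (eval_ident a) = a"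
proof (rule multi_eqI[OF lift_in_hom[OF eval_ident_in_hom[OF a]] a])
  fix X xs assume X: "X \<in> Ob C" and "homs C X [A] xs"
  then obtain h where h: "xs = [h]" "h \<in> hom C X A" by (auto simp: list_all2_Cons2)
  have A: "A \<in> Ob C" using hom_Ob[OF h(2)] by simp
  show "interp (lift (eval_ident a)) X xs = interp a X xs"
    using interp_lift[OF eval_ident_in_hom[OF a] h(2)] interp_comp[OF a A _ h(2), of "[Ident C A]"]
      ident_in_hom[OF A] ident_left[OF h(2)] mhomD(2)[OF a] h(1)
    by (simp add: eval_ident_def)
qed

lemma lift_functor: "cat_functor C (unary_category multi) id lift"
proof (intro cat_functor.intro cat_functor_axioms.intro category_axioms multi.category_unary_category)
  fix f A B g E assume f: "f \<in> hom C A B" and g: "g \<in> hom C B E"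
  note gf = multi.mcomp_unary_in_hom[OF lift_in_hom[OF g] lift_in_hom[OF f]]
  show "lift (Comp C g f) = Comp (unary_category multi) (lift g) (lift f)"
    unfolding unary_category_simps
  proof (rule multi_eqI[OF lift_in_hom[OF comp_in_hom[OF f g]] gf])
    fix X xs assume X: "X \<in> Ob C" and xs: "homs C X [A] xs"
    then obtain h where h: "xs = [h]" "h \<in> hom C X A" by (auto simp: list_all2_Cons2)
    show "interp (lift (Comp C g f)) X xs = interp (mComp multi (lift g) [lift f]) X xs"
      using interp_mComp_unary[OF lift_in_hom[OF g] lift_in_hom[OF f] X xs] h
        interp_lift[OF comp_in_hom[OF f g] h(2)] interp_lift[OF f h(2)]
        interp_lift[OF g comp_in_hom[OF h(2) f]] comp_assoc[OF h(2) f g] by simp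
  qed
next
  fix A assume A: "A \<in> Ob C"
  have "eval_ident (mIdent multi A) = Ident C A"
    using interp_mIdent[OF A ident_in_hom[OF A]] mIdent_in_hom[OF A] by
      (simp add: eval_ident_def mhom_def)
  then show "lift (Ident C A) = Ident (unary_category multi) (id A)"
    using lift_eval_ident[OF mIdent_in_hom[OF A]] by simp
qed (use lift_in_hom in auto)

text \<open>Functoriality is inherited from \<open>lift\<close>, whose inverse on arrows this
  is.\<close>

lemma eval_ident_functor: "cat_functor (unary_category multi) C id eval_ident"
proof (intro cat_functor.intro cat_functor_axioms.intro category_axioms multi.category_unary_category)
  interpret L: cat_functor C "unary_category multi" id lift by (rule lift_functor)
  fix f A B g E assume "f \<in> hom (unary_category multi) A B" "g \<in> hom (unary_category multi) B E"
  then have f: "f \<in> mhom multi [A] B" and g: "g \<in> mhom multi [B] E" by simp_all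
  note f' = eval_ident_in_hom[OF f] and g' = eval_ident_in_hom[OF g]
  show "eval_ident (Comp (unary_category multi) g f) = Comp C (eval_ident g) (eval_ident f)"
    using L.map_comp[OF f' g'] lift_eval_ident[OF f] lift_eval_ident[OF g]
      eval_ident_lift[OF comp_in_hom[OF f' g']] by simp
next
  fix A assume A: "A \<in> Ob (unary_category multi)"
  then show "eval_ident (Ident (unary_category multi) A) = Ident C (id A)"
    using eval_ident_lift[OF ident_in_hom[of A]] cat_functor.map_ident[OF lift_functor, of A] by
      simp
qed (use eval_ident_in_hom in auto)

end

text \<open>A cone in \<open>D\<close> is sent back to \<open>C\<close> by the inverse functor,
  factored there, and its factorisation is sent forward again.\<close>

lemma inverse_functor_preserves_products:
  assumes F: "cat_functor C D Fo Fa" and G: "cat_functor D C Go Ga"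
    and GFo: "\<And>A. A \<in> Ob C \<Longrightarrow> Go (Fo A) = A" and GFa: "\<And>A B f. f \<in> hom C A B \<Longrightarrow> Ga (Fa f) = f"
    and FGo: "\<And>A. A \<in> Ob D \<Longrightarrow> Fo (Go A) = A" and FGa: "\<And>A B f. f \<in> hom D A B \<Longrightarrow> Fa (Ga f) = f"
  shows "finite_product_functor C D Fo Fa"
proof -
  interpret F: cat_functor C D Fo Fa by (rule F)
  interpret G: cat_functor D C Go Ga by (rule G)
  show ?thesis
  proof (intro finite_product_functor.intro finite_product_functor_axioms.intro F)
    fix As P ps assume As: "set As \<subseteq> Ob C" and prod: "is_product C As P ps"
    have P: "P \<in> Ob C" and ps: "homs C P As ps" using prod by (auto simp: is_product_def)
    have univ: "\<exists>!h. h \<in> hom C X P \<and> map (\<lambda>p. Comp C p h) ps = fs"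
      if "X \<in> Ob C" "homs C X As fs" for X fs
      using prod that by (auto simp: is_product_def)
    have p_in: "\<exists>A. p \<in> hom C P A" if "p \<in> set ps" for p
      using ps that by (auto simp: list_all2_conv_all_nth in_set_conv_nth)
    have "\<exists>!h. h \<in> hom D Y (Fo P) \<and> map (\<lambda>p. Comp D p h) (map Fa ps) = fs"
      if Y: "Y \<in> Ob D" and fs: "homs D Y (map Fo As) fs" for Y fs
    proof -
      have "Ga (fs ! i) \<in> hom C (Go Y) (As ! i)" if "i < length As" for i
        using fs that G.map_hom[of "fs ! i" Y "Fo (As ! i)"] GFo[OF subsetD[OF As nth_mem[OF that]]]
        by (auto simp: list_all2_conv_all_nth)
      then have Gfs: "homs C (Go Y) As (map Ga fs)"
        using fs by (simp add: list_all2_conv_all_nth)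
      have FG: "map Fa (map Ga fs) = fs"
      proof -
        have "\<exists>A. f \<in> hom D Y A" if "f \<in> set fs" for f
          using fs that by (auto simp: list_all2_conv_all_nth in_set_conv_nth)
        then show ?thesis using FGa by (metis list.map_comp comp_apply map_idI)
      qed
      obtain h where h: "h \<in> hom C (Go Y) P" "map (\<lambda>p. Comp C p h) ps = map Ga fs"
        and h_unique: "\<And>k. \<lbrakk>k \<in> hom C (Go Y) P; map (\<lambda>p. Comp C p k) ps = map Ga fs\<rbrakk> \<Longrightarrow> k = h"
        using univ[OF G.map_Ob[OF Y] Gfs] by blast
      show ?thesis
      proof (intro ex1I conjI)
        show "Fa h \<in> hom D Y (Fo P)" using F.map_hom[OF h(1)] FGo[OF Y] by simp
        have "map (\<lambda>p. Comp D p (Fa h)) (map Fa ps) = map Fa (map (\<lambda>p. Comp C p h) ps)"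
          using p_in F.map_comp[OF h(1)] by fastforce
        then show "map (\<lambda>p. Comp D p (Fa h)) (map Fa ps) = fs" using h(2) FG by simp
      next
        fix k assume k: "k \<in> hom D Y (Fo P) \<and> map (\<lambda>p. Comp D p k) (map Fa ps) = fs"
        then have Gk: "Ga k \<in> hom C (Go Y) P" using G.map_hom[of k Y "Fo P"] GFo[OF P] by simp
        have "map (\<lambda>p. Comp C p (Ga k)) ps = map Ga (map (\<lambda>p. Comp D p k) (map Fa ps))"
          using p_in k G.map_comp[of k Y "Fo P"] F.map_hom GFa by fastforce
        then have "Ga k = h" using h_unique[OF Gk] k by (simp del: map_map)
        then show "k = Fa h" using k FGa[of k Y "Fo P"] by auto
      qed
    qed
    moreover have "homs D (Fo P) (map Fo As) (map Fa ps)"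
      using ps F.map_hom by (auto simp: list_all2_conv_all_nth)
    ultimately show "is_product D (map Fo As) (Fo P) (map Fa ps)"
      using F.map_Ob[OF P] by (simp add: is_product_def)
  qed
qed

text \<open>An infinite type admits an injective pairing and an injection from the naturals; lists
  are folded up by the pairing.\<close>

lemma ex_list_coding:
  assumes "infinite (UNIV :: 'a set)"
  obtains \<iota> :: "'a list \<times> 'a \<Rightarrow> 'a" where "inj \<iota>"
proof -
  obtain p :: "'a \<times> 'a \<Rightarrow> 'a" where p: "inj p"
    using card_of_Times_same_infinite[OF assms] unfolding card_of_ordIso[symmetric] bij_betw_def
    by auto
  obtain n :: "nat \<Rightarrow> 'a" where n: "inj n"
    using infinite_countable_subset[OF assms] by blast
  \<comment> \<open>The start value \<open>n 0\<close> may itself be the code of a pair, so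
    \<open>l\<close> is shown to separate only lists of equal length, and the length is stored as
    well.\<close>
  define l where "l = (\<lambda>xs. foldr (\<lambda>x y. p (x, y)) xs (n 0))"
  have l: "xs = ys" if "length xs = length ys" "l xs = l ys" for xs ys
    using that by (induction rule: list_induct2) (auto simp: l_def dest: injD[OF p])
  have "inj (\<lambda>(xs, x). p (p (n (length xs), l xs), x))"
    by (rule injI) (auto dest!: injD[OF p] injD[OF n] intro: l)
  then show thesis by (rule that)
qed

text \<open>The object type may be larger than the arrow type, so objects are coded by their
  identity arrows. This is injective on \<open>Ob C\<close>, hence the restriction of
  \<open>enc\<close> to lists of objects of \<open>C\<close>.\<close>

lemma (in finite_product_category) ex_encoded_products:
  assumes "infinite (UNIV :: 'a set)"
  shows "\<exists>Prod Proj enc dec. encoded_products C Prod Proj enc dec"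
proof -
  obtain \<iota> :: "'a list \<times> 'a \<Rightarrow> 'a" where \<iota>: "inj \<iota>" using ex_list_coding[OF assms] .
  define enc where "enc = (\<lambda>(As, f). \<iota> (map (Ident C) As, f))"
  have "inj_on (Ident C) (Ob C)"
    using ident_in_hom by (intro inj_onI) (metis homD(2))
  then have "As = Bs"
    if "map (Ident C) As = map (Ident C) Bs" "set As \<subseteq> Ob C" "set Bs \<subseteq> Ob C" for As Bs
    using map_inj_on[OF that(1)] that(2,3) inj_on_subset by (metis Un_least)
  then have inj: "inj_on enc ({As. set As \<subseteq> Ob C} \<times> Ar C)"
    by (auto simp: enc_def inj_on_def dest!: injD[OF \<iota>])
  obtain Prod Proj where "\<And>As. set As \<subseteq> Ob C \<Longrightarrow> is_product C As (Prod As) (Proj As)"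
    using has_products by metis
  then have "encoded_products C Prod Proj enc (inv_into ({As. set As \<subseteq> Ob C} \<times> Ar C) enc)"
    using inv_into_f_f[OF inj] by unfold_locales auto
  then show ?thesis by blast
qed

text \<open>An isomorphism in \<open>fpCat\<close> is asked for, so an equivalence with the unary
  part would not do. It exists because \<open>multi\<close> has the very objects of
  \<open>C\<close>, while \<open>eval_ident\<close> and \<open>lift\<close> are strictly inverse on
  arrows and so both preserve products.\<close>

lemma unary_category_essentially_surjective:
  fixes C :: "('o, 'a) category"
  assumes "infinite (UNIV :: 'a set)" and C: "C \<in> Ob fpCat"
  shows "\<exists>M \<in> Ob fpRep. \<exists>e \<in> hom fpCat (unary_category M) C. is_iso fpCat e"
proof -
  interpret finite_product_category C using C by (simp add: Ob_fpCat)
  obtain Prod Proj enc dec where "encoded_products C Prod Proj enc dec"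
    using ex_encoded_products[OF assms(1)] by blast
  then interpret encoded_products C Prod Proj enc dec .
  let ?U = "unary_category multi"
  have U: "finite_product_category ?U"
    using multi.finite_product_category_unary_category[OF representable_multi] .
  define e where "e = \<lparr>Src = ?U, Trg = C, OMap = restrict id (Ob C), AMap = restrict eval_ident (Ar ?U)\<rparr>"
  define k where "k = \<lparr>Src = C, Trg = ?U, OMap = restrict id (Ob C), AMap = restrict lift (Ar C)\<rparr>"
  have le: "lift (eval_ident f) = f" if "f \<in> hom ?U A B" for f A B
    using lift_eval_ident that by simp
  have el: "eval_ident (lift f) = f" if "f \<in> hom C A B" for f A B
    using eval_ident_lift that .
  have "finite_product_functor ?U C id eval_ident"
    by (rule inverse_functor_preserves_products[OF eval_ident_functor lift_functor])
      (use le el in auto)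
  then have "finite_product_functor ?U C (restrict id (Ob C)) (restrict eval_ident (Ar ?U))"
    by (rule finite_product_functor_cong) auto
  then have e: "e \<in> hom fpCat ?U C"
    using U finite_product_category_axioms by (simp add: hom_fpCat e_def)
  have "finite_product_functor C ?U id lift"
    by (rule inverse_functor_preserves_products[OF lift_functor eval_ident_functor])
      (use le el in auto)
  then have "finite_product_functor C ?U (restrict id (Ob C)) (restrict lift (Ar C))"
    by (rule finite_product_functor_cong) auto
  then have k: "k \<in> hom fpCat C ?U"
    using U finite_product_category_axioms by (simp add: hom_fpCat k_def)
  have "compose (Ar ?U) (restrict lift (Ar C)) (restrict eval_ident (Ar ?U)) = restrict (\<lambda>f. f) (Ar ?U)"
  proof (rule extensionalityI)
    fix f assume f: "f \<in> Ar ?U"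
    then have f': "f \<in> mhom multi [hd (mDom multi f)] (mCod multi f)"
      by (auto simp: mhom_def length_Suc_conv)
    show "compose (Ar ?U) (restrict lift (Ar C)) (restrict eval_ident (Ar ?U)) f = restrict (\<lambda>f. f) (Ar ?U) f"
      using f lift_eval_ident[OF f'] homD(1)[OF eval_ident_in_hom[OF f']] by (simp add: compose_def)
  qed auto
  then have "Comp fpCat k e = Ident fpCat ?U"
    by (simp add: fpCat_def k_def e_def) (auto simp: compose_def)
  moreover have "compose (Ar C) (restrict eval_ident (Ar ?U)) (restrict lift (Ar C)) = restrict (\<lambda>f. f) (Ar C)"
  proof (rule extensionalityI)
    fix f assume f: "f \<in> Ar C"
    then have f': "f \<in> hom C (Dom C f) (Cod C f)" by (simp add: hom_def)
    have "lift f \<in> Ar ?U" using lift_in_hom[OF f'] by (simp add: mhom_def)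
    then show "compose (Ar C) (restrict eval_ident (Ar ?U)) (restrict lift (Ar C)) f = restrict (\<lambda>f. f) (Ar C) f"
      using f eval_ident_lift[OF f'] by (simp add: compose_def)
  qed auto
  then have "Comp fpCat e k = Ident fpCat C"
    by (simp add: fpCat_def k_def e_def) (auto simp: compose_def)
  ultimately have "is_iso fpCat e" by (rule is_isoI[OF e k])
  moreover have "multi \<in> Ob fpRep"
    using cartesian_multicategory_multi representable_multi by (simp add: Ob_fpRep)
  ultimately show ?thesis using e by blast
qed

theorem proposition4p9:
  assumes "infinite (UNIV :: 'a set)"
  shows "equivalent_categories
    (fpRep :: (('o, 'a) cartesian_multicategory,
      (('o, 'a) cartesian_multicategory, 'o, 'a) structure_map) category)
    (fpCat :: (('o, 'a) category, (('o, 'a) category, 'o, 'a) structure_map) category)"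
  by (rule equivalent_if_fully_faithful_essentially_surjective[OF unary_functor unary_map_faithful
        unary_map_full unary_category_essentially_surjective[OF assms]])

end
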